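(* Let $\mathbf{UArr}(Cat)$ denote the 2-category of universal arrows whose 1-cells are those $(J,V,\rho^{JV})$ with $JR=R^{\dagger}V$ and $\rho^{JV}$ the identity. Then the 2-functors $\Phi:\mathbf{UArr}(Cat)\longrightarrow\mathbf{EMnd}(Cat)$ and $\Psi:\mathbf{EMnd}(Cat)\longrightarrow\mathbf{UArr}(Cat)$ described in the context form a 2-adjunction $\Phi\dashv\Psi$, with $\Phi$ the left and $\Psi$ the right 2-adjoint.
   Context: **Universal arrows.** Let $Cat$ be the 2-category of (small) categories. A universal arrow $(\mathcal{C},R,\eta^{RL},\zeta^{R}(\sim))$ consists of a functor $R:\mathcal{X}\to\mathcal{C}$, a function on objects $L:\mathrm{Obj}(\mathcal{C})\to\mathrm{Obj}(\mathcal{X})$, and for each object $A$ of $\mathcal{C}$ a morphism $\eta^{RL}A:A\to RLA$ such that for each $v:A\to RX$ there is a unique $w:LA\to X$ with $Rw\cdot\eta^{RL}A=v$; one writes $\zeta^{RX}(v):=w$. The 2-category $\mathbf{UArr}(Cat)$ has these as 0-cells. In general a 1-cell $(J,V,\rho^{JV}):(\mathcal{C},R,\eta^{RL},\zeta^{R}(\sim))\to(\mathcal{D},R^{\dagger},\eta^{RL\dagger},\zeta^{R\dagger}(\sim))$, where $R:\mathcal{X}\to\mathcal{C}$ and $R^{\dagger}:\mathcal{Y}\to\mathcal{D}$, consists of functors $J:\mathcal{C}\to\mathcal{D}$, $V:\mathcal{X}\to\mathcal{Y}$ and a natural isomorphism $\rho^{JV}:JR\to R^{\dagger}V$ with inverse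 $\varrho^{JV}$ (in the present statement $\rho^{JV}$ is required to be an identity). A 2-cell $(\alpha,\beta):(J,V,\rho^{JV})\to(K,W,\rho^{KW})$ is a pair of natural transformations $\alpha:J\to K$, $\beta:V\to W$ with $R^{\dagger}\beta\circ\rho^{JV}=\rho^{KW}\circ\alpha R$. Composition of 1-cells is $(F,G,\rho^{FG})(J,V,\rho^{JV})=(FJ,GV,\rho^{FG}V\circ F\rho^{JV})$; 2-cells compose componentwise, vertically and horizontally, as in $Cat$. **Extensive monads.** An extensive monad $(\mathcal{C},S,\eta^{S},(\sim)^{S})$ consists of a category $\mathcal{C}$, a function $S:\mathrm{Obj}(\mathcal{C})\to\mathrm{Obj}(\mathcal{C})$, morphisms $\eta^{S}A:A\to SA$, and functions $(\sim)^{SB}:\mathrm{Hom}_{\mathcal{C}}(A,SB)\to\mathrm{Hom}_{\mathcal{C}}(SA,SB)$, $h\mapsto h^{SB}$, with $(\eta^{S}A)^{SA}=1_{SA}$, $h^{SB}\cdot\eta^{S}A=h$ and $(k^{SC}\cdot h)^{SC}=k^{SC}\cdot h^{SB}$ for $h:A\to SB$, $k:B\to SC$. An $S$-algebra $(N,(\sim)^{N})$ is an object $N$ with functions $(\sim)^{N}:\mathrm{Hom}_{\mathcal{C}}(A,N)\to\mathrm{Hom}_{\mathcal{C}}(SA,N)$ for all $A$, with $a^{N}\cdot\eta^{S}A=a$ and $(b^{N}\cdot h)^{N}=b^{N}\cdot h^{SB}$ for $a:A\to N$, $b:B\to N$, $h:A\to SB$. A morphism of $S$-algebras $(M,(\sim)^{M})\to(N,(\sim)^{N})$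 is $q:M\to N$ with $(q\cdot a)^{N}=q\cdot a^{M}$ for all $a:A\to M$. These form the category $\mathcal{C}^{S}$, with forgetful functor $U^{S}:\mathcal{C}^{S}\to\mathcal{C}$ and object function $F^{S}A=(SA,(\sim)^{SA})$. The 2-category $\mathbf{EMnd}(Cat)$ has extensive monads as 0-cells. A 1-cell $(P,(\sim)^{PS}):(\mathcal{C},S)\to(\mathcal{D},T)$ is a functor $P:\mathcal{C}\to\mathcal{D}$ with functions $(\sim)^{PSA}:\mathrm{Hom}_{\mathcal{D}}(D,PSA)\to\mathrm{Hom}_{\mathcal{D}}(TD,PSA)$ such that each $(PSA,(\sim)^{PSA})$ is a $T$-algebra and, for each $h:A\to SB$, $Ph^{SB}:PSA\to PSB$ (meaning $P(h^{SB})$) is a morphism of $T$-algebras. A 2-cell $(P,(\sim)^{PS})\to(Q,(\sim)^{QS})$ is a natural transformation $\theta:P\to Q$ such that each $\theta SA:PSA\to QSA$ is a morphism of $T$-algebras. The composite of $(P,(\sim)^{PS}):(\mathcal{C},S)\to(\mathcal{D},T)$ and $(W,(\sim)^{WT}):(\mathcal{D},T)\to(\mathcal{X},U)$ is $WP$ with $w^{WPSA}:=W\big((1_{PSA})^{PSA}\big)\cdot[W\eta^{T}PSA\cdot w]^{WTPSA}$ for $w:X\to WPSA$; the identity 1-cell is $(1_{\mathcal{C}},(\sim)^{S})$; 2-cells compose as natural transformations. **The 2-functor $\Phi$.** $\Phi(\mathcal{C},R,\eta^{RL},\zeta^{R}(\sim))=(\mathcal{C},RL,\eta^{RL},(\sim)^{RL})$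 with $h^{RLB}:=R\zeta^{RLB}(h)$ for $h:A\to RLB$, where $\zeta^{RLB}(h):LA\to LB$. $\Phi(J,V,\rho^{JV})=(J,(\sim)^{JRL})$ with $p^{JRLA}:=\varrho^{JV}LA\cdot R^{\dagger}\zeta^{R\dagger VLA}(\rho^{JV}LA\cdot p)$ for $p:D\to JRLA$. $\Phi(\alpha,\beta)=\alpha$. **The 2-functor $\Psi$.** $\Psi(\mathcal{C},S,\eta^{S},(\sim)^{S})=(\mathcal{C},U^{S},\eta^{S},\zeta^{US}(\sim))$ with $U^S:\mathcal{C}^S\to\mathcal{C}$, object function $F^S$ and $\zeta^{USN}(v)=v^{N}$ for $v:A\to N=U^{S}(N,(\sim)^{N})$. $\Psi(P,(\sim)^{PS})=(P,\widehat{P},1)$, where $\widehat{P}:\mathcal{C}^{S}\to\mathcal{D}^{T}$ is $\widehat{P}(N,(\sim)^{N})=(PN,(\sim)^{PN})$ with $q^{PN}:=P\big((1_{N})^{N}\big)\cdot(P\eta^{S}N\cdot q)^{PSN}$ for $q:D\to PN$, and $\widehat{P}m=Pm$; the third entry is the identity of $PU^{S}=U^{T}\widehat{P}$. $\Psi(\theta)=(\theta,\widehat{\theta})$ with $\widehat{\theta}(N,(\sim)^{N})=\theta N$. *)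

theory Defs
  imports Main "HOL-Library.FuncSet" "HOL-Library.Nat_Bijection"
begin

section \<open>Categories, functors, natural transformations\<close>

text \<open>
  Throughout, a function with domain \<open>A\<close> is a HOL function that is \<open>undefined\<close> outside \<open>A\<close>
  (the library's \<open>extensional\<close>, \<open>\<rightarrow>\<^sub>E\<close>, \<open>restrict\<close>, \<open>compose\<close>), so that HOL equality of categories,
  functors, transformations and so on is equality of the mathematical objects. This matters here
  because all the laws of 2-categories and 2-adjunctions below are strict equalities.
\<close>

record ('o, 'a) cat =
  Obj :: "'o set"
  Arr :: "'a set"
  Dom :: "'a \<Rightarrow> 'o"
  Cod :: "'a \<Rightarrow> 'o"
  Idn :: "'o \<Rightarrow> 'a"
  Comp :: "'a \<Rightarrow> 'a \<Rightarrow> 'a"  (infixl "\<cdot>\<index>" 70)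

definition hom :: "('o, 'a, 'z) cat_scheme \<Rightarrow> 'o \<Rightarrow> 'o \<Rightarrow> 'a set" where
  "hom C A B = {f \<in> Arr C. Dom C f = A \<and> Cod C f = B}"

text \<open>The union of all hom-sets with codomain \<open>B\<close>; a family of functions on \<open>Hom(A, B)\<close>, one for
  each object \<open>A\<close>, is the same as one function on this set.\<close>

definition arrows_into :: "('o, 'a, 'z) cat_scheme \<Rightarrow> 'o \<Rightarrow> 'a set" where
  "arrows_into C B = {f \<in> Arr C. Cod C f = B}"

locale category =
  fixes C :: "('o, 'a) cat" (structure)
  assumes Dom_type: "Dom C \<in> Arr C \<rightarrow>\<^sub>E Obj C"
    and Cod_type: "Cod C \<in> Arr C \<rightarrow>\<^sub>E Obj C"
    and Idn_ext: "Idn C \<in> extensional (Obj C)"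
    and Idn_hom: "A \<in> Obj C \<Longrightarrow> Idn C A \<in> hom C A A"
    and Comp_ext: "\<not> (f \<in> Arr C \<and> g \<in> Arr C \<and> Cod C f = Dom C g) \<Longrightarrow> g \<cdot> f = undefined"
    and Comp_hom: "f \<in> hom C A B \<Longrightarrow> g \<in> hom C B D \<Longrightarrow> g \<cdot> f \<in> hom C A D"
    and Idn_right: "f \<in> hom C A B \<Longrightarrow> f \<cdot> Idn C A = f"
    and Idn_left: "f \<in> hom C A B \<Longrightarrow> Idn C B \<cdot> f = f"
    and Comp_assoc: "f \<in> hom C A B \<Longrightarrow> g \<in> hom C B D \<Longrightarrow> h \<in> hom C D E \<Longrightarrow> h \<cdot> (g \<cdot> f) = (h \<cdot> g) \<cdot> f"

definition mk_cat :: "'o set \<Rightarrow> 'a set \<Rightarrow> ('a \<Rightarrow> 'o) \<Rightarrow> ('a \<Rightarrow> 'o) \<Rightarrow> ('o \<Rightarrow> 'a) \<Rightarrow> ('a \<Rightarrow> 'a \<Rightarrow> 'a)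
    \<Rightarrow> ('o, 'a) cat" where
  "mk_cat obs ars dm cd idn cmp =
    \<lparr>Obj = obs, Arr = ars, Dom = restrict dm ars, Cod = restrict cd ars, Idn = restrict idn obs,
     Comp = (\<lambda>g f. if f \<in> ars \<and> g \<in> ars \<and> cd f = dm g then cmp g f else undefined)\<rparr>"

definition is_inverse_arr :: "('o, 'a) cat \<Rightarrow> 'a \<Rightarrow> 'a \<Rightarrow> bool" where
  "is_inverse_arr C f g \<longleftrightarrow> f \<in> Arr C \<and> g \<in> hom C (Cod C f) (Dom C f) \<and>
     g \<cdot>\<^bsub>C\<^esub> f = Idn C (Dom C f) \<and> f \<cdot>\<^bsub>C\<^esub> g = Idn C (Cod C f)"

definition inverse_arr :: "('o, 'a) cat \<Rightarrow> 'a \<Rightarrow> 'a" where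
  "inverse_arr C f = (THE g. is_inverse_arr C f g)"

record ('o, 'a, 'p, 'b) func =
  onO :: "'o \<Rightarrow> 'p"
  onA :: "'a \<Rightarrow> 'b"

locale is_functor =
  fixes C :: "('o, 'a) cat" and D :: "('p, 'b) cat" and F :: "('o, 'a, 'p, 'b) func"
  assumes source: "category C"
    and target: "category D"
    and onO_type: "onO F \<in> Obj C \<rightarrow>\<^sub>E Obj D"
    and onA_ext: "onA F \<in> extensional (Arr C)"
    and onA_hom: "f \<in> hom C A B \<Longrightarrow> onA F f \<in> hom D (onO F A) (onO F B)"
    and onA_Idn: "A \<in> Obj C \<Longrightarrow> onA F (Idn C A) = Idn D (onO F A)"
    and onA_Comp: "f \<in> hom C A B \<Longrightarrow> g \<in> hom C B E \<Longrightarrow> onA F (g \<cdot>\<^bsub>C\<^esub> f) = onA F g \<cdot>\<^bsub>D\<^esub> onA F f"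

definition id_func :: "('o, 'a) cat \<Rightarrow> ('o, 'a, 'o, 'a) func" where
  "id_func C = \<lparr>onO = (\<lambda>A\<in>Obj C. A), onA = (\<lambda>f\<in>Arr C. f)\<rparr>"

definition comp_func :: "('o, 'a) cat \<Rightarrow> ('p, 'b, 'q, 'c) func \<Rightarrow> ('o, 'a, 'p, 'b) func
    \<Rightarrow> ('o, 'a, 'q, 'c) func" where
  "comp_func C G F =
    \<lparr>onO = compose (Obj C) (onO G) (onO F), onA = compose (Arr C) (onA G) (onA F)\<rparr>"

locale is_nat_trans =
  fixes C :: "('o, 'a) cat" and D :: "('p, 'b) cat" and F G :: "('o, 'a, 'p, 'b) func"
    and \<tau> :: "'o \<Rightarrow> 'b"
  assumes source: "is_functor C D F"
    and target: "is_functor C D G"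
    and ext: "\<tau> \<in> extensional (Obj C)"
    and component: "A \<in> Obj C \<Longrightarrow> \<tau> A \<in> hom D (onO F A) (onO G A)"
    and natural: "f \<in> hom C A B \<Longrightarrow> \<tau> B \<cdot>\<^bsub>D\<^esub> onA F f = onA G f \<cdot>\<^bsub>D\<^esub> \<tau> A"

definition is_nat_iso :: "('o, 'a) cat \<Rightarrow> ('p, 'b) cat \<Rightarrow> ('o, 'a, 'p, 'b) func
    \<Rightarrow> ('o, 'a, 'p, 'b) func \<Rightarrow> ('o \<Rightarrow> 'b) \<Rightarrow> bool" where
  "is_nat_iso C D F G \<tau> \<longleftrightarrow>
    is_nat_trans C D F G \<tau> \<and> (\<forall>A\<in>Obj C. \<exists>g. is_inverse_arr D (\<tau> A) g)"

definition id_nat :: "('o, 'a) cat \<Rightarrow> ('p, 'b) cat \<Rightarrow> ('o, 'a, 'p, 'b) func \<Rightarrow> 'o \<Rightarrow> 'b" where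
  "id_nat C D F = (\<lambda>A\<in>Obj C. Idn D (onO F A))"

definition vcomp :: "('o, 'a) cat \<Rightarrow> ('p, 'b) cat \<Rightarrow> ('o \<Rightarrow> 'b) \<Rightarrow> ('o \<Rightarrow> 'b) \<Rightarrow> 'o \<Rightarrow> 'b" where
  "vcomp C D \<tau> \<sigma> = (\<lambda>A\<in>Obj C. \<tau> A \<cdot>\<^bsub>D\<^esub> \<sigma> A)"

text \<open>Horizontal composite of \<open>\<tau> : F \<rightarrow> F'\<close> (functors from \<open>C\<close>) and \<open>\<sigma> : G \<rightarrow> G'\<close> (functors to \<open>E\<close>);
  only \<open>F'\<close> and \<open>G\<close> enter the formula.\<close>

definition hcomp :: "('o, 'a) cat \<Rightarrow> ('q, 'c) cat \<Rightarrow> ('p, 'b, 'q, 'c) func \<Rightarrow> ('p \<Rightarrow> 'c)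
    \<Rightarrow> ('o, 'a, 'p, 'b) func \<Rightarrow> ('o \<Rightarrow> 'b) \<Rightarrow> 'o \<Rightarrow> 'c" where
  "hcomp C E G \<sigma> F' \<tau> = (\<lambda>A\<in>Obj C. \<sigma> (onO F' A) \<cdot>\<^bsub>E\<^esub> onA G (\<tau> A))"


section \<open>2-categories, 2-functors, 2-adjunctions\<close>

text \<open>Strict 2-categories as \<open>Cat\<close>-enriched categories. Vertical composition is the composition of
  the hom-categories; \<open>Comp1 K A B C g f\<close> and \<open>Comp2 K A B C \<beta> \<alpha>\<close> are the actions on objects and on
  arrows of the composition functor \<open>Hom(B, C) \<times> Hom(A, B) \<rightarrow> Hom(A, C)\<close>.\<close>

record ('o, 'f, 's) two_cat =
  Ob :: "'o set"
  Hom :: "'o \<Rightarrow> 'o \<Rightarrow> ('f, 's) cat"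
  Id1 :: "'o \<Rightarrow> 'f"
  Comp1 :: "'o \<Rightarrow> 'o \<Rightarrow> 'o \<Rightarrow> 'f \<Rightarrow> 'f \<Rightarrow> 'f"
  Comp2 :: "'o \<Rightarrow> 'o \<Rightarrow> 'o \<Rightarrow> 's \<Rightarrow> 's \<Rightarrow> 's"

definition Id2 :: "('o, 'f, 's) two_cat \<Rightarrow> 'o \<Rightarrow> 'o \<Rightarrow> 'f \<Rightarrow> 's" where
  "Id2 K A B f = Idn (Hom K A B) f"

locale two_category =
  fixes K :: "('o, 'f, 's) two_cat"
  assumes hom_category: "\<lbrakk>A \<in> Ob K; B \<in> Ob K\<rbrakk> \<Longrightarrow> category (Hom K A B)"
    and Id1_type: "A \<in> Ob K \<Longrightarrow> Id1 K A \<in> Obj (Hom K A A)"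
    and Comp1_type:
      "\<lbrakk>A \<in> Ob K; B \<in> Ob K; C \<in> Ob K; f \<in> Obj (Hom K A B); g \<in> Obj (Hom K B C)\<rbrakk>
       \<Longrightarrow> Comp1 K A B C g f \<in> Obj (Hom K A C)"
    and Comp2_type:
      "\<lbrakk>A \<in> Ob K; B \<in> Ob K; C \<in> Ob K; \<alpha> \<in> hom (Hom K A B) f f'; \<beta> \<in> hom (Hom K B C) g g'\<rbrakk>
       \<Longrightarrow> Comp2 K A B C \<beta> \<alpha> \<in> hom (Hom K A C) (Comp1 K A B C g f) (Comp1 K A B C g' f')"
    and Comp2_Id2:
      "\<lbrakk>A \<in> Ob K; B \<in> Ob K; C \<in> Ob K; f \<in> Obj (Hom K A B); g \<in> Obj (Hom K B C)\<rbrakk>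
       \<Longrightarrow> Comp2 K A B C (Id2 K B C g) (Id2 K A B f) = Id2 K A C (Comp1 K A B C g f)"
    and interchange:
      "\<lbrakk>A \<in> Ob K; B \<in> Ob K; C \<in> Ob K;
        \<alpha> \<in> hom (Hom K A B) f f'; \<alpha>' \<in> hom (Hom K A B) f' f'';
        \<beta> \<in> hom (Hom K B C) g g'; \<beta>' \<in> hom (Hom K B C) g' g''\<rbrakk>
       \<Longrightarrow> Comp2 K A B C (\<beta>' \<cdot>\<^bsub>Hom K B C\<^esub> \<beta>) (\<alpha>' \<cdot>\<^bsub>Hom K A B\<^esub> \<alpha>)
         = Comp2 K A B C \<beta>' \<alpha>' \<cdot>\<^bsub>Hom K A C\<^esub> Comp2 K A B C \<beta> \<alpha>"
    and Comp1_assoc: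
      "\<lbrakk>A \<in> Ob K; B \<in> Ob K; C \<in> Ob K; D \<in> Ob K;
        f \<in> Obj (Hom K A B); g \<in> Obj (Hom K B C); h \<in> Obj (Hom K C D)\<rbrakk>
       \<Longrightarrow> Comp1 K A C D h (Comp1 K A B C g f) = Comp1 K A B D (Comp1 K B C D h g) f"
    and Comp2_assoc:
      "\<lbrakk>A \<in> Ob K; B \<in> Ob K; C \<in> Ob K; D \<in> Ob K;
        \<alpha> \<in> Arr (Hom K A B); \<beta> \<in> Arr (Hom K B C); \<gamma> \<in> Arr (Hom K C D)\<rbrakk>
       \<Longrightarrow> Comp2 K A C D \<gamma> (Comp2 K A B C \<beta> \<alpha>) = Comp2 K A B D (Comp2 K B C D \<gamma> \<beta>) \<alpha>"
    and Comp1_Id1_right: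
      "\<lbrakk>A \<in> Ob K; B \<in> Ob K; f \<in> Obj (Hom K A B)\<rbrakk> \<Longrightarrow> Comp1 K A A B f (Id1 K A) = f"
    and Comp1_Id1_left:
      "\<lbrakk>A \<in> Ob K; B \<in> Ob K; f \<in> Obj (Hom K A B)\<rbrakk> \<Longrightarrow> Comp1 K A B B (Id1 K B) f = f"
    and Comp2_Id1_right:
      "\<lbrakk>A \<in> Ob K; B \<in> Ob K; \<alpha> \<in> Arr (Hom K A B)\<rbrakk>
       \<Longrightarrow> Comp2 K A A B \<alpha> (Id2 K A A (Id1 K A)) = \<alpha>"
    and Comp2_Id1_left:
      "\<lbrakk>A \<in> Ob K; B \<in> Ob K; \<alpha> \<in> Arr (Hom K A B)\<rbrakk>
       \<Longrightarrow> Comp2 K A B B (Id2 K B B (Id1 K B)) \<alpha> = \<alpha>"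

record ('o, 'f, 's, 'p, 'g, 't) two_func =
  on0 :: "'o \<Rightarrow> 'p"
  on1 :: "'o \<Rightarrow> 'o \<Rightarrow> 'f \<Rightarrow> 'g"
  on2 :: "'o \<Rightarrow> 'o \<Rightarrow> 's \<Rightarrow> 't"

locale two_functor =
  source: two_category K + target: two_category L
  for K :: "('o, 'f, 's) two_cat" and L :: "('p, 'g, 't) two_cat" +
  fixes F :: "('o, 'f, 's, 'p, 'g, 't) two_func"
  assumes on0_type: "A \<in> Ob K \<Longrightarrow> on0 F A \<in> Ob L"
    and on1_type:
      "\<lbrakk>A \<in> Ob K; B \<in> Ob K; f \<in> Obj (Hom K A B)\<rbrakk>
       \<Longrightarrow> on1 F A B f \<in> Obj (Hom L (on0 F A) (on0 F B))"
    and on2_type: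
      "\<lbrakk>A \<in> Ob K; B \<in> Ob K; \<alpha> \<in> hom (Hom K A B) f f'\<rbrakk>
       \<Longrightarrow> on2 F A B \<alpha> \<in> hom (Hom L (on0 F A) (on0 F B)) (on1 F A B f) (on1 F A B f')"
    and on2_Id2:
      "\<lbrakk>A \<in> Ob K; B \<in> Ob K; f \<in> Obj (Hom K A B)\<rbrakk>
       \<Longrightarrow> on2 F A B (Id2 K A B f) = Id2 L (on0 F A) (on0 F B) (on1 F A B f)"
    and on2_vertical:
      "\<lbrakk>A \<in> Ob K; B \<in> Ob K; \<alpha> \<in> hom (Hom K A B) f f'; \<beta> \<in> hom (Hom K A B) f' f''\<rbrakk>
       \<Longrightarrow> on2 F A B (\<beta> \<cdot>\<^bsub>Hom K A B\<^esub> \<alpha>) = on2 F A B \<beta> \<cdot>\<^bsub>Hom L (on0 F A) (on0 F B)\<^esub> on2 F A B \<alpha>"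
    and on1_Id1: "A \<in> Ob K \<Longrightarrow> on1 F A A (Id1 K A) = Id1 L (on0 F A)"
    and on1_Comp1:
      "\<lbrakk>A \<in> Ob K; B \<in> Ob K; C \<in> Ob K; f \<in> Obj (Hom K A B); g \<in> Obj (Hom K B C)\<rbrakk>
       \<Longrightarrow> on1 F A C (Comp1 K A B C g f)
         = Comp1 L (on0 F A) (on0 F B) (on0 F C) (on1 F B C g) (on1 F A B f)"
    and on2_Comp2:
      "\<lbrakk>A \<in> Ob K; B \<in> Ob K; C \<in> Ob K; \<alpha> \<in> Arr (Hom K A B); \<beta> \<in> Arr (Hom K B C)\<rbrakk>
       \<Longrightarrow> on2 F A C (Comp2 K A B C \<beta> \<alpha>)
         = Comp2 L (on0 F A) (on0 F B) (on0 F C) (on2 F B C \<beta>) (on2 F A B \<alpha>)"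

definition id_two_func :: "('o, 'f, 's, 'o, 'f, 's) two_func" where
  "id_two_func = \<lparr>on0 = (\<lambda>A. A), on1 = (\<lambda>A B f. f), on2 = (\<lambda>A B \<alpha>. \<alpha>)\<rparr>"

definition comp_two_func :: "('p, 'g, 't, 'q, 'h, 'r) two_func \<Rightarrow> ('o, 'f, 's, 'p, 'g, 't) two_func
    \<Rightarrow> ('o, 'f, 's, 'q, 'h, 'r) two_func"  (infixl "\<circ>\<^sub>2" 55) where
  "G \<circ>\<^sub>2 F =
    \<lparr>on0 = (\<lambda>A. on0 G (on0 F A)),
     on1 = (\<lambda>A B f. on1 G (on0 F A) (on0 F B) (on1 F A B f)),
     on2 = (\<lambda>A B \<alpha>. on2 G (on0 F A) (on0 F B) (on2 F A B \<alpha>))\<rparr>"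

locale two_nat_trans =
  source: two_functor K L F + target: two_functor K L G
  for K :: "('o, 'f, 's) two_cat" and L :: "('p, 'g, 't) two_cat"
    and F G :: "('o, 'f, 's, 'p, 'g, 't) two_func" +
  fixes \<eta> :: "'o \<Rightarrow> 'g"
  assumes component: "A \<in> Ob K \<Longrightarrow> \<eta> A \<in> Obj (Hom L (on0 F A) (on0 G A))"
    and natural1:
      "\<lbrakk>A \<in> Ob K; B \<in> Ob K; f \<in> Obj (Hom K A B)\<rbrakk>
       \<Longrightarrow> Comp1 L (on0 F A) (on0 G A) (on0 G B) (on1 G A B f) (\<eta> A)
         = Comp1 L (on0 F A) (on0 F B) (on0 G B) (\<eta> B) (on1 F A B f)"
    and natural2:
      "\<lbrakk>A \<in> Ob K; B \<in> Ob K; \<alpha> \<in> Arr (Hom K A B)\<rbrakk>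
       \<Longrightarrow> Comp2 L (on0 F A) (on0 G A) (on0 G B) (on2 G A B \<alpha>) (Id2 L (on0 F A) (on0 G A) (\<eta> A))
         = Comp2 L (on0 F A) (on0 F B) (on0 G B) (Id2 L (on0 F B) (on0 G B) (\<eta> B)) (on2 F A B \<alpha>)"

text \<open>\<open>F \<stileturn> G\<close> with unit \<open>\<eta>\<close> and counit \<open>\<epsilon>\<close>, where \<open>F : K \<rightarrow> L\<close> is the left 2-adjoint.\<close>

locale two_adjunction =
  left: two_functor K L F + right: two_functor L K G +
  unit: two_nat_trans K K id_two_func "G \<circ>\<^sub>2 F" \<eta> +
  counit: two_nat_trans L L "F \<circ>\<^sub>2 G" id_two_func \<epsilon>
  for K :: "('o, 'f, 's) two_cat" and L :: "('p, 'g, 't) two_cat"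
    and F :: "('o, 'f, 's, 'p, 'g, 't) two_func" and G :: "('p, 'g, 't, 'o, 'f, 's) two_func"
    and \<eta> :: "'o \<Rightarrow> 'f" and \<epsilon> :: "'p \<Rightarrow> 'g" +
  assumes triangle_left:
      "A \<in> Ob K \<Longrightarrow>
       Comp1 L (on0 F A) (on0 F (on0 G (on0 F A))) (on0 F A)
         (\<epsilon> (on0 F A)) (on1 F A (on0 G (on0 F A)) (\<eta> A)) = Id1 L (on0 F A)"
    and triangle_right:
      "B \<in> Ob L \<Longrightarrow>
       Comp1 K (on0 G B) (on0 G (on0 F (on0 G B))) (on0 G B)
         (on1 G (on0 F (on0 G B)) B (\<epsilon> B)) (\<eta> (on0 G B)) = Id1 K (on0 G B)"


section \<open>Small categories\<close>

text \<open>A Grothendieck universe on the type \<open>'u\<close>: \<open>small\<close> singles out the sets of elements of \<open>'u\<close> that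
  are themselves (coded by) elements of \<open>'u\<close>. As usual for universes in the wide sense, an infinite
  small set is not demanded.\<close>

locale universe =
  fixes small :: "'u set \<Rightarrow> bool" and code :: "'u set \<Rightarrow> 'u"
  assumes code_inj: "inj_on code (Collect small)"
    and small_subset: "small A \<Longrightarrow> B \<subseteq> A \<Longrightarrow> small B"
    and small_doubleton: "small {x, y}"
    and small_Pow: "small A \<Longrightarrow> small (code ` Pow A)"
    and small_UN: "small I \<Longrightarrow> (\<And>i. i \<in> I \<Longrightarrow> small (F i)) \<Longrightarrow> small (\<Union>i\<in>I. F i)"

lemma universe_hereditarily_finite: "universe finite set_encode"
  by standard (auto intro: inj_on_set_encode finite_subset)

type_synonym 'u scat = "('u, 'u) cat"
type_synonym 'u sfunc = "('u, 'u, 'u, 'u) func"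

definition small_category :: "('u set \<Rightarrow> bool) \<Rightarrow> 'u scat \<Rightarrow> bool" where
  "small_category small C \<longleftrightarrow> category C \<and> small (Obj C) \<and> small (Arr C)"


section \<open>The 2-category of universal arrows\<close>

text \<open>\<open>uzeta U X v\<close> is \<open>\<zeta>\<^sup>R\<^sup>X(v)\<close>.\<close>

record 'u uarr =
  ubase :: "'u scat"
  utop :: "'u scat"
  uR :: "'u sfunc"
  uL :: "'u \<Rightarrow> 'u"
  ueta :: "'u \<Rightarrow> 'u"
  uzeta :: "'u \<Rightarrow> 'u \<Rightarrow> 'u"

locale universal_arrow =
  fixes small :: "'u set \<Rightarrow> bool" and U :: "'u uarr"
  assumes base: "small_category small (ubase U)"
    and top: "small_category small (utop U)"
    and R: "is_functor (utop U) (ubase U) (uR U)"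
    and L: "uL U \<in> Obj (ubase U) \<rightarrow>\<^sub>E Obj (utop U)"
    and eta_ext: "ueta U \<in> extensional (Obj (ubase U))"
    and eta: "A \<in> Obj (ubase U) \<Longrightarrow> ueta U A \<in> hom (ubase U) A (onO (uR U) (uL U A))"
    and zeta_ext:
      "uzeta U \<in> (\<Pi>\<^sub>E X\<in>Obj (utop U). arrows_into (ubase U) (onO (uR U) X) \<rightarrow>\<^sub>E Arr (utop U))"
    and zeta:
      "\<lbrakk>X \<in> Obj (utop U); v \<in> hom (ubase U) A (onO (uR U) X)\<rbrakk>
       \<Longrightarrow> uzeta U X v \<in> hom (utop U) (uL U A) X \<and>
           onA (uR U) (uzeta U X v) \<cdot>\<^bsub>ubase U\<^esub> ueta U A = v"
    and zeta_unique:
      "\<lbrakk>X \<in> Obj (utop U); v \<in> hom (ubase U) A (onO (uR U) X); w \<in> hom (utop U) (uL U A) X;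
        onA (uR U) w \<cdot>\<^bsub>ubase U\<^esub> ueta U A = v\<rbrakk>
       \<Longrightarrow> w = uzeta U X v"

record 'u uarr1 =
  ubase1 :: "'u sfunc"
  utop1 :: "'u sfunc"
  urho :: "'u \<Rightarrow> 'u"

definition uarr_1cell :: "'u uarr \<Rightarrow> 'u uarr \<Rightarrow> 'u uarr1 \<Rightarrow> bool" where
  "uarr_1cell A B f \<longleftrightarrow>
    is_functor (ubase A) (ubase B) (ubase1 f) \<and>
    is_functor (utop A) (utop B) (utop1 f) \<and>
    is_nat_iso (utop A) (ubase B) (comp_func (utop A) (ubase1 f) (uR A))
      (comp_func (utop A) (uR B) (utop1 f)) (urho f)"

definition strict_uarr_1cell :: "'u uarr \<Rightarrow> 'u uarr \<Rightarrow> 'u uarr1 \<Rightarrow> bool" where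
  "strict_uarr_1cell A B f \<longleftrightarrow>
    uarr_1cell A B f \<and>
    comp_func (utop A) (ubase1 f) (uR A) = comp_func (utop A) (uR B) (utop1 f) \<and>
    urho f = id_nat (utop A) (ubase B) (comp_func (utop A) (ubase1 f) (uR A))"

text \<open>A 2-cell records its source and target 1-cells together with \<open>\<alpha>\<close> and \<open>\<beta>\<close>.\<close>

type_synonym 'u uarr2 = "'u uarr1 \<times> 'u uarr1 \<times> ('u \<Rightarrow> 'u) \<times> ('u \<Rightarrow> 'u)"

definition uarr_2cell :: "'u uarr \<Rightarrow> 'u uarr \<Rightarrow> 'u uarr2 \<Rightarrow> bool" where
  "uarr_2cell A B = (\<lambda>(f, g, \<alpha>, \<beta>).
    is_nat_trans (ubase A) (ubase B) (ubase1 f) (ubase1 g) \<alpha> \<and>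
    is_nat_trans (utop A) (utop B) (utop1 f) (utop1 g) \<beta> \<and>
    (\<forall>X\<in>Obj (utop A).
      onA (uR B) (\<beta> X) \<cdot>\<^bsub>ubase B\<^esub> urho f X = urho g X \<cdot>\<^bsub>ubase B\<^esub> \<alpha> (onO (uR A) X)))"

definition uarr_Hom :: "'u uarr \<Rightarrow> 'u uarr \<Rightarrow> ('u uarr1, 'u uarr2) cat" where
  "uarr_Hom A B = mk_cat
    {f. strict_uarr_1cell A B f}
    {(f, g, \<alpha>, \<beta>). strict_uarr_1cell A B f \<and> strict_uarr_1cell A B g \<and> uarr_2cell A B (f, g, \<alpha>, \<beta>)}
    (\<lambda>(f, g, \<alpha>, \<beta>). f)
    (\<lambda>(f, g, \<alpha>, \<beta>). g)
    (\<lambda>f. (f, f, id_nat (ubase A) (ubase B) (ubase1 f), id_nat (utop A) (utop B) (utop1 f)))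
    (\<lambda>(g, h, \<alpha>', \<beta>') (f, g', \<alpha>, \<beta>).
      (f, h, vcomp (ubase A) (ubase B) \<alpha>' \<alpha>, vcomp (utop A) (utop B) \<beta>' \<beta>))"

definition uarr_Id1 :: "'u uarr \<Rightarrow> 'u uarr1" where
  "uarr_Id1 A = \<lparr>ubase1 = id_func (ubase A), utop1 = id_func (utop A),
     urho = id_nat (utop A) (ubase A) (uR A)\<rparr>"

definition uarr_Comp1 :: "'u uarr \<Rightarrow> 'u uarr \<Rightarrow> 'u uarr \<Rightarrow> 'u uarr1 \<Rightarrow> 'u uarr1 \<Rightarrow> 'u uarr1" where
  "uarr_Comp1 A B C g f =
    \<lparr>ubase1 = comp_func (ubase A) (ubase1 g) (ubase1 f),
     utop1 = comp_func (utop A) (utop1 g) (utop1 f),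
     urho = (\<lambda>X\<in>Obj (utop A). urho g (onO (utop1 f) X) \<cdot>\<^bsub>ubase C\<^esub> onA (ubase1 g) (urho f X))\<rparr>"

definition uarr_Comp2 :: "'u uarr \<Rightarrow> 'u uarr \<Rightarrow> 'u uarr \<Rightarrow> 'u uarr2 \<Rightarrow> 'u uarr2 \<Rightarrow> 'u uarr2" where
  "uarr_Comp2 A B C = (\<lambda>(g, g', \<alpha>', \<beta>') (f, f', \<alpha>, \<beta>).
    (uarr_Comp1 A B C g f, uarr_Comp1 A B C g' f',
     hcomp (ubase A) (ubase C) (ubase1 g) \<alpha>' (ubase1 f') \<alpha>,
     hcomp (utop A) (utop C) (utop1 g) \<beta>' (utop1 f') \<beta>))"

definition UArr :: "('u set \<Rightarrow> bool) \<Rightarrow> ('u uarr, 'u uarr1, 'u uarr2) two_cat" where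
  "UArr small = \<lparr>Ob = {A. universal_arrow small A}, Hom = uarr_Hom, Id1 = uarr_Id1,
     Comp1 = uarr_Comp1, Comp2 = uarr_Comp2\<rparr>"


section \<open>The 2-category of extensive monads\<close>

text \<open>\<open>mext M B h\<close> is \<open>h\<^sup>S\<^sup>B\<close>.\<close>

record 'u emnd =
  mcat :: "'u scat"
  mS :: "'u \<Rightarrow> 'u"
  meta :: "'u \<Rightarrow> 'u"
  mext :: "'u \<Rightarrow> 'u \<Rightarrow> 'u"

locale extensive_monad =
  fixes small :: "'u set \<Rightarrow> bool" and M :: "'u emnd"
  assumes base: "small_category small (mcat M)"
    and S: "mS M \<in> Obj (mcat M) \<rightarrow>\<^sub>E Obj (mcat M)"
    and eta_ext: "meta M \<in> extensional (Obj (mcat M))"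
    and eta: "A \<in> Obj (mcat M) \<Longrightarrow> meta M A \<in> hom (mcat M) A (mS M A)"
    and ext_ext:
      "mext M \<in> (\<Pi>\<^sub>E B\<in>Obj (mcat M). arrows_into (mcat M) (mS M B) \<rightarrow>\<^sub>E Arr (mcat M))"
    and ext:
      "\<lbrakk>B \<in> Obj (mcat M); h \<in> hom (mcat M) A (mS M B)\<rbrakk>
       \<Longrightarrow> mext M B h \<in> hom (mcat M) (mS M A) (mS M B)"
    and ext_eta: "A \<in> Obj (mcat M) \<Longrightarrow> mext M A (meta M A) = Idn (mcat M) (mS M A)"
    and ext_comp_eta:
      "\<lbrakk>B \<in> Obj (mcat M); h \<in> hom (mcat M) A (mS M B)\<rbrakk>
       \<Longrightarrow> mext M B h \<cdot>\<^bsub>mcat M\<^esub> meta M A = h"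
    and ext_comp_ext:
      "\<lbrakk>B \<in> Obj (mcat M); D \<in> Obj (mcat M);
        h \<in> hom (mcat M) A (mS M B); k \<in> hom (mcat M) B (mS M D)\<rbrakk>
       \<Longrightarrow> mext M D (mext M D k \<cdot>\<^bsub>mcat M\<^esub> h) = mext M D k \<cdot>\<^bsub>mcat M\<^esub> mext M B h"

type_synonym 'u alg = "'u \<times> ('u \<Rightarrow> 'u)"

definition algebra :: "'u emnd \<Rightarrow> 'u alg \<Rightarrow> bool" where
  "algebra M = (\<lambda>(N, n).
    N \<in> Obj (mcat M) \<and>
    n \<in> extensional (arrows_into (mcat M) N) \<and>
    (\<forall>A. \<forall>a \<in> hom (mcat M) A N.
       n a \<in> hom (mcat M) (mS M A) N \<and> n a \<cdot>\<^bsub>mcat M\<^esub> meta M A = a) \<and>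
    (\<forall>B\<in>Obj (mcat M). \<forall>A. \<forall>b \<in> hom (mcat M) B N. \<forall>h \<in> hom (mcat M) A (mS M B).
       n (n b \<cdot>\<^bsub>mcat M\<^esub> h) = n b \<cdot>\<^bsub>mcat M\<^esub> mext M B h))"

definition algebra_mor :: "'u emnd \<Rightarrow> 'u alg \<Rightarrow> 'u alg \<Rightarrow> 'u \<Rightarrow> bool" where
  "algebra_mor M = (\<lambda>(K, k) (N, n) q.
    q \<in> hom (mcat M) K N \<and>
    (\<forall>a \<in> arrows_into (mcat M) K. n (q \<cdot>\<^bsub>mcat M\<^esub> a) = q \<cdot>\<^bsub>mcat M\<^esub> k a))"

text \<open>In a 1-cell \<open>(P, (\<sim>)\<^sup>P\<^sup>S)\<close>, \<open>pext P A p\<close> is \<open>p\<^sup>P\<^sup>S\<^sup>A\<close>.\<close>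

record 'u emnd1 =
  pfun :: "'u sfunc"
  pext :: "'u \<Rightarrow> 'u \<Rightarrow> 'u"

definition pext_alg :: "'u emnd \<Rightarrow> 'u emnd1 \<Rightarrow> 'u \<Rightarrow> 'u alg" where
  "pext_alg M P A = (onO (pfun P) (mS M A), pext P A)"

definition emnd_1cell :: "'u emnd \<Rightarrow> 'u emnd \<Rightarrow> 'u emnd1 \<Rightarrow> bool" where
  "emnd_1cell M T P \<longleftrightarrow>
    is_functor (mcat M) (mcat T) (pfun P) \<and>
    pext P \<in> extensional (Obj (mcat M)) \<and>
    (\<forall>A\<in>Obj (mcat M). algebra T (pext_alg M P A)) \<and>
    (\<forall>A\<in>Obj (mcat M). \<forall>B\<in>Obj (mcat M). \<forall>h \<in> hom (mcat M) A (mS M B).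
       algebra_mor T (pext_alg M P A) (pext_alg M P B) (onA (pfun P) (mext M B h)))"

type_synonym 'u emnd2 = "'u emnd1 \<times> 'u emnd1 \<times> ('u \<Rightarrow> 'u)"

definition emnd_2cell :: "'u emnd \<Rightarrow> 'u emnd \<Rightarrow> 'u emnd2 \<Rightarrow> bool" where
  "emnd_2cell M T = (\<lambda>(P, Q, \<theta>).
    is_nat_trans (mcat M) (mcat T) (pfun P) (pfun Q) \<theta> \<and>
    (\<forall>A\<in>Obj (mcat M). algebra_mor T (pext_alg M P A) (pext_alg M Q A) (\<theta> (mS M A))))"

definition emnd_Hom :: "'u emnd \<Rightarrow> 'u emnd \<Rightarrow> ('u emnd1, 'u emnd2) cat" where
  "emnd_Hom M T = mk_cat
    {P. emnd_1cell M T P}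
    {(P, Q, \<theta>). emnd_1cell M T P \<and> emnd_1cell M T Q \<and> emnd_2cell M T (P, Q, \<theta>)}
    (\<lambda>(P, Q, \<theta>). P)
    (\<lambda>(P, Q, \<theta>). Q)
    (\<lambda>P. (P, P, id_nat (mcat M) (mcat T) (pfun P)))
    (\<lambda>(Q, R, \<theta>') (P, Q', \<theta>). (P, R, vcomp (mcat M) (mcat T) \<theta>' \<theta>))"

definition emnd_Id1 :: "'u emnd \<Rightarrow> 'u emnd1" where
  "emnd_Id1 M = \<lparr>pfun = id_func (mcat M), pext = mext M\<rparr>"

definition emnd_Comp1 :: "'u emnd \<Rightarrow> 'u emnd \<Rightarrow> 'u emnd \<Rightarrow> 'u emnd1 \<Rightarrow> 'u emnd1 \<Rightarrow> 'u emnd1" where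
  "emnd_Comp1 M T U W P =
    \<lparr>pfun = comp_func (mcat M) (pfun W) (pfun P),
     pext = (\<lambda>A\<in>Obj (mcat M).
       (let PSA = onO (pfun P) (mS M A) in
        (\<lambda>w\<in>arrows_into (mcat U) (onO (pfun W) PSA).
         onA (pfun W) (pext P A (Idn (mcat T) PSA)) \<cdot>\<^bsub>mcat U\<^esub>
         pext W PSA (onA (pfun W) (meta T PSA) \<cdot>\<^bsub>mcat U\<^esub> w))))\<rparr>"

definition emnd_Comp2 :: "'u emnd \<Rightarrow> 'u emnd \<Rightarrow> 'u emnd \<Rightarrow> 'u emnd2 \<Rightarrow> 'u emnd2 \<Rightarrow> 'u emnd2" where
  "emnd_Comp2 M T U = (\<lambda>(W, W', \<theta>') (P, P', \<theta>).
    (emnd_Comp1 M T U W P, emnd_Comp1 M T U W' P',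
     hcomp (mcat M) (mcat U) (pfun W) \<theta>' (pfun P') \<theta>))"

definition EMnd :: "('u set \<Rightarrow> bool) \<Rightarrow> ('u emnd, 'u emnd1, 'u emnd2) two_cat" where
  "EMnd small = \<lparr>Ob = {M. extensive_monad small M}, Hom = emnd_Hom, Id1 = emnd_Id1,
     Comp1 = emnd_Comp1, Comp2 = emnd_Comp2\<rparr>"


section \<open>The 2-functor \<open>\<Phi>\<close>\<close>

definition Phi0 :: "'u uarr \<Rightarrow> 'u emnd" where
  "Phi0 U = \<lparr>mcat = ubase U,
     mS = compose (Obj (ubase U)) (onO (uR U)) (uL U),
     meta = ueta U,
     mext = (\<lambda>B\<in>Obj (ubase U). \<lambda>h\<in>arrows_into (ubase U) (onO (uR U) (uL U B)).
       onA (uR U) (uzeta U (uL U B) h))\<rparr>"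

definition Phi1 :: "'u uarr \<Rightarrow> 'u uarr \<Rightarrow> 'u uarr1 \<Rightarrow> 'u emnd1" where
  "Phi1 U U' f = \<lparr>pfun = ubase1 f,
     pext = (\<lambda>A\<in>Obj (ubase U).
       \<lambda>p\<in>arrows_into (ubase U') (onO (ubase1 f) (onO (uR U) (uL U A))).
         inverse_arr (ubase U') (urho f (uL U A)) \<cdot>\<^bsub>ubase U'\<^esub>
         onA (uR U') (uzeta U' (onO (utop1 f) (uL U A)) (urho f (uL U A) \<cdot>\<^bsub>ubase U'\<^esub> p)))\<rparr>"

definition Phi2 :: "'u uarr \<Rightarrow> 'u uarr \<Rightarrow> 'u uarr2 \<Rightarrow> 'u emnd2" where
  "Phi2 U U' = (\<lambda>(f, g, \<alpha>, \<beta>). (Phi1 U U' f, Phi1 U U' g, \<alpha>))"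

definition Phi :: "('u uarr, 'u uarr1, 'u uarr2, 'u emnd, 'u emnd1, 'u emnd2) two_func" where
  "Phi = \<lparr>on0 = Phi0, on1 = Phi1, on2 = Phi2\<rparr>"


section \<open>The category of algebras and the 2-functor \<open>\<Psi>\<close>\<close>

text \<open>The category \<open>\<C>\<^sup>S\<close>; an arrow is a triple consisting of source, target and underlying arrow.\<close>

type_synonym 'u alg_arr = "'u alg \<times> 'u alg \<times> 'u"

definition EM :: "'u emnd \<Rightarrow> ('u alg, 'u alg_arr) cat" where
  "EM M = mk_cat
    {N. algebra M N}
    {(K, N, q). algebra M K \<and> algebra M N \<and> algebra_mor M K N q}
    (\<lambda>(K, N, q). K)
    (\<lambda>(K, N, q). N)
    (\<lambda>N. (N, N, Idn (mcat M) (fst N)))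
    (\<lambda>(N, H, r) (K, N', q). (K, H, r \<cdot>\<^bsub>mcat M\<^esub> q))"

definition free_alg :: "'u emnd \<Rightarrow> 'u \<Rightarrow> 'u alg" where
  "free_alg M A = (mS M A, mext M A)"

text \<open>For \<open>\<Psi>\<close> the category \<open>\<C>\<^sup>S\<close> has to be a small category, with objects and arrows in the universe.
  As in set theory, pairs are coded as Kuratowski pairs and functions as their graphs, and the
  structure of \<^term>\<open>EM M\<close> is transported along the resulting bijection.\<close>

definition code_pair :: "('u set \<Rightarrow> 'u) \<Rightarrow> 'u \<Rightarrow> 'u \<Rightarrow> 'u" where
  "code_pair code x y = code {code {x}, code {x, y}}"

definition code_alg :: "('u set \<Rightarrow> 'u) \<Rightarrow> 'u emnd \<Rightarrow> 'u alg \<Rightarrow> 'u" where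
  "code_alg code M = (\<lambda>(N, n).
    code_pair code N (code ((\<lambda>a. code_pair code a (n a)) ` arrows_into (mcat M) N)))"

definition code_alg_arr :: "('u set \<Rightarrow> 'u) \<Rightarrow> 'u emnd \<Rightarrow> 'u alg_arr \<Rightarrow> 'u" where
  "code_alg_arr code M = (\<lambda>(K, N, q).
    code_pair code (code_alg code M K) (code_pair code (code_alg code M N) q))"

definition decode_alg :: "('u set \<Rightarrow> 'u) \<Rightarrow> 'u emnd \<Rightarrow> 'u \<Rightarrow> 'u alg" where
  "decode_alg code M = inv_into (Obj (EM M)) (code_alg code M)"

definition decode_alg_arr :: "('u set \<Rightarrow> 'u) \<Rightarrow> 'u emnd \<Rightarrow> 'u \<Rightarrow> 'u alg_arr" where
  "decode_alg_arr code M = inv_into (Arr (EM M)) (code_alg_arr code M)"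

definition small_EM :: "('u set \<Rightarrow> 'u) \<Rightarrow> 'u emnd \<Rightarrow> 'u scat" where
  "small_EM code M = mk_cat
    (code_alg code M ` Obj (EM M))
    (code_alg_arr code M ` Arr (EM M))
    (\<lambda>f. code_alg code M (Dom (EM M) (decode_alg_arr code M f)))
    (\<lambda>f. code_alg code M (Cod (EM M) (decode_alg_arr code M f)))
    (\<lambda>N. code_alg_arr code M (Idn (EM M) (decode_alg code M N)))
    (\<lambda>g f. code_alg_arr code M (decode_alg_arr code M g \<cdot>\<^bsub>EM M\<^esub> decode_alg_arr code M f))"

definition forget :: "('u set \<Rightarrow> 'u) \<Rightarrow> 'u emnd \<Rightarrow> 'u sfunc" where
  "forget code M =
    \<lparr>onO = (\<lambda>N\<in>Obj (small_EM code M). fst (decode_alg code M N)),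
     onA = (\<lambda>f\<in>Arr (small_EM code M). case decode_alg_arr code M f of (K, N, q) \<Rightarrow> q)\<rparr>"

definition Psi0 :: "('u set \<Rightarrow> 'u) \<Rightarrow> 'u emnd \<Rightarrow> 'u uarr" where
  "Psi0 code M = \<lparr>ubase = mcat M,
     utop = small_EM code M,
     uR = forget code M,
     uL = (\<lambda>A\<in>Obj (mcat M). code_alg code M (free_alg M A)),
     ueta = meta M,
     uzeta = (\<lambda>X\<in>Obj (small_EM code M). case decode_alg code M X of (N, n) \<Rightarrow>
       (\<lambda>v\<in>arrows_into (mcat M) N.
         code_alg_arr code M (free_alg M (Dom (mcat M) v), (N, n), n v)))\<rparr>"

definition hat_alg :: "'u emnd \<Rightarrow> 'u emnd \<Rightarrow> 'u emnd1 \<Rightarrow> 'u alg \<Rightarrow> 'u alg" where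
  "hat_alg M T P = (\<lambda>(N, n).
    (onO (pfun P) N,
     \<lambda>q\<in>arrows_into (mcat T) (onO (pfun P) N).
       onA (pfun P) (n (Idn (mcat M) N)) \<cdot>\<^bsub>mcat T\<^esub>
       pext P N (onA (pfun P) (meta M N) \<cdot>\<^bsub>mcat T\<^esub> q)))"

definition hat_func :: "('u set \<Rightarrow> 'u) \<Rightarrow> 'u emnd \<Rightarrow> 'u emnd \<Rightarrow> 'u emnd1 \<Rightarrow> 'u sfunc" where
  "hat_func code M T P =
    \<lparr>onO = (\<lambda>N\<in>Obj (small_EM code M). code_alg code T (hat_alg M T P (decode_alg code M N))),
     onA = (\<lambda>f\<in>Arr (small_EM code M). case decode_alg_arr code M f of (K, N, m) \<Rightarrow>
       code_alg_arr code T (hat_alg M T P K, hat_alg M T P N, onA (pfun P) m))\<rparr>"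

definition Psi1 :: "('u set \<Rightarrow> 'u) \<Rightarrow> 'u emnd \<Rightarrow> 'u emnd \<Rightarrow> 'u emnd1 \<Rightarrow> 'u uarr1" where
  "Psi1 code M T P = \<lparr>ubase1 = pfun P,
     utop1 = hat_func code M T P,
     urho = id_nat (small_EM code M) (mcat T)
       (comp_func (small_EM code M) (pfun P) (forget code M))\<rparr>"

definition Psi2 :: "('u set \<Rightarrow> 'u) \<Rightarrow> 'u emnd \<Rightarrow> 'u emnd \<Rightarrow> 'u emnd2 \<Rightarrow> 'u uarr2" where
  "Psi2 code M T = (\<lambda>(P, Q, \<theta>).
    (Psi1 code M T P, Psi1 code M T Q, \<theta>,
     \<lambda>X\<in>Obj (small_EM code M). case decode_alg code M X of (N, n) \<Rightarrow>
       code_alg_arr code T (hat_alg M T P (N, n), hat_alg M T Q (N, n), \<theta> N)))"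

definition Psi :: "('u set \<Rightarrow> 'u) \<Rightarrow> ('u emnd, 'u emnd1, 'u emnd2, 'u uarr, 'u uarr1, 'u uarr2) two_func"
  where "Psi code = \<lparr>on0 = Psi0 code, on1 = Psi1 code, on2 = Psi2 code\<rparr>"

end

theory Submission
  imports Defs
begin

text \<open>
  The unit of the adjunction is the comparison 1-cell and the counit is an identity. The reasons are
  the following.

  A 1-cell \<open>(P, (\<sim>)\<^sup>P\<^sup>S)\<close> of monads gives algebra structures on the objects \<open>P S A\<close> only, but these
  extend to a lifting of \<open>P\<close> to all algebras (\<open>algebra_hat\<close>, \<open>algebra_mor_hat\<close>), because an algebra
  \<open>(N, n)\<close> is the quotient of the free algebra on \<open>N\<close> by the structure map \<open>n 1 : S N \<rightarrow> N\<close>. On free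
  algebras the lifting returns the given structures (\<open>hat_free\<close>), and it is functorial in \<open>P\<close>
  (\<open>hat_alg_Id1\<close>, \<open>hat_alg_Comp1\<close>). Since composition of 1-cells of monads is defined by lifting, the
  laws of the 2-category of monads and the 2-functoriality of \<open>\<Psi>\<close> both follow from these facts.

  For a universal arrow, each object \<open>X\<close> of \<open>\<X>\<close> yields the comparison algebra \<open>R X\<close> with structure
  \<open>v \<mapsto> R \<zeta>(v)\<close>. For a 1-cell \<open>(J, V)\<close> with \<open>J R = R\<^sup>\<dagger> V\<close>, the structures of \<open>\<Phi>(J, V)\<close> are those of the
  comparison algebras of the objects \<open>V L A\<close> (\<open>pext_alg_Phi1\<close>), and the lifting of \<open>J\<close> takes the
  comparison algebra of any \<open>X\<close> to that of \<open>V X\<close> (\<open>hat_comparison\<close>), by uniqueness of \<open>\<zeta>\<close>. The two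
  facts together make \<open>\<Phi>\<close> functorial; the second says that the comparison is natural.

  Finally, the comparison algebra of an algebra with respect to \<open>U\<^sup>S\<close> is the algebra itself
  (\<open>comparison_alg_Psi0\<close>). With \<open>hat_free\<close> this gives \<open>\<Phi> \<Psi> = 1\<close> strictly, and it makes the comparison
  of \<open>\<Psi> M\<close> an identity, which is one triangle law. For the other, \<open>\<Phi>\<close> takes the comparison 1-cell to
  an identity because the comparison algebra of \<open>L A\<close> is the free algebra on \<open>A\<close>.

  The category of algebras must also be small. As the codings of algebras and of their morphisms are
  injective (\<open>code_alg_eq_iff\<close>), it may be replaced by its coded copy, and its coded objects form a
  small set because an algebra is an object with a subset of a small set.
\<close>

section \<open>Categories, functors and natural transformations\<close>

text \<open>Conditions of the form \<open>f \<in> Arr C\<close> and \<open>Cod C f = Dom C g\<close> mention no objects beyond those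
  determined by the arrows, so the simplifier can discharge them. The defining laws, which are
  stated with hom-sets, are therefore restated in this form.\<close>

lemma hom_iff: "f \<in> hom C A B \<longleftrightarrow> f \<in> Arr C \<and> Dom C f = A \<and> Cod C f = B"
  by (simp add: hom_def)

lemma arrows_into_iff [simp]: "f \<in> arrows_into C B \<longleftrightarrow> f \<in> Arr C \<and> Cod C f = B"
  by (simp add: arrows_into_def)

context category
begin

lemma Dom_in [simp]: "f \<in> Arr C \<Longrightarrow> Dom C f \<in> Obj C"
  using Dom_type by auto

lemma Cod_in [simp]: "f \<in> Arr C \<Longrightarrow> Cod C f \<in> Obj C"
  using Cod_type by auto

lemma Idn_simps [simp]:
  assumes "A \<in> Obj C"
  shows "Idn C A \<in> Arr C" "Dom C (Idn C A) = A" "Cod C (Idn C A) = A"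
  using Idn_hom[OF assms] by (auto simp: hom_iff)

lemma Comp_simps [simp]:
  assumes "f \<in> Arr C" "g \<in> Arr C" "Cod C f = Dom C g"
  shows "g \<cdot> f \<in> Arr C" "Dom C (g \<cdot> f) = Dom C f" "Cod C (g \<cdot> f) = Cod C g"
  using Comp_hom[of f "Dom C f" "Cod C f" g "Cod C g"] assms by (auto simp: hom_iff)

lemma Comp_Idn [simp]: "f \<in> Arr C \<Longrightarrow> Dom C f = A \<Longrightarrow> f \<cdot> Idn C A = f"
  using Idn_right by (auto simp: hom_iff)

lemma Idn_Comp [simp]: "f \<in> Arr C \<Longrightarrow> Cod C f = A \<Longrightarrow> Idn C A \<cdot> f = f"
  using Idn_left by (auto simp: hom_iff)

lemma assoc:
  assumes "f \<in> Arr C" "g \<in> Arr C" "h \<in> Arr C" "Cod C f = Dom C g" "Cod C g = Dom C h"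
  shows "(h \<cdot> g) \<cdot> f = h \<cdot> (g \<cdot> f)"
  using Comp_assoc[of f "Dom C f" "Cod C f" g "Cod C g" h "Cod C h"] assms by (auto simp: hom_iff)

lemma inverse_arr_Idn [simp]:
  assumes "A \<in> Obj C"
  shows "inverse_arr C (Idn C A) = Idn C A"
  unfolding inverse_arr_def is_inverse_arr_def using assms
  by (intro the_equality) (auto simp: hom_iff)

end

lemma mk_cat_simps [simp]:
  "Obj (mk_cat obs ars dm cd idn cmp) = obs"
  "Arr (mk_cat obs ars dm cd idn cmp) = ars"
  "f \<in> ars \<Longrightarrow> Dom (mk_cat obs ars dm cd idn cmp) f = dm f"
  "f \<in> ars \<Longrightarrow> Cod (mk_cat obs ars dm cd idn cmp) f = cd f"
  "A \<in> obs \<Longrightarrow> Idn (mk_cat obs ars dm cd idn cmp) A = idn A"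
  "\<lbrakk>f \<in> ars; g \<in> ars; cd f = dm g\<rbrakk> \<Longrightarrow> g \<cdot>\<^bsub>mk_cat obs ars dm cd idn cmp\<^esub> f = cmp g f"
  by (simp_all add: mk_cat_def)

lemma category_mk_cat:
  assumes "\<And>f. f \<in> ars \<Longrightarrow> dm f \<in> obs \<and> cd f \<in> obs"
    and "\<And>A. A \<in> obs \<Longrightarrow> idn A \<in> ars \<and> dm (idn A) = A \<and> cd (idn A) = A"
    and "\<And>f g. \<lbrakk>f \<in> ars; g \<in> ars; cd f = dm g\<rbrakk>
           \<Longrightarrow> cmp g f \<in> ars \<and> dm (cmp g f) = dm f \<and> cd (cmp g f) = cd g"
    and "\<And>f. f \<in> ars \<Longrightarrow> cmp f (idn (dm f)) = f"
    and "\<And>f. f \<in> ars \<Longrightarrow> cmp (idn (cd f)) f = f"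
    and "\<And>f g h. \<lbrakk>f \<in> ars; g \<in> ars; h \<in> ars; cd f = dm g; cd g = dm h\<rbrakk>
           \<Longrightarrow> cmp h (cmp g f) = cmp (cmp h g) f"
  shows "category (mk_cat obs ars dm cd idn cmp)"
  by unfold_locales (use assms in \<open>auto simp: mk_cat_def hom_def\<close>)

text \<open>A category structure can be transported along codings \<open>c\<close> of its objects and \<open>d\<close> of its
  arrows that have decodings \<open>c'\<close> and \<open>d'\<close>. In this form the lemma applies to the coded category
  of algebras.\<close>

lemma category_transport:
  assumes "category D"
    and c': "\<And>A. A \<in> Obj D \<Longrightarrow> c' (c A) = A" and d': "\<And>f. f \<in> Arr D \<Longrightarrow> d' (d f) = f"
  shows "category (mk_cat (c ` Obj D) (d ` Arr D) (\<lambda>f. c (Dom D (d' f))) (\<lambda>f. c (Cod D (d' f)))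
    (\<lambda>A. d (Idn D (c' A))) (\<lambda>g f. d (d' g \<cdot>\<^bsub>D\<^esub> d' f)))"
proof -
  interpret D: category D by fact
  have c_eq: "c A = c B \<longleftrightarrow> A = B" if "A \<in> Obj D" "B \<in> Obj D" for A B
    using that by (metis c')
  show ?thesis
    by (rule category_mk_cat) (auto simp: c' d' c_eq D.assoc)
qed

sublocale is_functor \<subseteq> C: category C
  by (rule source)
sublocale is_functor \<subseteq> D: category D
  by (rule target)

context is_functor
begin

lemma onO_in [simp]: "A \<in> Obj C \<Longrightarrow> onO F A \<in> Obj D"
  using onO_type by auto

lemma onA_simps [simp]:
  assumes "f \<in> Arr C"
  shows "onA F f \<in> Arr D" "Dom D (onA F f) = onO F (Dom C f)" "Cod D (onA F f) = onO F (Cod C f)"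
  using onA_hom[of f "Dom C f" "Cod C f"] assms by (auto simp: hom_iff)

lemma preserves_Comp:
  "\<lbrakk>f \<in> Arr C; g \<in> Arr C; Cod C f = Dom C g\<rbrakk> \<Longrightarrow> onA F (g \<cdot>\<^bsub>C\<^esub> f) = onA F g \<cdot>\<^bsub>D\<^esub> onA F f"
  using onA_Comp[of f "Dom C f" "Cod C f" g "Cod C g"] by (auto simp: hom_iff)

declare onA_Idn [simp]

end

lemma is_functorI:
  assumes "category C" "category D" "onO F \<in> extensional (Obj C)" "onA F \<in> extensional (Arr C)"
    and "\<And>A. A \<in> Obj C \<Longrightarrow> onO F A \<in> Obj D"
    and "\<And>f. f \<in> Arr C \<Longrightarrow> onA F f \<in> Arr D \<and> Dom D (onA F f) = onO F (Dom C f)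
           \<and> Cod D (onA F f) = onO F (Cod C f)"
    and "\<And>A. A \<in> Obj C \<Longrightarrow> onA F (Idn C A) = Idn D (onO F A)"
    and "\<And>f g. \<lbrakk>f \<in> Arr C; g \<in> Arr C; Cod C f = Dom C g\<rbrakk>
           \<Longrightarrow> onA F (g \<cdot>\<^bsub>C\<^esub> f) = onA F g \<cdot>\<^bsub>D\<^esub> onA F f"
  shows "is_functor C D F"
  by (rule is_functor.intro) (use assms in \<open>auto simp: hom_def PiE_iff\<close>)

lemma functor_eqI:
  assumes "is_functor C D F" "is_functor C D G"
    and "\<And>A. A \<in> Obj C \<Longrightarrow> onO F A = onO G A"
    and "\<And>f. f \<in> Arr C \<Longrightarrow> onA F f = onA G f"
  shows "F = G"
proof -
  interpret F: is_functor C D F by fact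
  interpret G: is_functor C D G by fact
  have "onO F = onO G"
    using F.onO_type G.onO_type assms(3) by (auto intro: PiE_ext)
  moreover have "onA F = onA G"
    using F.onA_ext G.onA_ext assms(4) by (auto intro: extensionalityI)
  ultimately show ?thesis by simp
qed

lemma id_func_simps [simp]:
  "A \<in> Obj C \<Longrightarrow> onO (id_func C) A = A"
  "f \<in> Arr C \<Longrightarrow> onA (id_func C) f = f"
  by (simp_all add: id_func_def)

lemma comp_func_simps [simp]:
  "A \<in> Obj C \<Longrightarrow> onO (comp_func C G F) A = onO G (onO F A)"
  "f \<in> Arr C \<Longrightarrow> onA (comp_func C G F) f = onA G (onA F f)"
  by (simp_all add: comp_func_def compose_def)

lemma is_functor_id_func:
  assumes "category C"
  shows "is_functor C C (id_func C)"
proof -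
  interpret category C by fact
  show ?thesis
    by (rule is_functorI) (auto simp: assms, auto simp: id_func_def)
qed

lemma is_functor_comp_func:
  assumes "is_functor C D F" "is_functor D E G"
  shows "is_functor C E (comp_func C G F)"
proof -
  interpret F: is_functor C D F by fact
  interpret G: is_functor D E G by fact
  show ?thesis
    by (rule is_functorI)
      (auto simp: F.source G.target F.preserves_Comp G.preserves_Comp, auto simp: comp_func_def)
qed

lemma comp_func_assoc:
  assumes "is_functor A B F" "is_functor B C G" "is_functor C D H"
  shows "comp_func A H (comp_func A G F) = comp_func A (comp_func B H G) F"
proof -
  interpret F: is_functor A B F by fact
  show ?thesis
    by (rule functor_eqI) (auto intro!: is_functor_comp_func assms)
qed

lemma comp_func_id_right:
  assumes "is_functor C D F"
  shows "comp_func C F (id_func C) = F"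
  using assms is_functor.source[OF assms]
  by (intro functor_eqI[of C D]) (auto intro: is_functor_comp_func is_functor_id_func)

lemma comp_func_id_left:
  assumes "is_functor C D F"
  shows "comp_func C (id_func D) F = F"
proof -
  interpret F: is_functor C D F by fact
  show ?thesis
    using assms is_functor.target[OF assms]
    by (intro functor_eqI[of C D]) (auto intro: is_functor_comp_func is_functor_id_func)
qed

sublocale is_nat_trans \<subseteq> F: is_functor C D F
  by (rule source)
sublocale is_nat_trans \<subseteq> G: is_functor C D G
  by (rule target)

context is_nat_trans
begin

lemma component_simps [simp]:
  assumes "A \<in> Obj C"
  shows "\<tau> A \<in> Arr D" "Dom D (\<tau> A) = onO F A" "Cod D (\<tau> A) = onO G A"
  using component[OF assms] by (auto simp: hom_iff)

lemma naturality: "f \<in> Arr C \<Longrightarrow> \<tau> (Cod C f) \<cdot>\<^bsub>D\<^esub> onA F f = onA G f \<cdot>\<^bsub>D\<^esub> \<tau> (Dom C f)"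
  using natural[of f "Dom C f" "Cod C f"] by (auto simp: hom_iff)

end

lemma is_nat_transI:
  assumes "is_functor C D F" "is_functor C D G" "\<tau> \<in> extensional (Obj C)"
    and "\<And>A. A \<in> Obj C \<Longrightarrow> \<tau> A \<in> Arr D \<and> Dom D (\<tau> A) = onO F A \<and> Cod D (\<tau> A) = onO G A"
    and "\<And>f. f \<in> Arr C \<Longrightarrow> \<tau> (Cod C f) \<cdot>\<^bsub>D\<^esub> onA F f = onA G f \<cdot>\<^bsub>D\<^esub> \<tau> (Dom C f)"
  shows "is_nat_trans C D F G \<tau>"
  by (rule is_nat_trans.intro) (use assms in \<open>auto simp: hom_def\<close>)

lemma nat_trans_eqI:
  assumes "is_nat_trans C D F G \<sigma>" "is_nat_trans C D F' G' \<tau>"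
    and "\<And>A. A \<in> Obj C \<Longrightarrow> \<sigma> A = \<tau> A"
  shows "\<sigma> = \<tau>"
  using assms by (auto intro: extensionalityI is_nat_trans.ext)

lemma nat_trans_comp_simps [simp]:
  "A \<in> Obj C \<Longrightarrow> id_nat C D F A = Idn D (onO F A)"
  "A \<in> Obj C \<Longrightarrow> vcomp C D \<tau> \<sigma> A = \<tau> A \<cdot>\<^bsub>D\<^esub> \<sigma> A"
  "A \<in> Obj C \<Longrightarrow> hcomp C E G \<beta> F' \<alpha> A = \<beta> (onO F' A) \<cdot>\<^bsub>E\<^esub> onA G (\<alpha> A)"
  by (simp_all add: id_nat_def vcomp_def hcomp_def)

lemma is_nat_trans_id_nat:
  assumes "is_functor C D F"
  shows "is_nat_trans C D F F (id_nat C D F)"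
proof -
  interpret is_functor C D F by fact
  show ?thesis
    by (rule is_nat_transI) (auto simp: assms, auto simp: id_nat_def)
qed

lemma is_nat_trans_vcomp:
  assumes "is_nat_trans C D F G \<sigma>" "is_nat_trans C D G H \<tau>"
  shows "is_nat_trans C D F H (vcomp C D \<tau> \<sigma>)"
proof -
  interpret \<sigma>: is_nat_trans C D F G \<sigma> by fact
  interpret \<tau>: is_nat_trans C D G H \<tau> by fact
  have "(\<tau> (Cod C f) \<cdot>\<^bsub>D\<^esub> \<sigma> (Cod C f)) \<cdot>\<^bsub>D\<^esub> onA F f = onA H f \<cdot>\<^bsub>D\<^esub> (\<tau> (Dom C f) \<cdot>\<^bsub>D\<^esub> \<sigma> (Dom C f))"
    if f: "f \<in> Arr C" for f
  proof -
    have "(\<tau> (Cod C f) \<cdot>\<^bsub>D\<^esub> \<sigma> (Cod C f)) \<cdot>\<^bsub>D\<^esub> onA F f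
        = \<tau> (Cod C f) \<cdot>\<^bsub>D\<^esub> (onA G f \<cdot>\<^bsub>D\<^esub> \<sigma> (Dom C f))"
      using f by (simp add: \<sigma>.F.D.assoc \<sigma>.naturality)
    also have "\<dots> = (onA H f \<cdot>\<^bsub>D\<^esub> \<tau> (Dom C f)) \<cdot>\<^bsub>D\<^esub> \<sigma> (Dom C f)"
      using f by (simp add: \<tau>.naturality[symmetric] \<sigma>.F.D.assoc)
    finally show ?thesis using f by (simp add: \<sigma>.F.D.assoc)
  qed
  then show ?thesis
    by (intro is_nat_transI) (auto intro: \<sigma>.source \<tau>.target, auto simp: vcomp_def)
qed

lemma is_nat_trans_hcomp:
  assumes "is_nat_trans A B F F' \<alpha>" "is_nat_trans B E G G' \<beta>"
  shows "is_nat_trans A E (comp_func A G F) (comp_func A G' F') (hcomp A E G \<beta> F' \<alpha>)"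
proof -
  interpret \<alpha>: is_nat_trans A B F F' \<alpha> by fact
  interpret \<beta>: is_nat_trans B E G G' \<beta> by fact
  have "(\<beta> (onO F' (Cod A f)) \<cdot>\<^bsub>E\<^esub> onA G (\<alpha> (Cod A f))) \<cdot>\<^bsub>E\<^esub> onA G (onA F f)
      = onA G' (onA F' f) \<cdot>\<^bsub>E\<^esub> (\<beta> (onO F' (Dom A f)) \<cdot>\<^bsub>E\<^esub> onA G (\<alpha> (Dom A f)))"
    if f: "f \<in> Arr A" for f
  proof -
    have "(\<beta> (onO F' (Cod A f)) \<cdot>\<^bsub>E\<^esub> onA G (\<alpha> (Cod A f))) \<cdot>\<^bsub>E\<^esub> onA G (onA F f)
        = \<beta> (onO F' (Cod A f)) \<cdot>\<^bsub>E\<^esub> onA G (onA F' f \<cdot>\<^bsub>B\<^esub> \<alpha> (Dom A f))"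
      using f by (simp add: \<beta>.F.D.assoc \<alpha>.naturality[symmetric] \<beta>.F.preserves_Comp)
    also have "\<dots> = (\<beta> (Cod B (onA F' f)) \<cdot>\<^bsub>E\<^esub> onA G (onA F' f)) \<cdot>\<^bsub>E\<^esub> onA G (\<alpha> (Dom A f))"
      using f by (simp add: \<beta>.F.preserves_Comp \<beta>.F.D.assoc)
    also have "\<dots> = onA G' (onA F' f) \<cdot>\<^bsub>E\<^esub> (\<beta> (onO F' (Dom A f)) \<cdot>\<^bsub>E\<^esub> onA G (\<alpha> (Dom A f)))"
      using f by (subst \<beta>.naturality) (simp_all add: \<beta>.F.D.assoc)
    finally show ?thesis .
  qed
  then show ?thesis
    using assms by (intro is_nat_transI is_functor_comp_func)
      (auto intro: \<alpha>.source \<alpha>.target \<beta>.source \<beta>.target, auto simp: hcomp_def)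
qed

lemma vcomp_assoc:
  assumes "is_nat_trans C D F G \<rho>" "is_nat_trans C D G H \<sigma>" "is_nat_trans C D H K \<tau>"
  shows "vcomp C D \<tau> (vcomp C D \<sigma> \<rho>) = vcomp C D (vcomp C D \<tau> \<sigma>) \<rho>"
proof -
  interpret \<rho>: is_nat_trans C D F G \<rho> by fact
  interpret \<sigma>: is_nat_trans C D G H \<sigma> by fact
  interpret \<tau>: is_nat_trans C D H K \<tau> by fact
  show ?thesis
    by (rule nat_trans_eqI) (auto intro: is_nat_trans_vcomp assms simp: \<rho>.F.D.assoc)
qed

lemma vcomp_id_right:
  assumes "is_nat_trans C D F G \<tau>"
  shows "vcomp C D \<tau> (id_nat C D F) = \<tau>"
proof -
  interpret \<tau>: is_nat_trans C D F G \<tau> by fact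
  show ?thesis
    by (rule nat_trans_eqI) (auto intro: is_nat_trans_vcomp is_nat_trans_id_nat \<tau>.source assms)
qed

lemma vcomp_id_left:
  assumes "is_nat_trans C D F G \<tau>"
  shows "vcomp C D (id_nat C D G) \<tau> = \<tau>"
proof -
  interpret \<tau>: is_nat_trans C D F G \<tau> by fact
  show ?thesis
    by (rule nat_trans_eqI) (auto intro: is_nat_trans_vcomp is_nat_trans_id_nat \<tau>.target assms)
qed

lemma hcomp_id_nat:
  assumes "is_functor A B F" "is_functor B C G"
  shows "hcomp A C G (id_nat B C G) F (id_nat A B F) = id_nat A C (comp_func A G F)"
proof -
  interpret F: is_functor A B F by fact
  interpret G: is_functor B C G by fact
  show ?thesis
    by (rule extensionalityI[of _ "Obj A"]) (auto simp: hcomp_def, auto simp: id_nat_def)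
qed

text \<open>The interchange law: naturality of \<open>\<beta>\<close> at the arrow \<open>\<alpha>' X\<close> exchanges the two middle factors.\<close>

lemma hcomp_vcomp:
  assumes "is_nat_trans A B F F' \<alpha>" "is_nat_trans A B F' F'' \<alpha>'"
    "is_nat_trans B C G G' \<beta>" "is_nat_trans B C G' G'' \<beta>'"
  shows "hcomp A C G (vcomp B C \<beta>' \<beta>) F'' (vcomp A B \<alpha>' \<alpha>)
       = vcomp A C (hcomp A C G' \<beta>' F'' \<alpha>') (hcomp A C G \<beta> F' \<alpha>)"
proof -
  interpret \<alpha>: is_nat_trans A B F F' \<alpha> by fact
  interpret \<alpha>': is_nat_trans A B F' F'' \<alpha>' by fact
  interpret \<beta>: is_nat_trans B C G G' \<beta> by fact
  interpret \<beta>': is_nat_trans B C G' G'' \<beta>' by fact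
  have "(\<beta>' (onO F'' X) \<cdot>\<^bsub>C\<^esub> \<beta> (onO F'' X)) \<cdot>\<^bsub>C\<^esub> onA G (\<alpha>' X \<cdot>\<^bsub>B\<^esub> \<alpha> X)
      = (\<beta>' (onO F'' X) \<cdot>\<^bsub>C\<^esub> onA G' (\<alpha>' X)) \<cdot>\<^bsub>C\<^esub> (\<beta> (onO F' X) \<cdot>\<^bsub>C\<^esub> onA G (\<alpha> X))"
    if X: "X \<in> Obj A" for X
  proof -
    have "(\<beta>' (onO F'' X) \<cdot>\<^bsub>C\<^esub> \<beta> (onO F'' X)) \<cdot>\<^bsub>C\<^esub> onA G (\<alpha>' X \<cdot>\<^bsub>B\<^esub> \<alpha> X)
        = \<beta>' (onO F'' X) \<cdot>\<^bsub>C\<^esub> ((\<beta> (Cod B (\<alpha>' X)) \<cdot>\<^bsub>C\<^esub> onA G (\<alpha>' X)) \<cdot>\<^bsub>C\<^esub> onA G (\<alpha> X))"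
      using X by (simp add: \<beta>.F.preserves_Comp \<beta>.F.D.assoc)
    also have "\<dots> = \<beta>' (onO F'' X) \<cdot>\<^bsub>C\<^esub> ((onA G' (\<alpha>' X) \<cdot>\<^bsub>C\<^esub> \<beta> (onO F' X)) \<cdot>\<^bsub>C\<^esub> onA G (\<alpha> X))"
      using X by (subst \<beta>.naturality) simp_all
    finally show ?thesis using X by (simp add: \<beta>.F.D.assoc)
  qed
  then show ?thesis
    using assms by (intro nat_trans_eqI[OF is_nat_trans_hcomp is_nat_trans_vcomp])
      (auto intro: is_nat_trans_vcomp is_nat_trans_hcomp)
qed

lemma hcomp_assoc:
  assumes "is_nat_trans A B F F' \<alpha>" "is_nat_trans B C G G' \<beta>" "is_nat_trans C D H H' \<gamma>"
  shows "hcomp A D H \<gamma> (comp_func A G' F') (hcomp A C G \<beta> F' \<alpha>)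
       = hcomp A D (comp_func B H G) (hcomp B D H \<gamma> G' \<beta>) F' \<alpha>"
proof -
  interpret \<alpha>: is_nat_trans A B F F' \<alpha> by fact
  interpret \<beta>: is_nat_trans B C G G' \<beta> by fact
  interpret \<gamma>: is_nat_trans C D H H' \<gamma> by fact
  show ?thesis
    by (rule extensionalityI[of _ "Obj A"])
      (auto simp: hcomp_def[of A D], auto simp: \<gamma>.F.D.assoc \<gamma>.F.preserves_Comp)
qed

lemma hcomp_id_right:
  assumes "is_nat_trans A B F F' \<alpha>"
  shows "hcomp A B F \<alpha> (id_func A) (id_nat A A (id_func A)) = \<alpha>"
proof -
  interpret \<alpha>: is_nat_trans A B F F' \<alpha> by fact
  show ?thesis
    by (rule extensionalityI[of _ "Obj A"]) (auto simp: \<alpha>.ext, auto simp: hcomp_def)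
qed

lemma hcomp_id_left:
  assumes "is_nat_trans A B F F' \<alpha>"
  shows "hcomp A B (id_func B) (id_nat B B (id_func B)) F' \<alpha> = \<alpha>"
proof -
  interpret \<alpha>: is_nat_trans A B F F' \<alpha> by fact
  show ?thesis
    by (rule extensionalityI[of _ "Obj A"]) (auto simp: \<alpha>.ext, auto simp: hcomp_def)
qed

section \<open>The 2-category of universal arrows\<close>

sublocale universal_arrow \<subseteq> C: category "ubase U"
  using base by (simp add: small_category_def)
sublocale universal_arrow \<subseteq> X: category "utop U"
  using top by (simp add: small_category_def)
sublocale universal_arrow \<subseteq> R: is_functor "utop U" "ubase U" "uR U"
  by (rule R)

context universal_arrow
begin

lemma L_in [simp]: "A \<in> Obj (ubase U) \<Longrightarrow> uL U A \<in> Obj (utop U)"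
  using L by auto

lemma eta_simps [simp]:
  assumes "A \<in> Obj (ubase U)"
  shows "ueta U A \<in> Arr (ubase U)" "Dom (ubase U) (ueta U A) = A"
    "Cod (ubase U) (ueta U A) = onO (uR U) (uL U A)"
  using eta[OF assms] by (auto simp: hom_iff)

lemma zeta_simps [simp]:
  assumes "X \<in> Obj (utop U)" "v \<in> Arr (ubase U)" "Cod (ubase U) v = onO (uR U) X"
  shows "uzeta U X v \<in> Arr (utop U)" "Dom (utop U) (uzeta U X v) = uL U (Dom (ubase U) v)"
    "Cod (utop U) (uzeta U X v) = X"
    "onA (uR U) (uzeta U X v) \<cdot>\<^bsub>ubase U\<^esub> ueta U (Dom (ubase U) v) = v"
  using zeta[of X v "Dom (ubase U) v"] assms by (auto simp: hom_iff)

lemma zeta_eqI: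
  assumes "w \<in> Arr (utop U)" "Dom (utop U) w = uL U A" "A \<in> Obj (ubase U)" "Cod (utop U) w = X"
    and "onA (uR U) w \<cdot>\<^bsub>ubase U\<^esub> ueta U A = v"
  shows "uzeta U X v = w"
  using zeta_unique[of X v A w] assms by (auto simp: hom_iff)

end

text \<open>With \<open>\<rho>\<close> an identity, a 1-cell is just a pair of functors commuting with the right adjoints,
  and a 2-cell a pair of transformations with \<open>R\<^sup>\<dagger> \<beta> = \<alpha> R\<close>.\<close>

lemma strict_uarr_1cell_iff:
  assumes "universal_arrow small A" "universal_arrow small B"
  shows "strict_uarr_1cell A B f \<longleftrightarrow>
    is_functor (ubase A) (ubase B) (ubase1 f) \<and> is_functor (utop A) (utop B) (utop1 f) \<and>
    comp_func (utop A) (ubase1 f) (uR A) = comp_func (utop A) (uR B) (utop1 f) \<and>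
    urho f = id_nat (utop A) (ubase B) (comp_func (utop A) (ubase1 f) (uR A))"
    (is "_ \<longleftrightarrow> ?J \<and> ?V \<and> ?eq \<and> ?rho")
proof -
  interpret A: universal_arrow small A by fact
  interpret B: universal_arrow small B by fact
  have "is_nat_iso (utop A) (ubase B) (comp_func (utop A) (ubase1 f) (uR A))
      (comp_func (utop A) (uR B) (utop1 f)) (urho f)" if ?J ?eq ?rho
  proof -
    interpret J: is_functor "ubase A" "ubase B" "ubase1 f" by fact
    have inv: "\<exists>g. is_inverse_arr (ubase B) (Idn (ubase B) Y) g" if "Y \<in> Obj (ubase B)" for Y
      using that by (auto simp: is_inverse_arr_def hom_iff intro!: exI[of _ "Idn (ubase B) Y"])
    show ?thesis
      unfolding is_nat_iso_def that(2)[symmetric] that(3)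
      by (auto intro!: is_nat_trans_id_nat is_functor_comp_func[OF A.R that(1)] inv)
  qed
  then show ?thesis
    by (auto simp: strict_uarr_1cell_def uarr_1cell_def)
qed

locale strict_1cell =
  A: universal_arrow small A + B: universal_arrow small B
  for small :: "'u set \<Rightarrow> bool" and A B :: "'u uarr" and f :: "'u uarr1" +
  assumes strict: "strict_uarr_1cell A B f"

sublocale strict_1cell \<subseteq> J: is_functor "ubase A" "ubase B" "ubase1 f"
  using strict by (simp add: strict_uarr_1cell_iff[OF A.universal_arrow_axioms B.universal_arrow_axioms])
sublocale strict_1cell \<subseteq> V: is_functor "utop A" "utop B" "utop1 f"
  using strict by (simp add: strict_uarr_1cell_iff[OF A.universal_arrow_axioms B.universal_arrow_axioms])

context strict_1cell
begin

lemma commutes: "comp_func (utop A) (ubase1 f) (uR A) = comp_func (utop A) (uR B) (utop1 f)"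
  using strict by (simp add: strict_uarr_1cell_iff[OF A.universal_arrow_axioms B.universal_arrow_axioms])

lemma commutes_Obj [simp]: "X \<in> Obj (utop A) \<Longrightarrow> onO (uR B) (onO (utop1 f) X) = onO (ubase1 f) (onO (uR A) X)"
  using arg_cong[OF commutes, of "\<lambda>F. onO F X"] by simp

lemma commutes_Arr [simp]: "m \<in> Arr (utop A) \<Longrightarrow> onA (uR B) (onA (utop1 f) m) = onA (ubase1 f) (onA (uR A) m)"
  using arg_cong[OF commutes, of "\<lambda>F. onA F m"] by simp

lemma urho_eq: "urho f = id_nat (utop A) (ubase B) (comp_func (utop A) (ubase1 f) (uR A))"
  using strict by (simp add: strict_uarr_1cell_iff[OF A.universal_arrow_axioms B.universal_arrow_axioms])

lemma urho_Idn [simp]: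
  "X \<in> Obj (utop A) \<Longrightarrow> urho f X = Idn (ubase B) (onO (ubase1 f) (onO (uR A) X))"
  by (simp add: urho_eq)

end

lemma strict_uarr_1cellI:
  assumes "universal_arrow small A" "universal_arrow small B"
    and "is_functor (ubase A) (ubase B) (ubase1 f)" "is_functor (utop A) (utop B) (utop1 f)"
    and "\<And>X. X \<in> Obj (utop A) \<Longrightarrow> onO (ubase1 f) (onO (uR A) X) = onO (uR B) (onO (utop1 f) X)"
    and "\<And>m. m \<in> Arr (utop A) \<Longrightarrow> onA (ubase1 f) (onA (uR A) m) = onA (uR B) (onA (utop1 f) m)"
    and "urho f \<in> extensional (Obj (utop A))"
    and "\<And>X. X \<in> Obj (utop A) \<Longrightarrow> urho f X = Idn (ubase B) (onO (ubase1 f) (onO (uR A) X))"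
  shows "strict_uarr_1cell A B f"
  unfolding strict_uarr_1cell_iff[OF assms(1,2)]
proof (intro conjI)
  interpret A: universal_arrow small A by fact
  interpret B: universal_arrow small B by fact
  show "comp_func (utop A) (ubase1 f) (uR A) = comp_func (utop A) (uR B) (utop1 f)"
    by (rule functor_eqI) (auto intro: is_functor_comp_func assms(3,4) A.R B.R simp: assms(5,6))
  show "urho f = id_nat (utop A) (ubase B) (comp_func (utop A) (ubase1 f) (uR A))"
    by (rule extensionalityI[of _ "Obj (utop A)"]) (auto simp: assms(7,8), auto simp: id_nat_def)
qed (fact assms)+

lemma (in strict_1cell) uarr1_eqI:
  assumes "strict_1cell small A B g" "ubase1 f = ubase1 g" "utop1 f = utop1 g"
  shows "f = g"
proof -
  interpret g: strict_1cell small A B g by fact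
  show ?thesis using assms(2,3) by (simp add: urho_eq g.urho_eq)
qed

lemma uarr_2cell_iff:
  assumes "strict_1cell small A B f" "strict_1cell small A B g"
  shows "uarr_2cell A B (f, g, \<alpha>, \<beta>) \<longleftrightarrow>
    is_nat_trans (ubase A) (ubase B) (ubase1 f) (ubase1 g) \<alpha> \<and>
    is_nat_trans (utop A) (utop B) (utop1 f) (utop1 g) \<beta> \<and>
    (\<forall>X\<in>Obj (utop A). onA (uR B) (\<beta> X) = \<alpha> (onO (uR A) X))"
proof -
  interpret f: strict_1cell small A B f by fact
  interpret g: strict_1cell small A B g by fact
  have "onA (uR B) (\<beta> X) \<cdot>\<^bsub>ubase B\<^esub> urho f X = onA (uR B) (\<beta> X) \<and>
      urho g X \<cdot>\<^bsub>ubase B\<^esub> \<alpha> (onO (uR A) X) = \<alpha> (onO (uR A) X)"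
    if "is_nat_trans (ubase A) (ubase B) (ubase1 f) (ubase1 g) \<alpha>"
      "is_nat_trans (utop A) (utop B) (utop1 f) (utop1 g) \<beta>" "X \<in> Obj (utop A)" for X
  proof -
    interpret \<alpha>: is_nat_trans "ubase A" "ubase B" "ubase1 f" "ubase1 g" \<alpha> by fact
    interpret \<beta>: is_nat_trans "utop A" "utop B" "utop1 f" "utop1 g" \<beta> by fact
    show ?thesis using that(3) by simp
  qed
  then show ?thesis unfolding uarr_2cell_def by auto
qed

locale strict_2cell =
  f: strict_1cell small A B f + g: strict_1cell small A B g
  for small :: "'u set \<Rightarrow> bool" and A B :: "'u uarr" and f g :: "'u uarr1" +
  fixes \<alpha> \<beta> :: "'u \<Rightarrow> 'u"
  assumes cell: "uarr_2cell A B (f, g, \<alpha>, \<beta>)"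

sublocale strict_2cell \<subseteq> \<alpha>: is_nat_trans "ubase A" "ubase B" "ubase1 f" "ubase1 g" \<alpha>
  using cell by (simp add: uarr_2cell_def)
sublocale strict_2cell \<subseteq> \<beta>: is_nat_trans "utop A" "utop B" "utop1 f" "utop1 g" \<beta>
  using cell by (simp add: uarr_2cell_def)

context strict_2cell
begin

lemma compatible [simp]: "X \<in> Obj (utop A) \<Longrightarrow> onA (uR B) (\<beta> X) = \<alpha> (onO (uR A) X)"
  using cell by (simp add: uarr_2cell_iff[OF f.strict_1cell_axioms g.strict_1cell_axioms])

end

lemma strict_2cellI:
  assumes "strict_1cell small A B f" "strict_1cell small A B g"
    and "is_nat_trans (ubase A) (ubase B) (ubase1 f) (ubase1 g) \<alpha>"
    and "is_nat_trans (utop A) (utop B) (utop1 f) (utop1 g) \<beta>"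
    and "\<And>X. X \<in> Obj (utop A) \<Longrightarrow> onA (uR B) (\<beta> X) = \<alpha> (onO (uR A) X)"
  shows "strict_2cell small A B f g \<alpha> \<beta>"
  by (simp add: strict_2cell_def strict_2cell_axioms_def assms uarr_2cell_iff[OF assms(1,2)])

lemma UArr_simps [simp]:
  "A \<in> Ob (UArr small) \<longleftrightarrow> universal_arrow small A"
  "Hom (UArr small) = uarr_Hom"
  "Id1 (UArr small) = uarr_Id1"
  "Comp1 (UArr small) = uarr_Comp1"
  "Comp2 (UArr small) = uarr_Comp2"
  by (simp_all add: UArr_def)

lemma Obj_uarr_Hom:
  assumes "universal_arrow small A" "universal_arrow small B"
  shows "f \<in> Obj (uarr_Hom A B) \<longleftrightarrow> strict_1cell small A B f"
  using assms by (simp add: uarr_Hom_def strict_1cell_def strict_1cell_axioms_def)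

lemma Arr_uarr_Hom:
  assumes "universal_arrow small A" "universal_arrow small B"
  shows "x \<in> Arr (uarr_Hom A B) \<longleftrightarrow> (\<exists>f g \<alpha> \<beta>. x = (f, g, \<alpha>, \<beta>) \<and> strict_2cell small A B f g \<alpha> \<beta>)"
  using assms
  by (cases x) (simp add: uarr_Hom_def strict_2cell_def strict_2cell_axioms_def
      strict_1cell_def strict_1cell_axioms_def)

lemma hom_uarr_Hom:
  assumes "universal_arrow small A" "universal_arrow small B"
  shows "x \<in> hom (uarr_Hom A B) f g \<longleftrightarrow> (\<exists>\<alpha> \<beta>. x = (f, g, \<alpha>, \<beta>) \<and> strict_2cell small A B f g \<alpha> \<beta>)"
proof (cases x)
  case (fields f' g' \<alpha> \<beta>)
  have "x \<in> Arr (uarr_Hom A B) \<Longrightarrow> Dom (uarr_Hom A B) x = f' \<and> Cod (uarr_Hom A B) x = g'"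
    using fields by (simp add: uarr_Hom_def)
  then show ?thesis
    using fields by (auto simp: hom_iff Arr_uarr_Hom[OF assms])
qed

lemma Comp_uarr_Hom [simp]:
  assumes "strict_2cell small A B f g \<alpha> \<beta>" "strict_2cell small A B g h \<alpha>' \<beta>'"
  shows "(g, h, \<alpha>', \<beta>') \<cdot>\<^bsub>uarr_Hom A B\<^esub> (f, g, \<alpha>, \<beta>)
       = (f, h, vcomp (ubase A) (ubase B) \<alpha>' \<alpha>, vcomp (utop A) (utop B) \<beta>' \<beta>)"
  using assms
  by (simp add: uarr_Hom_def strict_2cell_def strict_2cell_axioms_def
      strict_1cell_def strict_1cell_axioms_def)

lemma Id2_UArr [simp]:
  assumes "strict_1cell small A B f"
  shows "Id2 (UArr small) A B f =
    (f, f, id_nat (ubase A) (ubase B) (ubase1 f), id_nat (utop A) (utop B) (utop1 f))"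
  using assms by (simp add: Id2_def uarr_Hom_def strict_1cell_def strict_1cell_axioms_def)

lemma uarr_Comp2_simp [simp]:
  "uarr_Comp2 A B C (g, g', \<alpha>', \<beta>') (f, f', \<alpha>, \<beta>) =
    (uarr_Comp1 A B C g f, uarr_Comp1 A B C g' f',
     hcomp (ubase A) (ubase C) (ubase1 g) \<alpha>' (ubase1 f') \<alpha>,
     hcomp (utop A) (utop C) (utop1 g) \<beta>' (utop1 f') \<beta>)"
  by (simp add: uarr_Comp2_def)

lemma strict_2cell_id:
  assumes "strict_1cell small A B f"
  shows "strict_2cell small A B f f (id_nat (ubase A) (ubase B) (ubase1 f))
    (id_nat (utop A) (utop B) (utop1 f))"
proof -
  interpret strict_1cell small A B f by fact
  show ?thesis
    by (rule strict_2cellI)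
      (auto intro: assms is_nat_trans_id_nat J.is_functor_axioms V.is_functor_axioms)
qed

lemma strict_2cell_vcomp:
  assumes "strict_2cell small A B f g \<alpha> \<beta>" "strict_2cell small A B g h \<alpha>' \<beta>'"
  shows "strict_2cell small A B f h (vcomp (ubase A) (ubase B) \<alpha>' \<alpha>) (vcomp (utop A) (utop B) \<beta>' \<beta>)"
proof -
  interpret s: strict_2cell small A B f g \<alpha> \<beta> by fact
  interpret t: strict_2cell small A B g h \<alpha>' \<beta>' by fact
  show ?thesis
    by (rule strict_2cellI)
      (auto intro: is_nat_trans_vcomp s.f.strict_1cell_axioms t.g.strict_1cell_axioms
        s.\<alpha>.is_nat_trans_axioms s.\<beta>.is_nat_trans_axioms
        t.\<alpha>.is_nat_trans_axioms t.\<beta>.is_nat_trans_axioms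
        simp: s.f.B.R.preserves_Comp)
qed

lemma category_uarr_Hom:
  assumes "universal_arrow small A" "universal_arrow small B"
  shows "category (uarr_Hom A B)"
proof -
  have one: "strict_uarr_1cell A B f \<longleftrightarrow> strict_1cell small A B f" for f
    using assms by (simp add: strict_1cell_def strict_1cell_axioms_def)
  have two: "strict_uarr_1cell A B f \<and> strict_uarr_1cell A B g \<and> uarr_2cell A B (f, g, \<alpha>, \<beta>)
      \<longleftrightarrow> strict_2cell small A B f g \<alpha> \<beta>" for f g \<alpha> \<beta>
    using assms by (simp add: strict_2cell_def strict_2cell_axioms_def
        strict_1cell_def strict_1cell_axioms_def)
  show ?thesis
    unfolding uarr_Hom_def two unfolding one
  proof (rule category_mk_cat, goal_cases)
    case (1 x)
    then show ?case by (auto simp: strict_2cell_def)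
  next
    case (2 f)
    then show ?case by (auto simp: strict_2cell_id)
  next
    case (3 x y)
    then show ?case by (auto intro: strict_2cell_vcomp)
  next
    case (4 x)
    then show ?case
      by (auto intro!: vcomp_id_right
          simp: strict_2cell_def strict_2cell_axioms_def uarr_2cell_def)
  next
    case (5 x)
    then show ?case
      by (auto intro!: vcomp_id_left
          simp: strict_2cell_def strict_2cell_axioms_def uarr_2cell_def)
  next
    case (6 x y z)
    then show ?case
      by (auto intro!: vcomp_assoc
          simp: strict_2cell_def strict_2cell_axioms_def uarr_2cell_def)
  qed
qed

lemma uarr_Comp1_simps [simp]:
  "ubase1 (uarr_Comp1 A B C g f) = comp_func (ubase A) (ubase1 g) (ubase1 f)"
  "utop1 (uarr_Comp1 A B C g f) = comp_func (utop A) (utop1 g) (utop1 f)"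
  by (simp_all add: uarr_Comp1_def)

lemma uarr_Id1_simps [simp]:
  "ubase1 (uarr_Id1 A) = id_func (ubase A)" "utop1 (uarr_Id1 A) = id_func (utop A)"
  by (simp_all add: uarr_Id1_def)

lemma strict_1cell_Id1:
  assumes "universal_arrow small A"
  shows "strict_1cell small A A (uarr_Id1 A)"
proof -
  interpret universal_arrow small A by fact
  have "strict_uarr_1cell A A (uarr_Id1 A)"
    by (rule strict_uarr_1cellI)
      (auto intro: assms is_functor_id_func C.category_axioms X.category_axioms simp: uarr_Id1_def id_nat_def)
  then show ?thesis using assms by (simp add: strict_1cell_def strict_1cell_axioms_def)
qed

lemma strict_1cell_Comp1:
  assumes "strict_1cell small A B f" "strict_1cell small B C g"
  shows "strict_1cell small A C (uarr_Comp1 A B C g f)"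
proof -
  interpret f: strict_1cell small A B f by fact
  interpret g: strict_1cell small B C g by fact
  have "strict_uarr_1cell A C (uarr_Comp1 A B C g f)"
    by (rule strict_uarr_1cellI)
      (auto intro: f.A.universal_arrow_axioms g.B.universal_arrow_axioms is_functor_comp_func
        f.J.is_functor_axioms f.V.is_functor_axioms g.J.is_functor_axioms g.V.is_functor_axioms
        simp: uarr_Comp1_def)
  then show ?thesis
    by (simp add: strict_1cell_def strict_1cell_axioms_def
        f.A.universal_arrow_axioms g.B.universal_arrow_axioms)
qed

lemma strict_2cell_hcomp:
  assumes "strict_2cell small A B f f' \<alpha> \<beta>" "strict_2cell small B C g g' \<alpha>' \<beta>'"
  shows "strict_2cell small A C (uarr_Comp1 A B C g f) (uarr_Comp1 A B C g' f')
    (hcomp (ubase A) (ubase C) (ubase1 g) \<alpha>' (ubase1 f') \<alpha>)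
    (hcomp (utop A) (utop C) (utop1 g) \<beta>' (utop1 f') \<beta>)"
proof -
  interpret s: strict_2cell small A B f f' \<alpha> \<beta> by fact
  interpret t: strict_2cell small B C g g' \<alpha>' \<beta>' by fact
  show ?thesis
    by (rule strict_2cellI)
      (auto intro: is_nat_trans_hcomp strict_1cell_Comp1
        s.f.strict_1cell_axioms t.g.strict_1cell_axioms s.g.strict_1cell_axioms t.f.strict_1cell_axioms
        s.\<alpha>.is_nat_trans_axioms s.\<beta>.is_nat_trans_axioms
        t.\<alpha>.is_nat_trans_axioms t.\<beta>.is_nat_trans_axioms
        simp: t.f.B.R.preserves_Comp)
qed

lemma strict_2cellE:
  assumes "strict_2cell small A B f g \<alpha> \<beta>"
  shows "strict_1cell small A B f" "strict_1cell small A B g"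
    "is_nat_trans (ubase A) (ubase B) (ubase1 f) (ubase1 g) \<alpha>"
    "is_nat_trans (utop A) (utop B) (utop1 f) (utop1 g) \<beta>"
  using assms by (auto simp: strict_2cell_def strict_2cell_axioms_def uarr_2cell_def)

lemma strict_1cellE:
  assumes "strict_1cell small A B f"
  shows "is_functor (ubase A) (ubase B) (ubase1 f)" "is_functor (utop A) (utop B) (utop1 f)"
    "universal_arrow small A" "universal_arrow small B"
proof -
  interpret strict_1cell small A B f by fact
  show "is_functor (ubase A) (ubase B) (ubase1 f)" "is_functor (utop A) (utop B) (utop1 f)"
    "universal_arrow small A" "universal_arrow small B"
    by (fact J.is_functor_axioms V.is_functor_axioms A.universal_arrow_axioms B.universal_arrow_axioms)+
qed

lemma uarr_Comp1_assoc:
  assumes "strict_1cell small A B f" "strict_1cell small B C g" "strict_1cell small C D h"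
  shows "uarr_Comp1 A C D h (uarr_Comp1 A B C g f) = uarr_Comp1 A B D (uarr_Comp1 B C D h g) f"
  by (rule strict_1cell.uarr1_eqI)
    (auto intro!: strict_1cell_Comp1 comp_func_assoc intro: assms strict_1cellE[OF assms(1)]
      strict_1cellE[OF assms(2)] strict_1cellE[OF assms(3)])

lemma uarr_Comp1_Id1_right:
  assumes "strict_1cell small A B f"
  shows "uarr_Comp1 A A B f (uarr_Id1 A) = f"
  by (rule strict_1cell.uarr1_eqI)
    (auto intro!: strict_1cell_Comp1 strict_1cell_Id1 comp_func_id_right
      intro: assms strict_1cellE[OF assms])

lemma uarr_Comp1_Id1_left:
  assumes "strict_1cell small A B f"
  shows "uarr_Comp1 A B B (uarr_Id1 B) f = f"
  by (rule strict_1cell.uarr1_eqI)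
    (auto intro!: strict_1cell_Comp1 strict_1cell_Id1 comp_func_id_left
      intro: assms strict_1cellE[OF assms])

proposition two_category_UArr: "two_category (UArr small)"
proof (rule two_category.intro, unfold UArr_simps, goal_cases)
  case (1 A B)
  then show ?case by (rule category_uarr_Hom)
next
  case (2 A)
  then show ?case by (simp add: Obj_uarr_Hom[of small] strict_1cell_Id1)
next
  case (3 A B C f g)
  then show ?case by (simp add: Obj_uarr_Hom[of small] strict_1cell_Comp1)
next
  case (4 A B C \<alpha> f f' \<beta> g g')
  then show ?case by (auto simp: hom_uarr_Hom[of small] strict_2cell_hcomp)
next
  case (5 A B C f g)
  then show ?case
    by (simp add: Obj_uarr_Hom[of small] hcomp_id_nat strict_1cellE strict_1cell_Comp1)
next
  case (6 A B C \<alpha> f f' \<alpha>' f'' \<beta> g g' \<beta>' g'')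
  then show ?case
    by (auto simp: hom_uarr_Hom[of small] Comp_uarr_Hom[of small] strict_2cell_hcomp
        intro!: hcomp_vcomp dest: strict_2cellE)
next
  case (7 A B C D f g h)
  then show ?case by (simp add: Obj_uarr_Hom[of small] uarr_Comp1_assoc)
next
  case (8 A B C D \<alpha> \<beta> \<gamma>)
  then show ?case
    by (auto simp: Arr_uarr_Hom[of small] intro!: hcomp_assoc uarr_Comp1_assoc dest: strict_2cellE)
next
  case (9 A B f)
  then show ?case by (simp add: Obj_uarr_Hom[of small] uarr_Comp1_Id1_right)
next
  case (10 A B f)
  then show ?case by (simp add: Obj_uarr_Hom[of small] uarr_Comp1_Id1_left)
next
  case (11 A B \<alpha>)
  then show ?case
    by (auto simp: Arr_uarr_Hom[of small] Id2_UArr[OF strict_1cell_Id1]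
        intro!: hcomp_id_right uarr_Comp1_Id1_right dest: strict_2cellE)
next
  case (12 A B \<alpha>)
  then show ?case
    by (auto simp: Arr_uarr_Hom[of small] Id2_UArr[OF strict_1cell_Id1]
        intro!: hcomp_id_left uarr_Comp1_Id1_left dest: strict_2cellE)
qed

section \<open>Extensive monads and their algebras\<close>

sublocale extensive_monad \<subseteq> C: category "mcat M"
  using base by (simp add: small_category_def)

lemma algebra_mor_iff:
  "algebra_mor M (K, k) (N, n) q \<longleftrightarrow> q \<in> Arr (mcat M) \<and> Dom (mcat M) q = K \<and> Cod (mcat M) q = N \<and>
    (\<forall>a\<in>Arr (mcat M). Cod (mcat M) a = K \<longrightarrow> n (q \<cdot>\<^bsub>mcat M\<^esub> a) = q \<cdot>\<^bsub>mcat M\<^esub> k a)"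
  by (auto simp: algebra_mor_def hom_iff)

lemma algebraI:
  assumes "N \<in> Obj (mcat M)" "n \<in> extensional (arrows_into (mcat M) N)"
    and "\<And>a. \<lbrakk>a \<in> Arr (mcat M); Cod (mcat M) a = N\<rbrakk> \<Longrightarrow> n a \<in> Arr (mcat M)
      \<and> Dom (mcat M) (n a) = mS M (Dom (mcat M) a) \<and> Cod (mcat M) (n a) = N
      \<and> n a \<cdot>\<^bsub>mcat M\<^esub> meta M (Dom (mcat M) a) = a"
    and "\<And>b h. \<lbrakk>b \<in> Arr (mcat M); Cod (mcat M) b = N; h \<in> Arr (mcat M);
        Cod (mcat M) h = mS M (Dom (mcat M) b)\<rbrakk>
      \<Longrightarrow> n (n b \<cdot>\<^bsub>mcat M\<^esub> h) = n b \<cdot>\<^bsub>mcat M\<^esub> mext M (Dom (mcat M) b) h"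
  shows "algebra M (N, n)"
  using assms by (auto simp: algebra_def hom_iff)

context extensive_monad
begin

lemma S_in [simp]: "A \<in> Obj (mcat M) \<Longrightarrow> mS M A \<in> Obj (mcat M)"
  using S by auto

lemma eta_simps [simp]:
  assumes "A \<in> Obj (mcat M)"
  shows "meta M A \<in> Arr (mcat M)" "Dom (mcat M) (meta M A) = A" "Cod (mcat M) (meta M A) = mS M A"
  using eta[OF assms] by (auto simp: hom_iff)

lemma ext_simps [simp]:
  assumes "B \<in> Obj (mcat M)" "h \<in> Arr (mcat M)" "Cod (mcat M) h = mS M B"
  shows "mext M B h \<in> Arr (mcat M)" "Dom (mcat M) (mext M B h) = mS M (Dom (mcat M) h)"
    "Cod (mcat M) (mext M B h) = mS M B"
    "mext M B h \<cdot>\<^bsub>mcat M\<^esub> meta M (Dom (mcat M) h) = h"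
  using ext[of B h "Dom (mcat M) h"] ext_comp_eta[of B h "Dom (mcat M) h"] assms
  by (auto simp: hom_iff)

lemma mext_extensional [simp]:
  "mext M \<in> extensional (Obj (mcat M))"
  "B \<in> Obj (mcat M) \<Longrightarrow> mext M B \<in> extensional (arrows_into (mcat M) (mS M B))"
  using ext_ext by (auto simp: PiE_iff)

lemma algebra_free: "B \<in> Obj (mcat M) \<Longrightarrow> algebra M (free_alg M B)"
  unfolding free_alg_def
  by (rule algebraI) (auto intro: ext_comp_ext simp: hom_iff)

lemma algebra_mor_Idn: "algebra M (N, n) \<Longrightarrow> algebra_mor M (N, n) (N, n) (Idn (mcat M) N)"
  by (auto simp: algebra_mor_def algebra_def hom_iff)

lemma algebra_mor_Comp:
  assumes "algebra_mor M (K, k) (N, n) q" "algebra_mor M (N, n) (H, h) r" "algebra M (K, k)"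
  shows "algebra_mor M (K, k) (H, h) (r \<cdot>\<^bsub>mcat M\<^esub> q)"
  unfolding algebra_mor_iff
proof (intro conjI ballI impI)
  have q: "q \<in> Arr (mcat M)" "Dom (mcat M) q = K" "Cod (mcat M) q = N"
    and r: "r \<in> Arr (mcat M)" "Dom (mcat M) r = N" "Cod (mcat M) r = H"
    using assms(1,2) by (auto simp: algebra_mor_iff)
  then show "r \<cdot>\<^bsub>mcat M\<^esub> q \<in> Arr (mcat M)" "Dom (mcat M) (r \<cdot>\<^bsub>mcat M\<^esub> q) = K"
    "Cod (mcat M) (r \<cdot>\<^bsub>mcat M\<^esub> q) = H" by auto
  fix a
  assume a: "a \<in> Arr (mcat M)" "Cod (mcat M) a = K"
  then have "k a \<in> Arr (mcat M)" "Cod (mcat M) (k a) = K"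
    using assms(3) by (auto simp: algebra_def hom_iff)
  then show "h ((r \<cdot>\<^bsub>mcat M\<^esub> q) \<cdot>\<^bsub>mcat M\<^esub> a) = (r \<cdot>\<^bsub>mcat M\<^esub> q) \<cdot>\<^bsub>mcat M\<^esub> k a"
    using q r a assms(1,2) by (simp add: C.assoc algebra_mor_iff)
qed

end

locale monad_algebra = extensive_monad +
  fixes N :: 'a and n :: "'a \<Rightarrow> 'a"
  assumes algebra: "algebra M (N, n)"
begin

lemma carrier_in [simp]: "N \<in> Obj (mcat M)"
  using algebra by (simp add: algebra_def)

lemma ext_struct: "n \<in> extensional (arrows_into (mcat M) N)"
  using algebra by (simp add: algebra_def)

lemma struct_simps [simp]:
  assumes "a \<in> Arr (mcat M)" "Cod (mcat M) a = N"
  shows "n a \<in> Arr (mcat M)" "Dom (mcat M) (n a) = mS M (Dom (mcat M) a)" "Cod (mcat M) (n a) = N"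
    "n a \<cdot>\<^bsub>mcat M\<^esub> meta M (Dom (mcat M) a) = a"
  using algebra assms by (auto simp: algebra_def hom_iff)

lemma struct_ext:
  assumes "b \<in> Arr (mcat M)" "Cod (mcat M) b = N" "h \<in> Arr (mcat M)"
    "Cod (mcat M) h = mS M (Dom (mcat M) b)"
  shows "n (n b \<cdot>\<^bsub>mcat M\<^esub> h) = n b \<cdot>\<^bsub>mcat M\<^esub> mext M (Dom (mcat M) b) h"
  using algebra assms by (auto simp: algebra_def hom_iff)

lemma struct_Idn_eta [simp]: "n (Idn (mcat M) N) \<cdot>\<^bsub>mcat M\<^esub> meta M N = Idn (mcat M) N"
  using struct_simps(4)[of "Idn (mcat M) N"] by simp

text \<open>The whole structure is determined by the structure map \<open>n 1 : S N \<rightarrow> N\<close>, as \<open>n a = n 1 \<cdot> S a\<close>.\<close>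

lemma struct_via_Idn:
  assumes "a \<in> Arr (mcat M)" "Cod (mcat M) a = N"
  shows "n (Idn (mcat M) N) \<cdot>\<^bsub>mcat M\<^esub> mext M N (meta M N \<cdot>\<^bsub>mcat M\<^esub> a) = n a"
proof -
  have "n (Idn (mcat M) N) \<cdot>\<^bsub>mcat M\<^esub> mext M N (meta M N \<cdot>\<^bsub>mcat M\<^esub> a)
      = n (n (Idn (mcat M) N) \<cdot>\<^bsub>mcat M\<^esub> (meta M N \<cdot>\<^bsub>mcat M\<^esub> a))"
    using struct_ext[of "Idn (mcat M) N" "meta M N \<cdot>\<^bsub>mcat M\<^esub> a"] assms by simp
  also have "n (Idn (mcat M) N) \<cdot>\<^bsub>mcat M\<^esub> (meta M N \<cdot>\<^bsub>mcat M\<^esub> a) = a"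
    using assms by (simp add: C.assoc[symmetric])
  finally show ?thesis .
qed

end

lemma monad_algebraI: "extensive_monad small M \<Longrightarrow> algebra M (N, n) \<Longrightarrow> monad_algebra small M N n"
  by (simp add: monad_algebra_def monad_algebra_axioms_def)

lemma EM_simps [simp]:
  "Obj (EM M) = {N. algebra M N}"
  "Arr (EM M) = {(K, N, q). algebra M K \<and> algebra M N \<and> algebra_mor M K N q}"
  by (simp_all add: EM_def)

lemma EM_arrow_simps [simp]:
  assumes "algebra M K" "algebra M N" "algebra_mor M K N q"
  shows "Dom (EM M) (K, N, q) = K" "Cod (EM M) (K, N, q) = N"
    "\<lbrakk>algebra M H; algebra_mor M N H r\<rbrakk>
      \<Longrightarrow> (N, H, r) \<cdot>\<^bsub>EM M\<^esub> (K, N, q) = (K, H, r \<cdot>\<^bsub>mcat M\<^esub> q)"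
  using assms by (simp_all add: EM_def)

lemma Idn_EM [simp]: "algebra M N \<Longrightarrow> Idn (EM M) N = (N, N, Idn (mcat M) (fst N))"
  by (simp add: EM_def)

lemma category_EM:
  assumes "extensive_monad small M"
  shows "category (EM M)"
proof -
  interpret extensive_monad small M by fact
  show ?thesis
    unfolding EM_def
  proof (rule category_mk_cat, goal_cases)
    case (2 A)
    then show ?case by (cases A) (auto simp: algebra_mor_Idn)
  next
    case (3 f g)
    then show ?case by (auto intro: algebra_mor_Comp)
  qed (auto simp: algebra_mor_iff C.assoc)
qed

section \<open>1-cells of monads act on algebras\<close>

locale emnd_cell1 =
  M: extensive_monad small M + T: extensive_monad small T
  for small :: "'u set \<Rightarrow> bool" and M T :: "'u emnd" and P :: "'u emnd1" +
  assumes cell: "emnd_1cell M T P"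

sublocale emnd_cell1 \<subseteq> P: is_functor "mcat M" "mcat T" "pfun P"
  using cell by (simp add: emnd_1cell_def)

context emnd_cell1
begin

lemma pext_ext: "pext P \<in> extensional (Obj (mcat M))"
  using cell by (simp add: emnd_1cell_def)

lemma algebra_pext: "A \<in> Obj (mcat M) \<Longrightarrow> algebra T (pext_alg M P A)"
  using cell by (simp add: emnd_1cell_def)

lemma monad_algebra_pext:
  "A \<in> Obj (mcat M) \<Longrightarrow> monad_algebra small T (onO (pfun P) (mS M A)) (pext P A)"
  using algebra_pext by (intro monad_algebraI) (auto simp: pext_alg_def T.extensive_monad_axioms)

lemmas pext_simps [simp] = monad_algebra.struct_simps[OF monad_algebra_pext]
lemmas pext_pext = monad_algebra.struct_ext[OF monad_algebra_pext]

lemma algebra_mor_pext: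
  "\<lbrakk>B \<in> Obj (mcat M); h \<in> Arr (mcat M); Cod (mcat M) h = mS M B\<rbrakk>
    \<Longrightarrow> algebra_mor T (pext_alg M P (Dom (mcat M) h)) (pext_alg M P B) (onA (pfun P) (mext M B h))"
  using cell by (simp add: emnd_1cell_def hom_iff)

lemma pext_mext:
  assumes "B \<in> Obj (mcat M)" "h \<in> Arr (mcat M)" "Cod (mcat M) h = mS M B"
    "q \<in> Arr (mcat T)" "Cod (mcat T) q = onO (pfun P) (mS M (Dom (mcat M) h))"
  shows "pext P B (onA (pfun P) (mext M B h) \<cdot>\<^bsub>mcat T\<^esub> q)
    = onA (pfun P) (mext M B h) \<cdot>\<^bsub>mcat T\<^esub> pext P (Dom (mcat M) h) q"
  using algebra_mor_pext[OF assms(1-3)] assms(4,5) by (simp add: pext_alg_def algebra_mor_iff)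

lemma hat_alg_eq:
  "hat_alg M T P (N, n) = (onO (pfun P) N, \<lambda>q\<in>arrows_into (mcat T) (onO (pfun P) N).
    onA (pfun P) (n (Idn (mcat M) N)) \<cdot>\<^bsub>mcat T\<^esub> pext P N (onA (pfun P) (meta M N) \<cdot>\<^bsub>mcat T\<^esub> q))"
  by (simp add: hat_alg_def)

text \<open>The naturality of \<open>\<eta>\<close> turns \<open>P(\<eta> \<cdot> q)\<close> into \<open>P(S q) \<cdot> P \<eta>\<close>, and \<open>P(S q)\<close> can be moved out of
  the extension because it is a morphism of algebras.\<close>

lemma pext_eta_comp:
  assumes "q \<in> Arr (mcat M)" "Dom (mcat M) q = K" "Cod (mcat M) q = N"
    and "a \<in> Arr (mcat T)" "Cod (mcat T) a = onO (pfun P) K"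
  shows "pext P N (onA (pfun P) (meta M N) \<cdot>\<^bsub>mcat T\<^esub> (onA (pfun P) q \<cdot>\<^bsub>mcat T\<^esub> a))
    = onA (pfun P) (mext M N (meta M N \<cdot>\<^bsub>mcat M\<^esub> q))
        \<cdot>\<^bsub>mcat T\<^esub> pext P K (onA (pfun P) (meta M K) \<cdot>\<^bsub>mcat T\<^esub> a)"
proof -
  have K: "K \<in> Obj (mcat M)" and N: "N \<in> Obj (mcat M)"
    using assms by auto
  have "meta M N \<cdot>\<^bsub>mcat M\<^esub> q = mext M N (meta M N \<cdot>\<^bsub>mcat M\<^esub> q) \<cdot>\<^bsub>mcat M\<^esub> meta M K"
    using M.ext_simps(4)[of N "meta M N \<cdot>\<^bsub>mcat M\<^esub> q"] assms N by simp
  then have "onA (pfun P) (meta M N \<cdot>\<^bsub>mcat M\<^esub> q)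
      = onA (pfun P) (mext M N (meta M N \<cdot>\<^bsub>mcat M\<^esub> q)) \<cdot>\<^bsub>mcat T\<^esub> onA (pfun P) (meta M K)"
    using assms N K by (metis P.preserves_Comp M.eta_simps M.ext_simps M.C.Comp_simps)
  then have "onA (pfun P) (meta M N) \<cdot>\<^bsub>mcat T\<^esub> (onA (pfun P) q \<cdot>\<^bsub>mcat T\<^esub> a)
      = onA (pfun P) (mext M N (meta M N \<cdot>\<^bsub>mcat M\<^esub> q))
         \<cdot>\<^bsub>mcat T\<^esub> (onA (pfun P) (meta M K) \<cdot>\<^bsub>mcat T\<^esub> a)"
    using assms N K by (simp add: P.preserves_Comp T.C.assoc[symmetric])
  then show ?thesis
    using pext_mext[of N "meta M N \<cdot>\<^bsub>mcat M\<^esub> q" "onA (pfun P) (meta M K) \<cdot>\<^bsub>mcat T\<^esub> a"] assms N K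
    by simp
qed

text \<open>That the lifted structure is unital comes from the unit law of \<open>n 1\<close>. Its associativity
  combines that of \<open>n\<close>, in the form \<open>n 1 \<cdot> S(n 1) = n 1 \<cdot> \<mu>\<close> with \<open>\<mu> = 1\<^sup>S\<close>, with that of the given
  structure on \<open>P S N\<close>; the maps \<open>P(S(n 1))\<close> and \<open>P \<mu>\<close> pass through the extensions because they are
  morphisms of algebras.\<close>

lemma algebra_hat:
  assumes "algebra M X"
  shows "algebra T (hat_alg M T P X)"
proof (cases X)
  case (Pair N n)
  interpret N: monad_algebra small M N n
    using assms Pair by (auto intro: monad_algebraI M.extensive_monad_axioms)
  let ?s = "n (Idn (mcat M) N)" and ?C = "mcat M" and ?D = "mcat T" and ?P = "onA (pfun P)"
  let ?e = "\<lambda>q. ?P ?s \<cdot>\<^bsub>?D\<^esub> pext P N (?P (meta M N) \<cdot>\<^bsub>?D\<^esub> q)"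
  have s: "?s \<in> Arr ?C" "Dom ?C ?s = mS M N" "Cod ?C ?s = N" by auto
  have Pone: "?P ?s \<cdot>\<^bsub>?D\<^esub> ?P (meta M N) = Idn ?D (onO (pfun P) N)"
    using s by (simp add: P.preserves_Comp[symmetric])
  have eta: "?e q \<cdot>\<^bsub>?D\<^esub> meta T (Dom ?D q) = q"
    if q: "q \<in> Arr ?D" "Cod ?D q = onO (pfun P) N" for q
  proof -
    have "?e q \<cdot>\<^bsub>?D\<^esub> meta T (Dom ?D q)
        = ?P ?s \<cdot>\<^bsub>?D\<^esub> (pext P N (?P (meta M N) \<cdot>\<^bsub>?D\<^esub> q) \<cdot>\<^bsub>?D\<^esub> meta T (Dom ?D (?P (meta M N) \<cdot>\<^bsub>?D\<^esub> q)))"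
      using q s by (simp add: T.C.assoc)
    also have "\<dots> = (?P ?s \<cdot>\<^bsub>?D\<^esub> ?P (meta M N)) \<cdot>\<^bsub>?D\<^esub> q"
      using q s by (subst pext_simps(4)) (simp_all add: T.C.assoc)
    finally show ?thesis using q by (simp add: Pone)
  qed
  have ext: "?e (?e b \<cdot>\<^bsub>?D\<^esub> h) = ?e b \<cdot>\<^bsub>?D\<^esub> mext T (Dom ?D b) h"
    if b: "b \<in> Arr ?D" "Cod ?D b = onO (pfun P) N"
      and h: "h \<in> Arr ?D" "Cod ?D h = mS T (Dom ?D b)" for b h
  proof -
    let ?b = "?P (meta M N) \<cdot>\<^bsub>?D\<^esub> b" and ?i = "Idn ?C (mS M N)"
    let ?x = "pext P N ?b \<cdot>\<^bsub>?D\<^esub> h"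
    let ?z = "pext P (mS M N) (?P (meta M (mS M N)) \<cdot>\<^bsub>?D\<^esub> ?x)"
    have x: "?x \<in> Arr ?D" "Cod ?D ?x = onO (pfun P) (mS M N)" "Dom ?D ?x = Dom ?D h"
      using b h by auto
    have "?e (?e b \<cdot>\<^bsub>?D\<^esub> h) = ?P ?s \<cdot>\<^bsub>?D\<^esub> pext P N (?P (meta M N) \<cdot>\<^bsub>?D\<^esub> (?P ?s \<cdot>\<^bsub>?D\<^esub> ?x))"
      using b h s by (simp add: T.C.assoc)
    also have "\<dots> = ?P ?s \<cdot>\<^bsub>?D\<^esub> (?P (mext M N (meta M N \<cdot>\<^bsub>?C\<^esub> ?s)) \<cdot>\<^bsub>?D\<^esub> ?z)"
      using s x by (subst pext_eta_comp) auto
    also have "\<dots> = ?P (?s \<cdot>\<^bsub>?C\<^esub> mext M N (meta M N \<cdot>\<^bsub>?C\<^esub> ?s)) \<cdot>\<^bsub>?D\<^esub> ?z"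
      using s x by (simp add: P.preserves_Comp T.C.assoc)
    \<comment> \<open>The structure map coequalizes \<open>S(n 1)\<close> and the multiplication \<open>S S N \<rightarrow> S N\<close> of the monad.\<close>
    also have "?s \<cdot>\<^bsub>?C\<^esub> mext M N (meta M N \<cdot>\<^bsub>?C\<^esub> ?s) = ?s \<cdot>\<^bsub>?C\<^esub> mext M N ?i"
      using N.struct_via_Idn[of ?s] N.struct_ext[of "Idn ?C N" ?i] s by simp
    also have "?P (?s \<cdot>\<^bsub>?C\<^esub> mext M N ?i) \<cdot>\<^bsub>?D\<^esub> ?z = ?P ?s \<cdot>\<^bsub>?D\<^esub> (?P (mext M N ?i) \<cdot>\<^bsub>?D\<^esub> ?z)"
      using s x by (simp add: P.preserves_Comp T.C.assoc)
    also have "?P (mext M N ?i) \<cdot>\<^bsub>?D\<^esub> ?z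
        = pext P N (?P (mext M N ?i) \<cdot>\<^bsub>?D\<^esub> (?P (meta M (mS M N)) \<cdot>\<^bsub>?D\<^esub> ?x))"
      using x pext_mext[of N ?i "?P (meta M (mS M N)) \<cdot>\<^bsub>?D\<^esub> ?x"] by simp
    also have "?P (mext M N ?i) \<cdot>\<^bsub>?D\<^esub> (?P (meta M (mS M N)) \<cdot>\<^bsub>?D\<^esub> ?x) = ?x"
      using x M.ext_simps(4)[of N ?i] by (simp add: T.C.assoc[symmetric] P.preserves_Comp[symmetric])
    also have "pext P N ?x = pext P N ?b \<cdot>\<^bsub>?D\<^esub> mext T (Dom ?D b) h"
      using b h pext_pext[of N ?b h] by simp
    finally show ?thesis using b h s by (simp add: T.C.assoc)
  qed
  show ?thesis
    unfolding Pair hat_alg_eq using s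
    by (intro algebraI) (auto simp: eta ext)
qed

text \<open>The underlying equation is \<open>n 1 \<cdot> S q = q \<cdot> k 1\<close>, which says that \<open>q\<close> commutes with structure maps.\<close>

lemma algebra_mor_hat:
  assumes "algebra M X" "algebra M Y" "algebra_mor M X Y q"
  shows "algebra_mor T (hat_alg M T P X) (hat_alg M T P Y) (onA (pfun P) q)"
proof (cases X, cases Y)
  fix K k N n
  assume X: "X = (K, k)" and Y: "Y = (N, n)"
  interpret K: monad_algebra small M K k
    using assms X by (auto intro: monad_algebraI M.extensive_monad_axioms)
  interpret N: monad_algebra small M N n
    using assms Y by (auto intro: monad_algebraI M.extensive_monad_axioms)
  let ?s = "n (Idn (mcat M) N)" and ?C = "mcat M" and ?D = "mcat T" and ?P = "onA (pfun P)"
  have q: "q \<in> Arr ?C" "Dom ?C q = K" "Cod ?C q = N"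
    using assms X Y by (auto simp: algebra_mor_iff)
  have nq: "?s \<cdot>\<^bsub>?C\<^esub> mext M N (meta M N \<cdot>\<^bsub>?C\<^esub> q) = q \<cdot>\<^bsub>?C\<^esub> k (Idn ?C K)"
  proof -
    have "\<forall>a\<in>Arr ?C. Cod ?C a = K \<longrightarrow> n (q \<cdot>\<^bsub>?C\<^esub> a) = q \<cdot>\<^bsub>?C\<^esub> k a"
      using assms(3) X Y by (simp add: algebra_mor_iff)
    from bspec[OF this, of "Idn ?C K"] have "n q = q \<cdot>\<^bsub>?C\<^esub> k (Idn ?C K)"
      using q by simp
    then show ?thesis using q N.struct_via_Idn[of q] by simp
  qed
  have "?P ?s \<cdot>\<^bsub>?D\<^esub> pext P N (?P (meta M N) \<cdot>\<^bsub>?D\<^esub> (?P q \<cdot>\<^bsub>?D\<^esub> a))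
      = ?P q \<cdot>\<^bsub>?D\<^esub> (?P (k (Idn ?C K)) \<cdot>\<^bsub>?D\<^esub> pext P K (?P (meta M K) \<cdot>\<^bsub>?D\<^esub> a))"
    if a: "a \<in> Arr ?D" "Cod ?D a = onO (pfun P) K" for a
  proof -
    have "?P ?s \<cdot>\<^bsub>?D\<^esub> pext P N (?P (meta M N) \<cdot>\<^bsub>?D\<^esub> (?P q \<cdot>\<^bsub>?D\<^esub> a))
      = ?P (?s \<cdot>\<^bsub>?C\<^esub> mext M N (meta M N \<cdot>\<^bsub>?C\<^esub> q)) \<cdot>\<^bsub>?D\<^esub> pext P K (?P (meta M K) \<cdot>\<^bsub>?D\<^esub> a)"
      using q a by (subst pext_eta_comp) (auto simp: P.preserves_Comp T.C.assoc)
    then show ?thesis unfolding nq using q a by (simp add: P.preserves_Comp T.C.assoc)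
  qed
  then show ?thesis
    unfolding X Y hat_alg_eq using q by (auto simp: algebra_mor_iff)
qed

text \<open>The lifting extends the structures with which \<open>P\<close> comes: on a free algebra, \<open>P(n 1) = P \<mu>\<close>
  can be moved inside the extension, where it cancels \<open>P \<eta>\<close>.\<close>

lemma hat_free:
  assumes "A \<in> Obj (mcat M)"
  shows "hat_alg M T P (free_alg M A) = pext_alg M P A"
proof -
  let ?i = "Idn (mcat M) (mS M A)" and ?D = "mcat T" and ?P = "onA (pfun P)"
  have "?P (mext M A ?i) \<cdot>\<^bsub>?D\<^esub> pext P (mS M A) (?P (meta M (mS M A)) \<cdot>\<^bsub>?D\<^esub> q) = pext P A q"
    if q: "q \<in> Arr ?D" "Cod ?D q = onO (pfun P) (mS M A)" for q
  proof -
    have "?P (mext M A ?i) \<cdot>\<^bsub>?D\<^esub> pext P (mS M A) (?P (meta M (mS M A)) \<cdot>\<^bsub>?D\<^esub> q)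
        = pext P A (?P (mext M A ?i) \<cdot>\<^bsub>?D\<^esub> (?P (meta M (mS M A)) \<cdot>\<^bsub>?D\<^esub> q))"
      using q assms pext_mext[of A ?i "?P (meta M (mS M A)) \<cdot>\<^bsub>?D\<^esub> q"] by simp
    also have "?P (mext M A ?i) \<cdot>\<^bsub>?D\<^esub> (?P (meta M (mS M A)) \<cdot>\<^bsub>?D\<^esub> q) = q"
      using q assms M.ext_simps(4)[of A ?i]
      by (simp add: T.C.assoc[symmetric] P.preserves_Comp[symmetric])
    finally show ?thesis .
  qed
  then show ?thesis
    using monad_algebra.ext_struct[OF monad_algebra_pext[OF assms]]
    unfolding free_alg_def hat_alg_eq pext_alg_def
    by (auto intro!: extensionalityI[of _ "arrows_into ?D (onO (pfun P) (mS M A))"])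
qed

end

lemma hat_alg_cases:
  assumes "emnd_cell1 small M T P" "algebra M X"
  obtains N n n' where "X = (N, n)" "hat_alg M T P X = (onO (pfun P) N, n')"
    "monad_algebra small M N n" "monad_algebra small T (onO (pfun P) N) n'"
    "\<And>q. \<lbrakk>q \<in> Arr (mcat T); Cod (mcat T) q = onO (pfun P) N\<rbrakk> \<Longrightarrow> n' q =
      onA (pfun P) (n (Idn (mcat M) N)) \<cdot>\<^bsub>mcat T\<^esub> pext P N (onA (pfun P) (meta M N) \<cdot>\<^bsub>mcat T\<^esub> q)"
proof (cases X)
  case (Pair N n)
  interpret emnd_cell1 small M T P by fact
  show ?thesis
    using that[OF Pair, of "snd (hat_alg M T P X)"] assms(2) algebra_hat[OF assms(2)]
    by (auto simp: Pair hat_alg_eq intro!: monad_algebraI M.extensive_monad_axioms T.extensive_monad_axioms)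
qed

lemma emnd_Comp1_simps [simp]:
  "pfun (emnd_Comp1 M T U W P) = comp_func (mcat M) (pfun W) (pfun P)"
  by (simp add: emnd_Comp1_def)

lemma emnd_Id1_simps [simp]: "pfun (emnd_Id1 M) = id_func (mcat M)" "pext (emnd_Id1 M) = mext M"
  by (simp_all add: emnd_Id1_def)

text \<open>The structure in a composite of 1-cells is the lifting along the second of the structure of the
  first. This reduces the laws of composition to functoriality of the lifting.\<close>

lemma pext_alg_Comp1:
  assumes "emnd_cell1 small M T P" "emnd_cell1 small T U W" "A \<in> Obj (mcat M)"
  shows "pext_alg M (emnd_Comp1 M T U W P) A = hat_alg T U W (pext_alg M P A)"
proof -
  interpret P: emnd_cell1 small M T P by fact
  show ?thesis using assms by (simp add: pext_alg_def hat_alg_def emnd_Comp1_def Let_def)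
qed

lemma pext_alg_Id1:
  assumes "extensive_monad small M" "A \<in> Obj (mcat M)"
  shows "pext_alg M (emnd_Id1 M) A = free_alg M A"
proof -
  interpret extensive_monad small M by fact
  show ?thesis using assms by (simp add: pext_alg_def free_alg_def)
qed

lemma emnd_cell1I:
  assumes "extensive_monad small M" "extensive_monad small T" "is_functor (mcat M) (mcat T) (pfun P)"
    and "pext P \<in> extensional (Obj (mcat M))"
    and "\<And>A. A \<in> Obj (mcat M) \<Longrightarrow> algebra T (pext_alg M P A)"
    and "\<And>B h. \<lbrakk>B \<in> Obj (mcat M); h \<in> Arr (mcat M); Cod (mcat M) h = mS M B\<rbrakk>
    \<Longrightarrow> algebra_mor T (pext_alg M P (Dom (mcat M) h)) (pext_alg M P B) (onA (pfun P) (mext M B h))"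
  shows "emnd_cell1 small M T P"
  using assms by (auto simp: emnd_cell1_def emnd_cell1_axioms_def emnd_1cell_def hom_iff)

lemma algebra_mor_mext:
  assumes "extensive_monad small M" "B \<in> Obj (mcat M)" "h \<in> Arr (mcat M)" "Cod (mcat M) h = mS M B"
  shows "algebra_mor M (free_alg M (Dom (mcat M) h)) (free_alg M B) (mext M B h)"
proof -
  interpret extensive_monad small M by fact
  show ?thesis
    using assms ext_comp_ext[of "Dom (mcat M) h" B _ _ h]
    by (auto simp: free_alg_def algebra_mor_iff hom_iff)
qed

lemma emnd_cell1_Id1:
  assumes "extensive_monad small M"
  shows "emnd_cell1 small M M (emnd_Id1 M)"
proof -
  interpret extensive_monad small M by fact
  show ?thesis
    by (rule emnd_cell1I)
      (auto simp: pext_alg_Id1[OF assms] intro: assms is_functor_id_func C.category_axioms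
        algebra_free algebra_mor_mext)
qed

lemma emnd_cell1_Comp1:
  assumes "emnd_cell1 small M T P" "emnd_cell1 small T U W"
  shows "emnd_cell1 small M U (emnd_Comp1 M T U W P)"
proof -
  interpret P: emnd_cell1 small M T P by fact
  interpret W: emnd_cell1 small T U W by fact
  have "algebra_mor U (hat_alg T U W (pext_alg M P (Dom (mcat M) h))) (hat_alg T U W (pext_alg M P B))
      (onA (pfun W) (onA (pfun P) (mext M B h)))"
    if "B \<in> Obj (mcat M)" "h \<in> Arr (mcat M)" "Cod (mcat M) h = mS M B" for B h
    using that by (intro W.algebra_mor_hat P.algebra_pext P.algebra_mor_pext) auto
  then show ?thesis
    by (intro emnd_cell1I)
      (auto simp: pext_alg_Comp1[OF assms] intro: P.M.extensive_monad_axioms W.T.extensive_monad_axioms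
        is_functor_comp_func P.P.is_functor_axioms W.P.is_functor_axioms W.algebra_hat P.algebra_pext,
       auto simp: emnd_Comp1_def)
qed

lemma hat_alg_Id1:
  assumes "extensive_monad small M" "algebra M X"
  shows "hat_alg M M (emnd_Id1 M) X = X"
proof (rule hat_alg_cases[OF emnd_cell1_Id1[OF assms(1)] assms(2)])
  fix N n n'
  assume X: "X = (N, n)" and hat: "hat_alg M M (emnd_Id1 M) X = (onO (pfun (emnd_Id1 M)) N, n')"
    and "monad_algebra small M N n" "monad_algebra small M (onO (pfun (emnd_Id1 M)) N) n'"
    and n': "\<And>q. \<lbrakk>q \<in> Arr (mcat M); Cod (mcat M) q = onO (pfun (emnd_Id1 M)) N\<rbrakk> \<Longrightarrow> n' q =
      onA (pfun (emnd_Id1 M)) (n (Idn (mcat M) N)) \<cdot>\<^bsub>mcat M\<^esub>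
      pext (emnd_Id1 M) N (onA (pfun (emnd_Id1 M)) (meta M N) \<cdot>\<^bsub>mcat M\<^esub> q)"
  then interpret N: monad_algebra small M N n by simp
  interpret N': monad_algebra small M "onO (pfun (emnd_Id1 M)) N" n' by fact
  have "n' = n"
    using N.ext_struct N'.ext_struct
    by (intro extensionalityI[of _ "arrows_into (mcat M) N"]) (auto simp: n' N.struct_via_Idn)
  then show ?thesis using hat by (simp add: X)
qed

text \<open>Unfolding the left-hand side produces \<open>W \<eta> \<cdot> W P \<eta>\<close> inside the extension of \<open>W\<close>. Moving
  \<open>W P \<eta>\<close> out of it leaves \<open>x \<cdot> T(P \<eta>)\<close>, where \<open>x\<close> is the structure map of \<open>P S N\<close>, and this is the
  extension of \<open>P \<eta>\<close>.\<close>

lemma hat_alg_Comp1: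
  assumes P: "emnd_cell1 small M T P" and W: "emnd_cell1 small T U W" and "algebra M X"
  shows "hat_alg M U (emnd_Comp1 M T U W P) X = hat_alg T U W (hat_alg M T P X)"
proof -
  interpret P: emnd_cell1 small M T P by fact
  interpret W: emnd_cell1 small T U W by fact
  interpret WP: emnd_cell1 small M U "emnd_Comp1 M T U W P"
    using P W by (rule emnd_cell1_Comp1)
  obtain N n n' where X: "X = (N, n)" and hat: "hat_alg M T P X = (onO (pfun P) N, n')"
    and N: "monad_algebra small M N n" and N': "monad_algebra small T (onO (pfun P) N) n'"
    and n': "\<And>q. \<lbrakk>q \<in> Arr (mcat T); Cod (mcat T) q = onO (pfun P) N\<rbrakk> \<Longrightarrow> n' q =
      onA (pfun P) (n (Idn (mcat M) N)) \<cdot>\<^bsub>mcat T\<^esub> pext P N (onA (pfun P) (meta M N) \<cdot>\<^bsub>mcat T\<^esub> q)"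
    using hat_alg_cases[OF P \<open>algebra M X\<close>] by metis
  interpret N: monad_algebra small M N n by fact
  interpret N': monad_algebra small T "onO (pfun P) N" n' by fact
  let ?P = "onA (pfun P)" and ?W = "onA (pfun W)" and ?D = "mcat T" and ?E = "mcat U"
  let ?s = "n (Idn (mcat M) N)" and ?PN = "onO (pfun P) N" and ?PSN = "onO (pfun P) (mS M N)"
  let ?x = "pext P N (Idn ?D ?PSN)" and ?y = "\<lambda>q. pext W ?PN (?W (meta T ?PN) \<cdot>\<^bsub>?E\<^esub> q)"
  have s: "?s \<in> Arr (mcat M)" "Dom (mcat M) ?s = mS M N" "Cod (mcat M) ?s = N" by auto
  have "?W (?P ?s) \<cdot>\<^bsub>?E\<^esub> (?W ?x \<cdot>\<^bsub>?E\<^esub> pext W ?PSN (?W (meta T ?PSN) \<cdot>\<^bsub>?E\<^esub> (?W (?P (meta M N)) \<cdot>\<^bsub>?E\<^esub> q)))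
      = ?W (n' (Idn ?D ?PN)) \<cdot>\<^bsub>?E\<^esub> ?y q"
    if q: "q \<in> Arr ?E" "Cod ?E q = onO (pfun W) ?PN" for q
  proof -
    have "?W ?x \<cdot>\<^bsub>?E\<^esub> pext W ?PSN (?W (meta T ?PSN) \<cdot>\<^bsub>?E\<^esub> (?W (?P (meta M N)) \<cdot>\<^bsub>?E\<^esub> q))
       = ?W (?x \<cdot>\<^bsub>?D\<^esub> mext T ?PSN (meta T ?PSN \<cdot>\<^bsub>?D\<^esub> ?P (meta M N))) \<cdot>\<^bsub>?E\<^esub> ?y q"
      using q by (subst W.pext_eta_comp) (auto simp: W.P.preserves_Comp W.T.C.assoc)
    also have "?x \<cdot>\<^bsub>?D\<^esub> mext T ?PSN (meta T ?PSN \<cdot>\<^bsub>?D\<^esub> ?P (meta M N)) = pext P N (?P (meta M N))"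
      by (rule monad_algebra.struct_via_Idn[OF P.monad_algebra_pext]) auto
    finally show ?thesis
      using q s by (simp add: n' W.P.preserves_Comp W.T.C.assoc)
  qed
  then show ?thesis
    unfolding hat unfolding X WP.hat_alg_eq W.hat_alg_eq
    by (auto simp: emnd_Comp1_def Let_def fun_eq_iff W.P.preserves_Comp W.T.C.assoc)
qed

locale emnd_cell2 =
  P: emnd_cell1 small M T P + Q: emnd_cell1 small M T Q
  for small :: "'u set \<Rightarrow> bool" and M T :: "'u emnd" and P Q :: "'u emnd1" +
  fixes \<theta> :: "'u \<Rightarrow> 'u"
  assumes cell2: "emnd_2cell M T (P, Q, \<theta>)"

sublocale emnd_cell2 \<subseteq> \<theta>: is_nat_trans "mcat M" "mcat T" "pfun P" "pfun Q" \<theta>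
  using cell2 by (simp add: emnd_2cell_def)

context emnd_cell2
begin

lemma algebra_mor_free:
  "A \<in> Obj (mcat M) \<Longrightarrow> algebra_mor T (pext_alg M P A) (pext_alg M Q A) (\<theta> (mS M A))"
  using cell2 by (simp add: emnd_2cell_def)

lemma pext_theta:
  "\<lbrakk>A \<in> Obj (mcat M); q \<in> Arr (mcat T); Cod (mcat T) q = onO (pfun P) (mS M A)\<rbrakk>
    \<Longrightarrow> pext Q A (\<theta> (mS M A) \<cdot>\<^bsub>mcat T\<^esub> q) = \<theta> (mS M A) \<cdot>\<^bsub>mcat T\<^esub> pext P A q"
  using algebra_mor_free[of A] by (simp add: pext_alg_def algebra_mor_iff)

text \<open>A 2-cell is compatible with free algebras by definition; since every algebra is a quotient of
  a free one by its structure map, it is compatible with all algebras.\<close>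

lemma algebra_mor_theta:
  assumes "algebra M X"
  shows "algebra_mor T (hat_alg M T P X) (hat_alg M T Q X) (\<theta> (fst X))"
proof (cases X)
  case (Pair N n)
  interpret N: monad_algebra small M N n
    using assms Pair by (auto intro: monad_algebraI P.M.extensive_monad_axioms)
  let ?P = "onA (pfun P)" and ?Q = "onA (pfun Q)" and ?D = "mcat T" and ?s = "n (Idn (mcat M) N)"
  have s: "?s \<in> Arr (mcat M)" "Dom (mcat M) ?s = mS M N" "Cod (mcat M) ?s = N" by auto
  have "?Q ?s \<cdot>\<^bsub>?D\<^esub> pext Q N (?Q (meta M N) \<cdot>\<^bsub>?D\<^esub> (\<theta> N \<cdot>\<^bsub>?D\<^esub> a))
      = \<theta> N \<cdot>\<^bsub>?D\<^esub> (?P ?s \<cdot>\<^bsub>?D\<^esub> pext P N (?P (meta M N) \<cdot>\<^bsub>?D\<^esub> a))"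
    if a: "a \<in> Arr ?D" "Cod ?D a = onO (pfun P) N" for a
  proof -
    have "?Q (meta M N) \<cdot>\<^bsub>?D\<^esub> \<theta> N = \<theta> (mS M N) \<cdot>\<^bsub>?D\<^esub> ?P (meta M N)"
      using \<theta>.naturality[of "meta M N"] by simp
    then have "?Q (meta M N) \<cdot>\<^bsub>?D\<^esub> (\<theta> N \<cdot>\<^bsub>?D\<^esub> a) = \<theta> (mS M N) \<cdot>\<^bsub>?D\<^esub> (?P (meta M N) \<cdot>\<^bsub>?D\<^esub> a)"
      using a by (simp add: P.T.C.assoc[symmetric])
    then have "?Q ?s \<cdot>\<^bsub>?D\<^esub> pext Q N (?Q (meta M N) \<cdot>\<^bsub>?D\<^esub> (\<theta> N \<cdot>\<^bsub>?D\<^esub> a))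
        = (?Q ?s \<cdot>\<^bsub>?D\<^esub> \<theta> (mS M N)) \<cdot>\<^bsub>?D\<^esub> pext P N (?P (meta M N) \<cdot>\<^bsub>?D\<^esub> a)"
      using a s by (simp add: pext_theta P.T.C.assoc)
    also have "?Q ?s \<cdot>\<^bsub>?D\<^esub> \<theta> (mS M N) = \<theta> N \<cdot>\<^bsub>?D\<^esub> ?P ?s"
      using \<theta>.naturality[of ?s] s by simp
    finally show ?thesis using a s by (simp add: P.T.C.assoc)
  qed
  then show ?thesis
    unfolding Pair P.hat_alg_eq Q.hat_alg_eq by (auto simp: algebra_mor_iff)
qed

end

section \<open>The 2-category of extensive monads\<close>

lemma emnd_cell2I:
  assumes "emnd_cell1 small M T P" "emnd_cell1 small M T Q"
    "is_nat_trans (mcat M) (mcat T) (pfun P) (pfun Q) \<theta>"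
    "\<And>A. A \<in> Obj (mcat M) \<Longrightarrow> algebra_mor T (pext_alg M P A) (pext_alg M Q A) (\<theta> (mS M A))"
  shows "emnd_cell2 small M T P Q \<theta>"
  using assms by (simp add: emnd_cell2_def emnd_cell2_axioms_def emnd_2cell_def)

lemma (in emnd_cell1) emnd1_eqI:
  assumes "emnd_cell1 small M T Q" "pfun P = pfun Q"
    and "\<And>A. A \<in> Obj (mcat M) \<Longrightarrow> pext_alg M P A = pext_alg M Q A"
  shows "P = Q"
proof -
  interpret Q: emnd_cell1 small M T Q by fact
  have "pext P = pext Q"
    using pext_ext Q.pext_ext assms(3) by (auto intro: extensionalityI simp: pext_alg_def)
  then show ?thesis using assms(2) by simp
qed

lemma emnd_cell1E:
  assumes "emnd_cell1 small M T P"
  shows "is_functor (mcat M) (mcat T) (pfun P)" "extensive_monad small M" "extensive_monad small T"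
proof -
  interpret emnd_cell1 small M T P by fact
  show "is_functor (mcat M) (mcat T) (pfun P)" "extensive_monad small M" "extensive_monad small T"
    by (fact P.is_functor_axioms M.extensive_monad_axioms T.extensive_monad_axioms)+
qed

lemma emnd_cell2E:
  assumes "emnd_cell2 small M T P Q \<theta>"
  shows "emnd_cell1 small M T P" "emnd_cell1 small M T Q"
    "is_nat_trans (mcat M) (mcat T) (pfun P) (pfun Q) \<theta>"
  using assms by (auto simp: emnd_cell2_def emnd_cell2_axioms_def emnd_2cell_def)

lemma emnd_Comp1_assoc:
  assumes P: "emnd_cell1 small M T P" and W: "emnd_cell1 small T U W" and Y: "emnd_cell1 small U V Y"
  shows "emnd_Comp1 M U V Y (emnd_Comp1 M T U W P) = emnd_Comp1 M T V (emnd_Comp1 T U V Y W) P"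
proof (rule emnd_cell1.emnd1_eqI)
  show YWP: "emnd_cell1 small M V (emnd_Comp1 M U V Y (emnd_Comp1 M T U W P))"
    "emnd_cell1 small M V (emnd_Comp1 M T V (emnd_Comp1 T U V Y W) P)"
    by (intro emnd_cell1_Comp1 P W Y)+
  show "pfun (emnd_Comp1 M U V Y (emnd_Comp1 M T U W P))
      = pfun (emnd_Comp1 M T V (emnd_Comp1 T U V Y W) P)"
    using emnd_cell1E(1)[OF P] emnd_cell1E(1)[OF W] emnd_cell1E(1)[OF Y]
    by (simp add: comp_func_assoc)
  fix A
  assume "A \<in> Obj (mcat M)"
  then show "pext_alg M (emnd_Comp1 M U V Y (emnd_Comp1 M T U W P)) A
      = pext_alg M (emnd_Comp1 M T V (emnd_Comp1 T U V Y W) P) A"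
    by (simp add: pext_alg_Comp1[OF emnd_cell1_Comp1[OF P W] Y] pext_alg_Comp1[OF P W]
        pext_alg_Comp1[OF P emnd_cell1_Comp1[OF W Y]] hat_alg_Comp1[OF W Y]
        emnd_cell1.algebra_pext[OF P])
qed

lemma emnd_Comp1_Id1_right:
  assumes "emnd_cell1 small M T P"
  shows "emnd_Comp1 M M T P (emnd_Id1 M) = P"
proof (rule emnd_cell1.emnd1_eqI)
  note P = emnd_cell1E[OF assms]
  show "emnd_cell1 small M T (emnd_Comp1 M M T P (emnd_Id1 M))"
    by (rule emnd_cell1_Comp1[OF emnd_cell1_Id1[OF P(2)] assms])
  show "emnd_cell1 small M T P" by fact
  show "pfun (emnd_Comp1 M M T P (emnd_Id1 M)) = pfun P"
    by (simp add: comp_func_id_right[OF P(1)])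
  fix A
  assume "A \<in> Obj (mcat M)"
  then show "pext_alg M (emnd_Comp1 M M T P (emnd_Id1 M)) A = pext_alg M P A"
    by (simp add: pext_alg_Comp1[OF emnd_cell1_Id1[OF P(2)] assms] pext_alg_Id1[OF P(2)]
        emnd_cell1.hat_free[OF assms])
qed

lemma emnd_Comp1_Id1_left:
  assumes "emnd_cell1 small M T P"
  shows "emnd_Comp1 M T T (emnd_Id1 T) P = P"
proof (rule emnd_cell1.emnd1_eqI)
  note P = emnd_cell1E[OF assms]
  show "emnd_cell1 small M T (emnd_Comp1 M T T (emnd_Id1 T) P)"
    by (rule emnd_cell1_Comp1[OF assms emnd_cell1_Id1[OF P(3)]])
  show "emnd_cell1 small M T P" by fact
  show "pfun (emnd_Comp1 M T T (emnd_Id1 T) P) = pfun P"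
    by (simp add: comp_func_id_left[OF P(1)])
  fix A
  assume "A \<in> Obj (mcat M)"
  then show "pext_alg M (emnd_Comp1 M T T (emnd_Id1 T) P) A = pext_alg M P A"
    by (simp add: pext_alg_Comp1[OF assms emnd_cell1_Id1[OF P(3)]] hat_alg_Id1[OF P(3)]
        emnd_cell1.algebra_pext[OF assms])
qed

lemma emnd_cell2_id:
  assumes "emnd_cell1 small M T P"
  shows "emnd_cell2 small M T P P (id_nat (mcat M) (mcat T) (pfun P))"
proof -
  interpret emnd_cell1 small M T P by fact
  show ?thesis
    using algebra_pext T.algebra_mor_Idn
    by (intro emnd_cell2I) (auto intro: assms is_nat_trans_id_nat P.is_functor_axioms simp: pext_alg_def)
qed

lemma emnd_cell2_vcomp:
  assumes "emnd_cell2 small M T P Q \<theta>" "emnd_cell2 small M T Q R \<theta>'"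
  shows "emnd_cell2 small M T P R (vcomp (mcat M) (mcat T) \<theta>' \<theta>)"
proof -
  interpret s: emnd_cell2 small M T P Q \<theta> by fact
  interpret t: emnd_cell2 small M T Q R \<theta>' by fact
  have "algebra_mor T (pext_alg M P A) (pext_alg M R A) (\<theta>' (mS M A) \<cdot>\<^bsub>mcat T\<^esub> \<theta> (mS M A))"
    if "A \<in> Obj (mcat M)" for A
    using s.algebra_mor_free[OF that] t.algebra_mor_free[OF that] s.P.algebra_pext[OF that]
    unfolding pext_alg_def by (rule s.P.T.algebra_mor_Comp)
  then show ?thesis
    by (intro emnd_cell2I) (auto intro: is_nat_trans_vcomp emnd_cell2E[OF assms(1)] emnd_cell2E[OF assms(2)])
qed

text \<open>Both factors of the composite transformation at \<open>S A\<close> are morphisms of algebras: the first is the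
  lifting along \<open>W\<close> of a morphism, the second is a component of \<open>\<theta>'\<close> at a lifted algebra, which need
  not be free.\<close>

lemma emnd_cell2_hcomp:
  assumes "emnd_cell2 small M T P P' \<theta>" "emnd_cell2 small T U W W' \<theta>'"
  shows "emnd_cell2 small M U (emnd_Comp1 M T U W P) (emnd_Comp1 M T U W' P')
    (hcomp (mcat M) (mcat U) (pfun W) \<theta>' (pfun P') \<theta>)"
proof -
  interpret s: emnd_cell2 small M T P P' \<theta> by fact
  interpret t: emnd_cell2 small T U W W' \<theta>' by fact
  note s = emnd_cell2E[OF assms(1)] and t = emnd_cell2E[OF assms(2)]
  have "algebra_mor U (hat_alg T U W (pext_alg M P A)) (hat_alg T U W' (pext_alg M P' A))
      (\<theta>' (onO (pfun P') (mS M A)) \<cdot>\<^bsub>mcat U\<^esub> onA (pfun W) (\<theta> (mS M A)))"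
    if A: "A \<in> Obj (mcat M)" for A
  proof -
    note P = s.P.algebra_pext[OF A] and P' = s.Q.algebra_pext[OF A]
    show ?thesis
      using t.P.algebra_mor_hat[OF P P' s.algebra_mor_free[OF A]] t.algebra_mor_theta[OF P']
        t.P.algebra_hat[OF P]
      by (cases "hat_alg T U W (pext_alg M P A)"; cases "hat_alg T U W (pext_alg M P' A)";
          cases "hat_alg T U W' (pext_alg M P' A)")
        (simp add: pext_alg_def t.P.T.algebra_mor_Comp)
  qed
  then show ?thesis
    using s t by (intro emnd_cell2I)
      (auto intro: is_nat_trans_hcomp emnd_cell1_Comp1 simp: pext_alg_Comp1)
qed

lemma EMnd_simps [simp]:
  "M \<in> Ob (EMnd small) \<longleftrightarrow> extensive_monad small M"
  "Hom (EMnd small) = emnd_Hom"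
  "Id1 (EMnd small) = emnd_Id1"
  "Comp1 (EMnd small) = emnd_Comp1"
  "Comp2 (EMnd small) = emnd_Comp2"
  by (simp_all add: EMnd_def)

lemma Obj_emnd_Hom:
  assumes "extensive_monad small M" "extensive_monad small T"
  shows "P \<in> Obj (emnd_Hom M T) \<longleftrightarrow> emnd_cell1 small M T P"
  using assms by (simp add: emnd_Hom_def emnd_cell1_def emnd_cell1_axioms_def)

lemma Arr_emnd_Hom:
  assumes "extensive_monad small M" "extensive_monad small T"
  shows "x \<in> Arr (emnd_Hom M T) \<longleftrightarrow> (\<exists>P Q \<theta>. x = (P, Q, \<theta>) \<and> emnd_cell2 small M T P Q \<theta>)"
  using assms
  by (cases x) (simp add: emnd_Hom_def emnd_cell2_def emnd_cell2_axioms_def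
      emnd_cell1_def emnd_cell1_axioms_def)

lemma hom_emnd_Hom:
  assumes "extensive_monad small M" "extensive_monad small T"
  shows "x \<in> hom (emnd_Hom M T) P Q \<longleftrightarrow> (\<exists>\<theta>. x = (P, Q, \<theta>) \<and> emnd_cell2 small M T P Q \<theta>)"
proof (cases x)
  case (fields P' Q' \<theta>)
  have "x \<in> Arr (emnd_Hom M T) \<Longrightarrow> Dom (emnd_Hom M T) x = P' \<and> Cod (emnd_Hom M T) x = Q'"
    using fields by (simp add: emnd_Hom_def)
  then show ?thesis
    using fields by (auto simp: hom_iff Arr_emnd_Hom[OF assms])
qed

lemma Comp_emnd_Hom [simp]:
  assumes "emnd_cell2 small M T P Q \<theta>" "emnd_cell2 small M T Q R \<theta>'"
  shows "(Q, R, \<theta>') \<cdot>\<^bsub>emnd_Hom M T\<^esub> (P, Q, \<theta>) = (P, R, vcomp (mcat M) (mcat T) \<theta>' \<theta>)"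
  using assms
  by (simp add: emnd_Hom_def emnd_cell2_def emnd_cell2_axioms_def
      emnd_cell1_def emnd_cell1_axioms_def)

lemma Id2_EMnd [simp]:
  assumes "emnd_cell1 small M T P"
  shows "Id2 (EMnd small) M T P = (P, P, id_nat (mcat M) (mcat T) (pfun P))"
  using assms by (simp add: Id2_def emnd_Hom_def emnd_cell1_def emnd_cell1_axioms_def)

lemma emnd_Comp2_simp [simp]:
  "emnd_Comp2 M T U (W, W', \<theta>') (P, P', \<theta>) = (emnd_Comp1 M T U W P, emnd_Comp1 M T U W' P',
    hcomp (mcat M) (mcat U) (pfun W) \<theta>' (pfun P') \<theta>)"
  by (simp add: emnd_Comp2_def)

lemma category_emnd_Hom:
  assumes "extensive_monad small M" "extensive_monad small T"
  shows "category (emnd_Hom M T)"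
proof -
  have one: "emnd_1cell M T P \<longleftrightarrow> emnd_cell1 small M T P" for P
    using assms by (simp add: emnd_cell1_def emnd_cell1_axioms_def)
  have two: "emnd_1cell M T P \<and> emnd_1cell M T Q \<and> emnd_2cell M T (P, Q, \<theta>)
      \<longleftrightarrow> emnd_cell2 small M T P Q \<theta>" for P Q \<theta>
    using assms by (simp add: emnd_cell2_def emnd_cell2_axioms_def
        emnd_cell1_def emnd_cell1_axioms_def)
  show ?thesis
    unfolding emnd_Hom_def two unfolding one
  proof (rule category_mk_cat, goal_cases)
    case (1 x)
    then show ?case by (auto dest: emnd_cell2E)
  next
    case (2 P)
    then show ?case by (auto simp: emnd_cell2_id)
  next
    case (3 x y)
    then show ?case by (auto intro: emnd_cell2_vcomp)
  next
    case (4 x)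
    then show ?case by (auto intro!: vcomp_id_right dest: emnd_cell2E)
  next
    case (5 x)
    then show ?case by (auto intro!: vcomp_id_left dest: emnd_cell2E)
  next
    case (6 x y z)
    then show ?case by (auto intro!: vcomp_assoc dest: emnd_cell2E)
  qed
qed

proposition two_category_EMnd: "two_category (EMnd small)"
proof (rule two_category.intro, unfold EMnd_simps, goal_cases)
  case (1 A B)
  then show ?case by (rule category_emnd_Hom)
next
  case (2 A)
  then show ?case by (simp add: Obj_emnd_Hom[of small] emnd_cell1_Id1)
next
  case (3 A B C f g)
  then show ?case by (simp add: Obj_emnd_Hom[of small] emnd_cell1_Comp1)
next
  case (4 A B C \<alpha> f f' \<beta> g g')
  then show ?case by (auto simp: hom_emnd_Hom[of small] emnd_cell2_hcomp)
next
  case (5 A B C f g)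
  then show ?case
    by (simp add: Obj_emnd_Hom[of small] hcomp_id_nat emnd_cell1E emnd_cell1_Comp1)
next
  case (6 A B C \<alpha> f f' \<alpha>' f'' \<beta> g g' \<beta>' g'')
  then show ?case
    by (auto simp: hom_emnd_Hom[of small] Comp_emnd_Hom[of small] emnd_cell2_hcomp
        intro!: hcomp_vcomp dest: emnd_cell2E)
next
  case (7 A B C D f g h)
  then show ?case by (simp add: Obj_emnd_Hom[of small] emnd_Comp1_assoc)
next
  case (8 A B C D \<alpha> \<beta> \<gamma>)
  then show ?case
    by (auto simp: Arr_emnd_Hom[of small] intro!: hcomp_assoc emnd_Comp1_assoc dest: emnd_cell2E)
next
  case (9 A B f)
  then show ?case by (simp add: Obj_emnd_Hom[of small] emnd_Comp1_Id1_right)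
next
  case (10 A B f)
  then show ?case by (simp add: Obj_emnd_Hom[of small] emnd_Comp1_Id1_left)
next
  case (11 A B \<alpha>)
  then show ?case
    by (auto simp: Arr_emnd_Hom[of small] Id2_EMnd[OF emnd_cell1_Id1]
        intro!: hcomp_id_right emnd_Comp1_Id1_right dest: emnd_cell2E)
next
  case (12 A B \<alpha>)
  then show ?case
    by (auto simp: Arr_emnd_Hom[of small] Id2_EMnd[OF emnd_cell1_Id1]
        intro!: hcomp_id_left emnd_Comp1_Id1_left dest: emnd_cell2E)
qed

section \<open>From universal arrows to monads\<close>

context universal_arrow
begin

text \<open>Naturality of the bijection \<open>Hom(A, R X) \<rightarrow> Hom(L A, X)\<close> in \<open>X\<close>; the associativity laws of
  monads and algebras arising from a universal arrow are instances of it.\<close>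

lemma zeta_natural:
  assumes "w \<in> Arr (utop U)" "v \<in> Arr (ubase U)" "Cod (ubase U) v = onO (uR U) (Dom (utop U) w)"
  shows "uzeta U (Cod (utop U) w) (onA (uR U) w \<cdot>\<^bsub>ubase U\<^esub> v) = w \<cdot>\<^bsub>utop U\<^esub> uzeta U (Dom (utop U) w) v"
  using assms
  by (intro zeta_eqI[where A = "Dom (ubase U) v"]) (auto simp: R.preserves_Comp C.assoc)

end

lemma Phi0_simps [simp]:
  "mcat (Phi0 U) = ubase U"
  "meta (Phi0 U) = ueta U"
  "A \<in> Obj (ubase U) \<Longrightarrow> mS (Phi0 U) A = onO (uR U) (uL U A)"
  "\<lbrakk>B \<in> Obj (ubase U); h \<in> Arr (ubase U); Cod (ubase U) h = onO (uR U) (uL U B)\<rbrakk>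
    \<Longrightarrow> mext (Phi0 U) B h = onA (uR U) (uzeta U (uL U B) h)"
  by (simp_all add: Phi0_def compose_def)

text \<open>The object part of the comparison functor \<open>\<X> \<rightarrow> \<C>\<^sup>R\<^sup>L\<close>.\<close>

definition comparison_alg :: "'u uarr \<Rightarrow> 'u \<Rightarrow> 'u alg" where
  "comparison_alg U X = (onO (uR U) X,
    \<lambda>v\<in>arrows_into (ubase U) (onO (uR U) X). onA (uR U) (uzeta U X v))"

context universal_arrow
begin

lemma extensive_monad_Phi0: "extensive_monad small (Phi0 U)"
proof (unfold_locales, goal_cases)
  case 1
  then show ?case using base by simp
next
  case 2
  then show ?case by (auto simp: Phi0_def compose_def)
next
  case 3
  then show ?case by (simp add: eta_ext)
next
  case (4 A)
  then show ?case by (simp add: hom_iff)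
next
  case 5
  then show ?case by (auto simp: Phi0_def compose_def)
next
  case (6 B h A)
  then show ?case by (auto simp: hom_iff)
next
  case (7 A)
  have "uzeta U (uL U A) (ueta U A) = Idn (utop U) (uL U A)"
    using 7 by (intro zeta_eqI[where A = A]) auto
  then show ?case using 7 by simp
next
  case (8 B h A)
  then show ?case by (auto simp: hom_iff)
next
  case (9 B D h A k)
  then show ?case
    using zeta_natural[of "uzeta U (uL U D) k" h] by (auto simp: hom_iff R.preserves_Comp)
qed

lemma algebra_comparison:
  assumes "X \<in> Obj (utop U)"
  shows "algebra (Phi0 U) (comparison_alg U X)"
  unfolding comparison_alg_def
proof (rule algebraI, goal_cases)
  case (4 b h)
  then show ?case
    using assms zeta_natural[of "uzeta U X b" h] by (simp add: R.preserves_Comp)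
qed (use assms in auto)

lemma algebra_mor_comparison:
  assumes "m \<in> Arr (utop U)"
  shows "algebra_mor (Phi0 U) (comparison_alg U (Dom (utop U) m)) (comparison_alg U (Cod (utop U) m))
    (onA (uR U) m)"
  using assms by (auto simp: algebra_mor_iff comparison_alg_def zeta_natural R.preserves_Comp)

lemma comparison_L:
  assumes "A \<in> Obj (ubase U)"
  shows "comparison_alg U (uL U A) = free_alg (Phi0 U) A"
  using assms by (simp add: comparison_alg_def free_alg_def Phi0_def compose_def)

end

lemma Phi1_simps [simp]: "pfun (Phi1 A B f) = ubase1 f"
  by (simp add: Phi1_def)

context strict_1cell
begin

text \<open>As \<open>\<rho>\<close> is an identity, the structure that \<open>\<Phi>\<close> puts on \<open>J R L A = R\<^sup>\<dagger> V L A\<close> is that of the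
  comparison algebra of \<open>V L A\<close>.\<close>

lemma pext_alg_Phi1:
  assumes "X \<in> Obj (ubase A)"
  shows "pext_alg (Phi0 A) (Phi1 A B f) X = comparison_alg B (onO (utop1 f) (uL A X))"
  using assms by (auto simp: pext_alg_def comparison_alg_def Phi1_def)

lemma emnd_cell1_Phi1: "emnd_cell1 small (Phi0 A) (Phi0 B) (Phi1 A B f)"
proof -
  have "algebra_mor (Phi0 B) (comparison_alg B (onO (utop1 f) (uL A (Dom (ubase A) h))))
      (comparison_alg B (onO (utop1 f) (uL A X))) (onA (ubase1 f) (onA (uR A) (uzeta A (uL A X) h)))"
    if "X \<in> Obj (ubase A)" "h \<in> Arr (ubase A)" "Cod (ubase A) h = onO (uR A) (uL A X)" for X h
    using B.algebra_mor_comparison[of "onA (utop1 f) (uzeta A (uL A X) h)"] that by simp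
  then show ?thesis
    by (intro emnd_cell1I)
      (auto intro: A.extensive_monad_Phi0 B.extensive_monad_Phi0 J.is_functor_axioms
        B.algebra_comparison simp: pext_alg_Phi1, auto simp: Phi1_def)
qed

text \<open>The comparison functors commute with \<open>V\<close> and the lifting of \<open>J\<close>. Both structures on
  \<open>J R X = R\<^sup>\<dagger> V X\<close> arise from arrows \<open>w : L\<^sup>\<dagger> D \<rightarrow> V X\<close> with \<open>R\<^sup>\<dagger> w \<cdot> \<eta>\<^sup>\<dagger> = q\<close>, of which there is only one.\<close>

lemma hat_comparison:
  assumes X: "X \<in> Obj (utop A)"
  shows "hat_alg (Phi0 A) (Phi0 B) (Phi1 A B f) (comparison_alg A X)
    = comparison_alg B (onO (utop1 f) X)"
proof -
  let ?C = "ubase A" and ?D = "ubase B" and ?J = "onA (ubase1 f)" and ?V = "onA (utop1 f)"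
  let ?RX = "onO (uR A) X"
  let ?e = "uzeta A X (Idn ?C ?RX)" and ?LRX = "uL A ?RX"
  interpret P: emnd_cell1 small "Phi0 A" "Phi0 B" "Phi1 A B f"
    by (rule emnd_cell1_Phi1)
  have e: "?e \<in> Arr (utop A)" "Dom (utop A) ?e = ?LRX" "Cod (utop A) ?e = X"
    using X by auto
  have "?J (onA (uR A) ?e) \<cdot>\<^bsub>?D\<^esub> pext (Phi1 A B f) ?RX (?J (ueta A ?RX) \<cdot>\<^bsub>?D\<^esub> q)
      = onA (uR B) (uzeta B (onO (utop1 f) X) q)"
    if q: "q \<in> Arr ?D" "Cod ?D q = onO (ubase1 f) ?RX" for q
  proof -
    let ?z = "uzeta B (onO (utop1 f) ?LRX) (?J (ueta A ?RX) \<cdot>\<^bsub>?D\<^esub> q)"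
    have v: "?J (ueta A ?RX) \<cdot>\<^bsub>?D\<^esub> q \<in> Arr ?D"
      "Cod ?D (?J (ueta A ?RX) \<cdot>\<^bsub>?D\<^esub> q) = onO (ubase1 f) (onO (uR A) ?LRX)"
      "Dom ?D (?J (ueta A ?RX) \<cdot>\<^bsub>?D\<^esub> q) = Dom ?D q"
      using q X by auto
    have "pext (Phi1 A B f) ?RX (?J (ueta A ?RX) \<cdot>\<^bsub>?D\<^esub> q) = onA (uR B) ?z"
      using arg_cong[OF pext_alg_Phi1[of ?RX], of snd] v X
      by (simp add: pext_alg_def comparison_alg_def)
    moreover have "?V ?e \<cdot>\<^bsub>utop B\<^esub> ?z = uzeta B (onO (utop1 f) X) q"
    proof -
      have "?V ?e \<cdot>\<^bsub>utop B\<^esub> ?z = uzeta B (onO (utop1 f) X)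
          (onA (uR B) (?V ?e) \<cdot>\<^bsub>?D\<^esub> (?J (ueta A ?RX) \<cdot>\<^bsub>?D\<^esub> q))"
        using B.zeta_natural[of "?V ?e" "?J (ueta A ?RX) \<cdot>\<^bsub>?D\<^esub> q"] v e X by simp
      also have "onA (uR B) (?V ?e) \<cdot>\<^bsub>?D\<^esub> (?J (ueta A ?RX) \<cdot>\<^bsub>?D\<^esub> q)
          = ?J (onA (uR A) ?e \<cdot>\<^bsub>?C\<^esub> ueta A ?RX) \<cdot>\<^bsub>?D\<^esub> q"
        using e q X by (simp add: J.preserves_Comp B.C.assoc)
      also have "onA (uR A) ?e \<cdot>\<^bsub>?C\<^esub> ueta A ?RX = Idn ?C ?RX"
        using A.zeta_simps(4)[of X "Idn ?C ?RX"] X by simp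
      finally show ?thesis using q X by simp
    qed
    then have "onA (uR B) (?V ?e) \<cdot>\<^bsub>?D\<^esub> onA (uR B) ?z = onA (uR B) (uzeta B (onO (utop1 f) X) q)"
      using v e X by (simp add: B.R.preserves_Comp[symmetric] del: commutes_Arr)
    ultimately show ?thesis using e by simp
  qed
  then show ?thesis
    using X unfolding comparison_alg_def P.hat_alg_eq by (auto simp: fun_eq_iff)
qed

end

lemma Phi1_Id1:
  assumes "universal_arrow small A"
  shows "Phi1 A A (uarr_Id1 A) = emnd_Id1 (Phi0 A)"
proof -
  interpret universal_arrow small A by fact
  note one = strict_1cell_Id1[OF assms]
  show ?thesis
    by (rule emnd_cell1.emnd1_eqI[OF strict_1cell.emnd_cell1_Phi1[OF one]
          emnd_cell1_Id1[OF extensive_monad_Phi0]])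
      (auto simp: strict_1cell.pext_alg_Phi1[OF one] pext_alg_Id1[OF extensive_monad_Phi0] comparison_L)
qed

lemma Phi1_Comp1:
  assumes f: "strict_1cell small A B f" and g: "strict_1cell small B C g"
  shows "Phi1 A C (uarr_Comp1 A B C g f)
    = emnd_Comp1 (Phi0 A) (Phi0 B) (Phi0 C) (Phi1 B C g) (Phi1 A B f)"
proof -
  interpret f: strict_1cell small A B f by fact
  interpret g: strict_1cell small B C g by fact
  note gf = strict_1cell_Comp1[OF f g]
  show ?thesis
    by (rule emnd_cell1.emnd1_eqI[OF strict_1cell.emnd_cell1_Phi1[OF gf]
          emnd_cell1_Comp1[OF f.emnd_cell1_Phi1 g.emnd_cell1_Phi1]])
      (auto simp: strict_1cell.pext_alg_Phi1[OF gf] f.pext_alg_Phi1 g.hat_comparison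
        pext_alg_Comp1[OF f.emnd_cell1_Phi1 g.emnd_cell1_Phi1])
qed

lemma (in strict_2cell) emnd_cell2_Phi2:
  "emnd_cell2 small (Phi0 A) (Phi0 B) (Phi1 A B f) (Phi1 A B g) \<alpha>"
proof -
  have "algebra_mor (Phi0 B) (comparison_alg B (onO (utop1 f) (uL A X)))
      (comparison_alg B (onO (utop1 g) (uL A X))) (\<alpha> (onO (uR A) (uL A X)))"
    if "X \<in> Obj (ubase A)" for X
    using f.B.algebra_mor_comparison[of "\<beta> (uL A X)"] that by simp
  then show ?thesis
    by (intro emnd_cell2I f.emnd_cell1_Phi1 g.emnd_cell1_Phi1)
      (auto simp: f.pext_alg_Phi1 g.pext_alg_Phi1 intro: \<alpha>.is_nat_trans_axioms)
qed

lemma Phi_simps [simp]: "on0 Phi = Phi0" "on1 Phi = Phi1" "on2 Phi = Phi2"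
  by (simp_all add: Phi_def)

lemma Phi2_simp [simp]: "Phi2 A B (f, g, \<alpha>, \<beta>) = (Phi1 A B f, Phi1 A B g, \<alpha>)"
  by (simp add: Phi2_def)

proposition two_functor_Phi: "two_functor (UArr small) (EMnd small) Phi"
proof (rule two_functor.intro[OF two_category_UArr two_category_EMnd two_functor_axioms.intro],
    unfold UArr_simps EMnd_simps Phi_simps, goal_cases)
  case (1 A)
  then show ?case by (rule universal_arrow.extensive_monad_Phi0)
next
  case (2 A B f)
  then show ?case
    by (simp add: Obj_uarr_Hom Obj_emnd_Hom[of small] universal_arrow.extensive_monad_Phi0
        strict_1cell.emnd_cell1_Phi1)
next
  case (3 A B \<alpha> f f')
  then show ?case
    by (auto simp: hom_uarr_Hom[of small] hom_emnd_Hom[of small] universal_arrow.extensive_monad_Phi0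
        dest: strict_2cell.emnd_cell2_Phi2)
next
  case (4 A B f)
  then have "strict_1cell small A B f" by (simp add: Obj_uarr_Hom)
  then show ?case by (simp add: strict_1cell.emnd_cell1_Phi1)
next
  case (5 A B \<alpha> f f' \<beta> f'')
  then obtain \<sigma> \<sigma>' \<tau> \<tau>' where \<alpha>: "\<alpha> = (f, f', \<sigma>, \<sigma>')" "strict_2cell small A B f f' \<sigma> \<sigma>'"
    and \<beta>: "\<beta> = (f', f'', \<tau>, \<tau>')" "strict_2cell small A B f' f'' \<tau> \<tau>'"
    by (auto simp: hom_uarr_Hom[of small])
  then show ?case
    using strict_2cell.emnd_cell2_Phi2[OF \<alpha>(2)] strict_2cell.emnd_cell2_Phi2[OF \<beta>(2)] by simp
next
  case (6 A)
  then show ?case by (rule Phi1_Id1)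
next
  case (7 A B C f g)
  then show ?case by (simp add: Obj_uarr_Hom[of small] Phi1_Comp1)
next
  case (8 A B C \<alpha> \<beta>)
  then show ?case
    by (auto simp: Arr_uarr_Hom[of small] intro!: Phi1_Comp1 dest: strict_2cellE)
qed

section \<open>The small category of algebras\<close>

context universe
begin

lemma code_eq_iff [simp]: "small A \<Longrightarrow> small B \<Longrightarrow> code A = code B \<longleftrightarrow> A = B"
  using code_inj by (auto dest: inj_onD)

lemma small_singleton [simp]: "small {x}"
  using small_doubleton[of x x] by simp

lemma small_image:
  assumes "small A"
  shows "small (f ` A)"
proof -
  have "f ` A = (\<Union>a\<in>A. {f a})" by auto
  then show ?thesis using small_UN[OF assms, of "\<lambda>a. {f a}"] by simp
qed

lemma small_image2:
  assumes "small A" "small B"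
  shows "small ((\<lambda>(x, y). f x y) ` (A \<times> B))"
proof -
  have "(\<lambda>(x, y). f x y) ` (A \<times> B) = (\<Union>x\<in>A. f x ` B)" by auto
  then show ?thesis using small_UN[OF assms(1), of "\<lambda>x. f x ` B"] small_image[OF assms(2)] by simp
qed

lemma code_pair_eq_iff [simp]: "code_pair code x y = code_pair code x' y' \<longleftrightarrow> x = x' \<and> y = y'"
  by (auto simp: code_pair_def small_doubleton doubleton_eq_iff)

end

locale coded_monad = universe small code + extensive_monad small M
  for small :: "'u set \<Rightarrow> bool" and code :: "'u set \<Rightarrow> 'u" and M :: "'u emnd"
begin

lemma small_Obj: "small (Obj (mcat M))" and small_Arr: "small (Arr (mcat M))"
  using base by (auto simp: small_category_def)

lemma small_arrows_into: "small (arrows_into (mcat M) N)"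
  by (rule small_subset[OF small_Arr]) auto

lemma graph_inj:
  assumes "(\<lambda>a. code_pair code a (n a)) ` A = (\<lambda>a. code_pair code a (n' a)) ` A" "a \<in> A"
  shows "n a = n' a"
proof -
  have "code_pair code a (n a) \<in> (\<lambda>a. code_pair code a (n' a)) ` A"
    using assms by blast
  then show ?thesis by auto
qed

lemma code_alg_eq_iff [simp]:
  assumes "algebra M X" "algebra M Y"
  shows "code_alg code M X = code_alg code M Y \<longleftrightarrow> X = Y"
proof
  assume eq: "code_alg code M X = code_alg code M Y"
  obtain N n N' n' where X: "X = (N, n)" and Y: "Y = (N', n')"
    by (metis surj_pair)
  have N: "N = N'" and graphs: "(\<lambda>a. code_pair code a (n a)) ` arrows_into (mcat M) N
      = (\<lambda>a. code_pair code a (n' a)) ` arrows_into (mcat M) N"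
    using eq by (auto simp: X Y code_alg_def small_image small_arrows_into simp del: arrows_into_iff)
  have "n a = n' a" if "a \<in> arrows_into (mcat M) N" for a
    using graphs that by (rule graph_inj)
  moreover have "n \<in> extensional (arrows_into (mcat M) N)" "n' \<in> extensional (arrows_into (mcat M) N)"
    using assms X Y N by (auto simp: algebra_def)
  ultimately have "n = n'" by (auto intro: extensionalityI)
  then show "X = Y" by (simp add: X Y N)
qed simp

lemma inj_on_code_alg: "inj_on (code_alg code M) (Obj (EM M))"
  by (auto simp: inj_on_def)

lemma inj_on_code_alg_arr: "inj_on (code_alg_arr code M) (Arr (EM M))"
  by (auto simp: inj_on_def code_alg_arr_def)

lemma decode_alg [simp]: "algebra M X \<Longrightarrow> decode_alg code M (code_alg code M X) = X"
  unfolding decode_alg_def by (rule inv_into_f_f[OF inj_on_code_alg]) simp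

lemma decode_alg_arr [simp]:
  assumes "algebra M K" "algebra M N" "algebra_mor M K N q"
  shows "decode_alg_arr code M (code_alg_arr code M (K, N, q)) = (K, N, q)"
  unfolding decode_alg_arr_def using assms by (intro inv_into_f_f[OF inj_on_code_alg_arr]) simp

text \<open>An algebra is coded by a pair of an object and a code of a subset of a fixed small set of coded
  pairs of arrows, namely the graph of its structure.\<close>

lemma small_code_alg: "small (code_alg code M ` Obj (EM M))"
proof -
  let ?G = "(\<lambda>(x, y). code_pair code x y) ` (Arr (mcat M) \<times> Arr (mcat M))"
  have "code_alg code M X \<in> (\<lambda>(x, y). code_pair code x y) ` (Obj (mcat M) \<times> code ` Pow ?G)"
    if "algebra M X" for X
  proof -
    obtain N n where X: "X = (N, n)" by fastforce
    have "n a \<in> Arr (mcat M)" if "a \<in> Arr (mcat M)" "Cod (mcat M) a = N" for a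
      using \<open>algebra M X\<close> that by (auto simp: algebra_def X hom_iff)
    then have "(\<lambda>a. code_pair code a (n a)) ` arrows_into (mcat M) N \<in> Pow ?G"
      by auto
    moreover have "N \<in> Obj (mcat M)"
      using that by (simp add: algebra_def X)
    moreover have "code_alg code M X = (\<lambda>(x, y). code_pair code x y)
        (N, code ((\<lambda>a. code_pair code a (n a)) ` arrows_into (mcat M) N))"
      by (simp add: code_alg_def X)
    ultimately show ?thesis
      by (intro image_eqI[of _ _ "(N, _)"] SigmaI imageI) auto
  qed
  then have "code_alg code M ` Obj (EM M)
      \<subseteq> (\<lambda>(x, y). code_pair code x y) ` (Obj (mcat M) \<times> code ` Pow ?G)"
    by auto
  then show ?thesis
    by (rule small_subset[rotated]) (intro small_image2 small_Pow small_Obj small_Arr)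
qed

lemma small_code_alg_arr: "small (code_alg_arr code M ` Arr (EM M))"
proof -
  let ?p = "\<lambda>(x, y). code_pair code x y" and ?O = "code_alg code M ` Obj (EM M)"
  have "code_alg_arr code M f \<in> ?p ` (?O \<times> ?p ` (?O \<times> Arr (mcat M)))" if arr: "f \<in> Arr (EM M)" for f
  proof -
    obtain K N q where f: "f = (K, N, q)" and KN: "algebra M K" "algebra M N" "algebra_mor M K N q"
      using arr by (cases f) auto
    have "q \<in> Arr (mcat M)"
      using KN(3) by (cases K; cases N) (simp add: algebra_mor_iff)
    then show ?thesis using KN by (auto simp: f code_alg_arr_def)
  qed
  then have "code_alg_arr code M ` Arr (EM M) \<subseteq> ?p ` (?O \<times> ?p ` (?O \<times> Arr (mcat M)))"
    by blast
  then show ?thesis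
    by (rule small_subset[rotated]) (intro small_image2 small_code_alg small_Arr)
qed

lemma Obj_small_EM: "Obj (small_EM code M) = code_alg code M ` {X. algebra M X}"
  by (simp add: small_EM_def)

lemma code_alg_in [simp]: "algebra M X \<Longrightarrow> code_alg code M X \<in> Obj (small_EM code M)"
  by (simp add: Obj_small_EM)

lemma Obj_small_EM_E:
  assumes "X \<in> Obj (small_EM code M)"
  obtains N n where "X = code_alg code M (N, n)" "algebra M (N, n)" "N \<in> Obj (mcat M)"
  using assms by (auto simp: Obj_small_EM algebra_def)

lemma Arr_small_EM_E:
  assumes "f \<in> Arr (small_EM code M)"
  obtains K k N n q where "f = code_alg_arr code M ((K, k), (N, n), q)"
    "algebra M (K, k)" "algebra M (N, n)" "algebra_mor M (K, k) (N, n) q"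
  using assms by (auto simp: small_EM_def)

lemma small_EM_simps [simp]:
  assumes "algebra M K" "algebra M N" "algebra_mor M K N q"
  shows "code_alg_arr code M (K, N, q) \<in> Arr (small_EM code M)"
    "Dom (small_EM code M) (code_alg_arr code M (K, N, q)) = code_alg code M K"
    "Cod (small_EM code M) (code_alg_arr code M (K, N, q)) = code_alg code M N"
    "\<lbrakk>algebra M H; algebra_mor M N H r\<rbrakk> \<Longrightarrow>
      code_alg_arr code M (N, H, r) \<cdot>\<^bsub>small_EM code M\<^esub> code_alg_arr code M (K, N, q)
        = code_alg_arr code M (K, H, r \<cdot>\<^bsub>mcat M\<^esub> q)"
proof -
  show "code_alg_arr code M (K, N, q) \<in> Arr (small_EM code M)"
    "Dom (small_EM code M) (code_alg_arr code M (K, N, q)) = code_alg code M K"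
    "Cod (small_EM code M) (code_alg_arr code M (K, N, q)) = code_alg code M N"
    using assms by (auto simp: small_EM_def)
  show "code_alg_arr code M (N, H, r) \<cdot>\<^bsub>small_EM code M\<^esub> code_alg_arr code M (K, N, q)
        = code_alg_arr code M (K, H, r \<cdot>\<^bsub>mcat M\<^esub> q)" if "algebra M H" "algebra_mor M N H r"
    using assms that unfolding small_EM_def by (subst mk_cat_simps(6)) auto
qed

lemma Idn_small_EM [simp]:
  "algebra M X \<Longrightarrow> Idn (small_EM code M) (code_alg code M X)
    = code_alg_arr code M (X, X, Idn (mcat M) (fst X))"
  by (simp add: small_EM_def)

lemma category_small_EM: "category (small_EM code M)"
  unfolding small_EM_def
  by (rule category_transport[OF category_EM[OF extensive_monad_axioms]])
    auto

lemma small_category_small_EM: "small_category small (small_EM code M)"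
  using category_small_EM small_code_alg small_code_alg_arr
  by (simp add: small_category_def small_EM_def)

lemma forget_simps [simp]:
  "algebra M X \<Longrightarrow> onO (forget code M) (code_alg code M X) = fst X"
  "\<lbrakk>algebra M K; algebra M N; algebra_mor M K N q\<rbrakk>
    \<Longrightarrow> onA (forget code M) (code_alg_arr code M (K, N, q)) = q"
  by (simp_all add: forget_def)

lemma is_functor_forget: "is_functor (small_EM code M) (mcat M) (forget code M)"
proof (rule is_functorI[OF category_small_EM C.category_axioms], goal_cases)
  case (3 X)
  then show ?case by (auto elim!: Obj_small_EM_E)
next
  case (4 f)
  then show ?case by (auto elim!: Arr_small_EM_E) (auto simp: algebra_mor_iff)
next
  case (5 X)
  then show ?case by (auto elim!: Obj_small_EM_E simp: algebra_mor_Idn)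
next
  case (6 f g)
  obtain K k N n q where f: "f = code_alg_arr code M ((K, k), (N, n), q)"
    "algebra M (K, k)" "algebra M (N, n)" "algebra_mor M (K, k) (N, n) q"
    using 6(1) by (rule Arr_small_EM_E)
  obtain N' n' H h r where g: "g = code_alg_arr code M ((N', n'), (H, h), r)"
    "algebra M (N', n')" "algebra M (H, h)" "algebra_mor M (N', n') (H, h) r"
    using 6(2) by (rule Arr_small_EM_E)
  have "(N', n') = (N, n)"
    using 6(3) f g by simp
  then show ?case
    using f g algebra_mor_Comp[of K k N n q H h r] by simp
qed (auto simp: forget_def)

lemma algebra_mor_struct:
  assumes "algebra M (N, n)" "v \<in> Arr (mcat M)" "Cod (mcat M) v = N"
  shows "algebra_mor M (free_alg M (Dom (mcat M) v)) (N, n) (n v)"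
proof -
  interpret N: monad_algebra small M N n
    using assms(1) by (rule monad_algebraI[OF extensive_monad_axioms])
  show ?thesis
    using assms(2,3) by (auto simp: algebra_mor_iff free_alg_def N.struct_ext)
qed

text \<open>A morphism of algebras \<open>q : S A \<rightarrow> N\<close> with \<open>q \<cdot> \<eta> = v\<close> satisfies \<open>n v = n (q \<cdot> \<eta>) = q \<cdot> \<eta>\<^sup>S = q\<close>, so
  \<open>n v\<close> is the only one.\<close>

lemma universal_arrow_Psi0: "universal_arrow small (Psi0 code M)"
proof (rule universal_arrow.intro, goal_cases)
  case 1
  then show ?case using base by (simp add: Psi0_def)
next
  case 2
  then show ?case using small_category_small_EM by (simp add: Psi0_def)
next
  case 3
  then show ?case using is_functor_forget by (simp add: Psi0_def)
next
  case 4
  then show ?case using algebra_free by (auto simp: Psi0_def)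
next
  case 5
  then show ?case by (simp add: Psi0_def eta_ext)
next
  case (6 A)
  then show ?case using algebra_free by (simp add: Psi0_def hom_iff free_alg_def)
next
  case 7
  have "code_alg_arr code M (free_alg M (Dom (mcat M) v), (N, n), n v) \<in> Arr (small_EM code M)"
    if "algebra M (N, n)" "v \<in> Arr (mcat M)" "Cod (mcat M) v = N" for N n v
    using that algebra_mor_struct[of N n v] algebra_free by simp
  then show ?case
    by (auto simp: Psi0_def elim!: Obj_small_EM_E)
next
  case (8 X v A)
  then obtain N n where X: "X = code_alg code M (N, n)" "algebra M (N, n)"
    by (auto simp: Psi0_def elim!: Obj_small_EM_E)
  interpret N: monad_algebra small M N n
    using X(2) by (rule monad_algebraI[OF extensive_monad_axioms])
  have v: "v \<in> Arr (mcat M)" "Dom (mcat M) v = A" "Cod (mcat M) v = N"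
    using 8(2) X by (auto simp: Psi0_def hom_iff)
  then show ?case
    using X algebra_mor_struct[of N n v] algebra_free[of A] N.struct_simps(4)[of v]
    by (auto simp: Psi0_def hom_iff)
next
  case (9 X v A w)
  then obtain N n where X: "X = code_alg code M (N, n)" "algebra M (N, n)"
    by (auto simp: Psi0_def elim!: Obj_small_EM_E)
  interpret N: monad_algebra small M N n
    using X(2) by (rule monad_algebraI[OF extensive_monad_axioms])
  have v: "v \<in> Arr (mcat M)" "Dom (mcat M) v = A" "Cod (mcat M) v = N"
    using 9(2) X by (auto simp: Psi0_def hom_iff)
  then have A: "A \<in> Obj (mcat M)" by auto
  obtain K k H h q where w: "w = code_alg_arr code M ((K, k), (H, h), q)"
    "algebra M (K, k)" "algebra M (H, h)" "algebra_mor M (K, k) (H, h) q"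
    using 9(3) by (auto simp: Psi0_def hom_iff elim!: Arr_small_EM_E)
  have "(K, k) = free_alg M A" "(H, h) = (N, n)"
    using 9(3) w X A algebra_free[OF A] by (auto simp: Psi0_def hom_iff)
  moreover have "q \<cdot>\<^bsub>mcat M\<^esub> meta M A = v"
    using 9(4) w by (simp add: Psi0_def)
  ultimately have "q = n v"
    using w(4) A ext_eta[OF A] by (auto simp: algebra_mor_iff free_alg_def)
  then show ?case
    using X v w \<open>(K, k) = free_alg M A\<close> \<open>(H, h) = (N, n)\<close> by (simp add: Psi0_def)
qed

end

lemma Psi0_simps [simp]:
  "ubase (Psi0 code M) = mcat M" "utop (Psi0 code M) = small_EM code M"
  "uR (Psi0 code M) = forget code M" "ueta (Psi0 code M) = meta M"
  "A \<in> Obj (mcat M) \<Longrightarrow> uL (Psi0 code M) A = code_alg code M (free_alg M A)"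
  by (simp_all add: Psi0_def)

lemma (in coded_monad) uzeta_Psi0 [simp]:
  "\<lbrakk>algebra M (N, n); v \<in> Arr (mcat M); Cod (mcat M) v = N\<rbrakk> \<Longrightarrow>
    uzeta (Psi0 code M) (code_alg code M (N, n)) v
      = code_alg_arr code M (free_alg M (Dom (mcat M) v), (N, n), n v)"
  by (simp add: Psi0_def)

section \<open>From monads to universal arrows\<close>

locale coded_cell1 =
  univ: universe small code + emnd_cell1 small M T P
  for small :: "'u set \<Rightarrow> bool" and code :: "'u set \<Rightarrow> 'u" and M T :: "'u emnd" and P :: "'u emnd1"

sublocale coded_cell1 \<subseteq> EM: coded_monad small code M ..
sublocale coded_cell1 \<subseteq> ET: coded_monad small code T ..

lemma coded_cell1I: "universe small code \<Longrightarrow> emnd_cell1 small M T P \<Longrightarrow> coded_cell1 small code M T P"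
  by (simp add: coded_cell1_def)

lemma fst_hat_alg [simp]: "fst (hat_alg M T P X) = onO (pfun P) (fst X)"
  by (cases X) (simp add: hat_alg_def)

lemma Psi1_simps [simp]:
  "ubase1 (Psi1 code M T P) = pfun P" "utop1 (Psi1 code M T P) = hat_func code M T P"
  by (simp_all add: Psi1_def)

context coded_cell1
begin

lemma hat_func_simps [simp]:
  "algebra M X \<Longrightarrow> onO (hat_func code M T P) (code_alg code M X) = code_alg code T (hat_alg M T P X)"
  "\<lbrakk>algebra M K; algebra M N; algebra_mor M K N q\<rbrakk>
    \<Longrightarrow> onA (hat_func code M T P) (code_alg_arr code M (K, N, q))
      = code_alg_arr code T (hat_alg M T P K, hat_alg M T P N, onA (pfun P) q)"
  by (simp_all add: hat_func_def)

declare algebra_hat [simp] algebra_mor_hat [simp]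

lemma is_functor_hat_func: "is_functor (small_EM code M) (small_EM code T) (hat_func code M T P)"
proof (rule is_functorI[OF EM.category_small_EM ET.category_small_EM], goal_cases)
  case (3 X)
  then show ?case by (auto elim!: EM.Obj_small_EM_E)
next
  case (4 f)
  then show ?case by (auto elim!: EM.Arr_small_EM_E)
next
  case (5 X)
  then show ?case by (auto elim!: EM.Obj_small_EM_E simp: M.algebra_mor_Idn)
next
  case (6 f g)
  obtain K k N n q where f: "f = code_alg_arr code M ((K, k), (N, n), q)"
    "algebra M (K, k)" "algebra M (N, n)" "algebra_mor M (K, k) (N, n) q"
    using 6(1) by (rule EM.Arr_small_EM_E)
  obtain N' n' H h r where g: "g = code_alg_arr code M ((N', n'), (H, h), r)"
    "algebra M (N', n')" "algebra M (H, h)" "algebra_mor M (N', n') (H, h) r"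
    using 6(2) by (rule EM.Arr_small_EM_E)
  have "(N', n') = (N, n)"
    using 6(3) f g by simp
  moreover have "onA (pfun P) (r \<cdot>\<^bsub>mcat M\<^esub> q) = onA (pfun P) r \<cdot>\<^bsub>mcat T\<^esub> onA (pfun P) q"
    using f(4) g(4) \<open>(N', n') = (N, n)\<close> by (intro P.preserves_Comp) (auto simp: algebra_mor_iff)
  ultimately show ?case
    using f g M.algebra_mor_Comp[of K k N n q H h r] by simp
qed (auto simp: hat_func_def)

lemma strict_1cell_Psi1: "strict_1cell small (Psi0 code M) (Psi0 code T) (Psi1 code M T P)"
proof -
  interpret R: is_functor "small_EM code M" "mcat M" "forget code M"
    by (rule EM.is_functor_forget)
  have "strict_uarr_1cell (Psi0 code M) (Psi0 code T) (Psi1 code M T P)"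
    by (rule strict_uarr_1cellI[OF EM.universal_arrow_Psi0 ET.universal_arrow_Psi0])
      (auto simp: P.is_functor_axioms is_functor_hat_func elim!: EM.Obj_small_EM_E EM.Arr_small_EM_E,
       auto simp: Psi1_def id_nat_def)
  then show ?thesis
    by (simp add: strict_1cell_def strict_1cell_axioms_def EM.universal_arrow_Psi0 ET.universal_arrow_Psi0)
qed

end

lemma Psi1_Id1:
  assumes "coded_monad small code M"
  shows "Psi1 code M M (emnd_Id1 M) = uarr_Id1 (Psi0 code M)"
proof -
  interpret coded_monad small code M by fact
  interpret I: coded_cell1 small code M M "emnd_Id1 M"
    by (intro coded_cell1I universe_axioms emnd_cell1_Id1 extensive_monad_axioms)
  have "hat_func code M M (emnd_Id1 M) = id_func (small_EM code M)"
    by (rule functor_eqI[OF I.is_functor_hat_func is_functor_id_func[OF category_small_EM]])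
      (auto elim!: Obj_small_EM_E Arr_small_EM_E simp: hat_alg_Id1[OF extensive_monad_axioms],
       auto simp: algebra_mor_iff)
  then show ?thesis
    by (intro strict_1cell.uarr1_eqI[OF I.strict_1cell_Psi1 strict_1cell_Id1[OF universal_arrow_Psi0]]) auto
qed

lemma Psi1_Comp1:
  assumes P: "coded_cell1 small code M T P" and W: "coded_cell1 small code T U W"
  shows "Psi1 code M U (emnd_Comp1 M T U W P)
    = uarr_Comp1 (Psi0 code M) (Psi0 code T) (Psi0 code U) (Psi1 code T U W) (Psi1 code M T P)"
proof -
  interpret P: coded_cell1 small code M T P by fact
  interpret W: coded_cell1 small code T U W by fact
  interpret WP: coded_cell1 small code M U "emnd_Comp1 M T U W P"
    by (intro coded_cell1I P.univ.universe_axioms emnd_cell1_Comp1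
        P.emnd_cell1_axioms W.emnd_cell1_axioms)
  note hat = hat_alg_Comp1[OF P.emnd_cell1_axioms W.emnd_cell1_axioms]
  have "hat_func code M U (emnd_Comp1 M T U W P)
      = comp_func (small_EM code M) (hat_func code T U W) (hat_func code M T P)"
    by (rule functor_eqI[OF WP.is_functor_hat_func
          is_functor_comp_func[OF P.is_functor_hat_func W.is_functor_hat_func]])
      (auto elim!: P.EM.Obj_small_EM_E P.EM.Arr_small_EM_E simp: hat, auto simp: algebra_mor_iff)
  then show ?thesis
    by (intro strict_1cell.uarr1_eqI[OF WP.strict_1cell_Psi1
          strict_1cell_Comp1[OF P.strict_1cell_Psi1 W.strict_1cell_Psi1]]) auto
qed

text \<open>The second component \<open>\<theta>\<close>-hat of \<open>\<Psi>(\<theta>)\<close>.\<close>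

definition hat_nat :: "('u set \<Rightarrow> 'u) \<Rightarrow> 'u emnd \<Rightarrow> 'u emnd \<Rightarrow> 'u emnd1 \<Rightarrow> 'u emnd1 \<Rightarrow> ('u \<Rightarrow> 'u) \<Rightarrow> 'u \<Rightarrow> 'u"
  where "hat_nat code M T P Q \<theta> = (\<lambda>X\<in>Obj (small_EM code M). case decode_alg code M X of (N, n) \<Rightarrow>
    code_alg_arr code T (hat_alg M T P (N, n), hat_alg M T Q (N, n), \<theta> N))"

lemma Psi2_simp [simp]:
  "Psi2 code M T (P, Q, \<theta>) = (Psi1 code M T P, Psi1 code M T Q, \<theta>, hat_nat code M T P Q \<theta>)"
  by (simp add: Psi2_def hat_nat_def)

locale coded_cell2 =
  univ: universe small code + emnd_cell2 small M T P Q \<theta>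
  for small :: "'u set \<Rightarrow> bool" and code :: "'u set \<Rightarrow> 'u" and M T :: "'u emnd" and P Q :: "'u emnd1"
    and \<theta> :: "'u \<Rightarrow> 'u"

sublocale coded_cell2 \<subseteq> cP: coded_cell1 small code M T P ..
sublocale coded_cell2 \<subseteq> cQ: coded_cell1 small code M T Q ..

lemma coded_cell2I:
  "universe small code \<Longrightarrow> emnd_cell2 small M T P Q \<theta> \<Longrightarrow> coded_cell2 small code M T P Q \<theta>"
  by (simp add: coded_cell2_def)

context coded_cell2
begin

lemma hat_nat_simp [simp]:
  "algebra M X \<Longrightarrow> hat_nat code M T P Q \<theta> (code_alg code M X)
    = code_alg_arr code T (hat_alg M T P X, hat_alg M T Q X, \<theta> (fst X))"
  by (cases X) (simp add: hat_nat_def)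

declare algebra_mor_theta [simp]

lemma algebra_mor_theta' [simp]:
  "algebra M (N, n) \<Longrightarrow> algebra_mor T (hat_alg M T P (N, n)) (hat_alg M T Q (N, n)) (\<theta> N)"
  using algebra_mor_theta[of "(N, n)"] by simp

lemma is_nat_trans_hat_nat:
  "is_nat_trans (small_EM code M) (small_EM code T) (hat_func code M T P) (hat_func code M T Q)
    (hat_nat code M T P Q \<theta>)"
proof (rule is_nat_transI[OF cP.is_functor_hat_func cQ.is_functor_hat_func], goal_cases)
  case (2 X)
  then show ?case by (auto elim!: cP.EM.Obj_small_EM_E)
next
  case (3 f)
  then obtain K k N n q where f: "f = code_alg_arr code M ((K, k), (N, n), q)"
    "algebra M (K, k)" "algebra M (N, n)" "algebra_mor M (K, k) (N, n) q"
    by (rule cP.EM.Arr_small_EM_E)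
  then have "\<theta> N \<cdot>\<^bsub>mcat T\<^esub> onA (pfun P) q = onA (pfun Q) q \<cdot>\<^bsub>mcat T\<^esub> \<theta> K"
    using \<theta>.naturality[of q] by (auto simp: algebra_mor_iff)
  then show ?case using f by simp
qed (simp add: hat_nat_def)

lemma strict_2cell_Psi2:
  "strict_2cell small (Psi0 code M) (Psi0 code T) (Psi1 code M T P) (Psi1 code M T Q)
    \<theta> (hat_nat code M T P Q \<theta>)"
  by (rule strict_2cellI[OF cP.strict_1cell_Psi1 cQ.strict_1cell_Psi1])
    (auto simp: is_nat_trans_hat_nat \<theta>.is_nat_trans_axioms elim!: cP.EM.Obj_small_EM_E)

end

text \<open>All the equations that make \<open>\<Psi>\<close> a 2-functor on 2-cells are instances of one principle: a
  transformation with the prescribed values on coded algebras is \<open>\<theta>\<close>-hat.\<close>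

lemma hat_nat_eqI:
  assumes "coded_cell2 small code M T P Q \<theta>"
    "is_nat_trans (small_EM code M) (small_EM code T) F G \<beta>"
    "\<And>N n. \<lbrakk>algebra M (N, n); N \<in> Obj (mcat M)\<rbrakk> \<Longrightarrow> \<beta> (code_alg code M (N, n))
      = code_alg_arr code T (hat_alg M T P (N, n), hat_alg M T Q (N, n), \<theta> N)"
  shows "hat_nat code M T P Q \<theta> = \<beta>"
proof -
  interpret coded_cell2 small code M T P Q \<theta> by fact
  show ?thesis
    by (rule nat_trans_eqI[OF is_nat_trans_hat_nat assms(2)])
      (auto elim!: cP.EM.Obj_small_EM_E simp: assms(3))
qed

lemma hat_nat_id:
  assumes "coded_cell1 small code M T P"
  shows "hat_nat code M T P P (id_nat (mcat M) (mcat T) (pfun P))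
    = id_nat (small_EM code M) (small_EM code T) (hat_func code M T P)"
proof -
  interpret coded_cell1 small code M T P by fact
  show ?thesis
    by (rule hat_nat_eqI[OF coded_cell2I[OF univ.universe_axioms emnd_cell2_id[OF emnd_cell1_axioms]]
        is_nat_trans_id_nat[OF is_functor_hat_func]]) simp
qed

lemma hat_nat_vcomp:
  assumes s: "coded_cell2 small code M T P Q \<theta>" and t: "coded_cell2 small code M T Q R \<theta>'"
  shows "hat_nat code M T P R (vcomp (mcat M) (mcat T) \<theta>' \<theta>)
    = vcomp (small_EM code M) (small_EM code T) (hat_nat code M T Q R \<theta>') (hat_nat code M T P Q \<theta>)"
proof -
  interpret s: coded_cell2 small code M T P Q \<theta> by fact
  interpret t: coded_cell2 small code M T Q R \<theta>' by fact
  show ?thesis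
    by (rule hat_nat_eqI[OF coded_cell2I[OF s.univ.universe_axioms
            emnd_cell2_vcomp[OF s.emnd_cell2_axioms t.emnd_cell2_axioms]]
        is_nat_trans_vcomp[OF s.is_nat_trans_hat_nat t.is_nat_trans_hat_nat]])
      simp
qed

lemma hat_nat_hcomp:
  assumes s: "coded_cell2 small code M T P P' \<theta>" and t: "coded_cell2 small code T U W W' \<theta>'"
  shows "hat_nat code M U (emnd_Comp1 M T U W P) (emnd_Comp1 M T U W' P')
      (hcomp (mcat M) (mcat U) (pfun W) \<theta>' (pfun P') \<theta>)
    = hcomp (small_EM code M) (small_EM code U) (hat_func code T U W) (hat_nat code T U W W' \<theta>')
      (hat_func code M T P') (hat_nat code M T P P' \<theta>)"
proof -
  interpret s: coded_cell2 small code M T P P' \<theta> by fact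
  interpret t: coded_cell2 small code T U W W' \<theta>' by fact
  note hat = hat_alg_Comp1[OF s.P.emnd_cell1_axioms t.P.emnd_cell1_axioms]
    hat_alg_Comp1[OF s.Q.emnd_cell1_axioms t.Q.emnd_cell1_axioms]
  have "algebra_mor U (hat_alg T U W (hat_alg M T P' (N, n))) (hat_alg T U W' (hat_alg M T P' (N, n)))
      (\<theta>' (onO (pfun P') N))" if "algebra M (N, n)" for N n
    using t.algebra_mor_theta[of "hat_alg M T P' (N, n)"] that by simp
  then show ?thesis
    by (intro hat_nat_eqI[OF coded_cell2I[OF s.univ.universe_axioms
            emnd_cell2_hcomp[OF s.emnd_cell2_axioms t.emnd_cell2_axioms]]
        is_nat_trans_hcomp[OF s.is_nat_trans_hat_nat t.is_nat_trans_hat_nat]])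
      (simp add: hat)
qed

lemma Psi_simps [simp]:
  "on0 (Psi code) = Psi0 code" "on1 (Psi code) = Psi1 code" "on2 (Psi code) = Psi2 code"
  by (simp_all add: Psi_def)

context universe
begin

proposition two_functor_Psi: "two_functor (EMnd small) (UArr small) (Psi code)"
proof (rule two_functor.intro[OF two_category_EMnd two_category_UArr two_functor_axioms.intro],
    unfold UArr_simps EMnd_simps Psi_simps, goal_cases)
  note cell1 = coded_cell1I[OF universe_axioms] and cell2 = coded_cell2I[OF universe_axioms]
  have monad: "coded_monad small code M" if "extensive_monad small M" for M
    using that universe_axioms by (simp add: coded_monad_def)
  note Psi0 = coded_monad.universal_arrow_Psi0[OF monad]
  {
    case (1 A)
    then show ?case by (rule Psi0)
  next
    case (2 A B f)
    then show ?case
      by (simp add: Obj_uarr_Hom[of small] Obj_emnd_Hom[of small] Psi0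
          coded_cell1.strict_1cell_Psi1[OF cell1])
  next
    case (3 A B \<alpha> f f')
    then show ?case
      by (auto simp: hom_uarr_Hom[of small] hom_emnd_Hom[of small] Psi0
          coded_cell2.strict_2cell_Psi2[OF cell2])
  next
    case (4 A B f)
    then have "emnd_cell1 small A B f" by (simp add: Obj_emnd_Hom)
    then show ?case
      by (simp add: coded_cell1.strict_1cell_Psi1[OF cell1] hat_nat_id[OF cell1])
  next
    case (5 A B \<alpha> f f' \<beta> f'')
    then obtain \<sigma> \<tau> where \<alpha>: "\<alpha> = (f, f', \<sigma>)" "emnd_cell2 small A B f f' \<sigma>"
      and \<beta>: "\<beta> = (f', f'', \<tau>)" "emnd_cell2 small A B f' f'' \<tau>"
      by (auto simp: hom_emnd_Hom[of small])
    then show ?case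
      using coded_cell2.strict_2cell_Psi2[OF cell2[OF \<alpha>(2)]]
        coded_cell2.strict_2cell_Psi2[OF cell2[OF \<beta>(2)]]
      by (simp add: hat_nat_vcomp[OF cell2[OF \<alpha>(2)] cell2[OF \<beta>(2)]])
  next
    case (6 A)
    then show ?case by (intro Psi1_Id1[of small] monad)
  next
    case (7 A B C f g)
    then show ?case by (simp add: Obj_emnd_Hom[of small] Psi1_Comp1[OF cell1 cell1])
  next
    case (8 A B C \<alpha> \<beta>)
    then show ?case
      by (auto simp: Arr_emnd_Hom[of small] hat_nat_hcomp[OF cell2 cell2]
          intro!: Psi1_Comp1[OF cell1 cell1] dest: emnd_cell2E)
  }
qed

end

section \<open>The 2-adjunction\<close>

locale coded_arrow = universe small code + universal_arrow small U
  for small :: "'u set \<Rightarrow> bool" and code :: "'u set \<Rightarrow> 'u" and U :: "'u uarr"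

sublocale coded_arrow \<subseteq> Phi: coded_monad small code "Phi0 U"
  by (intro coded_monad.intro universe_axioms extensive_monad_Phi0)

text \<open>The comparison 1-cell \<open>U \<rightarrow> \<Psi> \<Phi> U\<close>, which is the unit of the adjunction.\<close>

definition comparison :: "('u set \<Rightarrow> 'u) \<Rightarrow> 'u uarr \<Rightarrow> 'u uarr1" where
  "comparison code U = \<lparr>ubase1 = id_func (ubase U),
    utop1 = \<lparr>onO = (\<lambda>X\<in>Obj (utop U). code_alg code (Phi0 U) (comparison_alg U X)),
      onA = (\<lambda>m\<in>Arr (utop U). code_alg_arr code (Phi0 U)
        (comparison_alg U (Dom (utop U) m), comparison_alg U (Cod (utop U) m), onA (uR U) m))\<rparr>,
    urho = id_nat (utop U) (ubase U) (uR U)\<rparr>"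

lemma comparison_simps [simp]:
  "ubase1 (comparison code U) = id_func (ubase U)"
  "X \<in> Obj (utop U) \<Longrightarrow> onO (utop1 (comparison code U)) X = code_alg code (Phi0 U) (comparison_alg U X)"
  "m \<in> Arr (utop U) \<Longrightarrow> onA (utop1 (comparison code U)) m = code_alg_arr code (Phi0 U)
    (comparison_alg U (Dom (utop U) m), comparison_alg U (Cod (utop U) m), onA (uR U) m)"
  by (simp_all add: comparison_def)

lemma fst_comparison_alg [simp]: "fst (comparison_alg U X) = onO (uR U) X"
  by (simp add: comparison_alg_def)

context coded_arrow
begin

declare algebra_comparison [simp] algebra_mor_comparison [simp]

lemma algebra_mor_comparison_Idn [simp]:
  "X \<in> Obj (utop U) \<Longrightarrow>
    algebra_mor (Phi0 U) (comparison_alg U X) (comparison_alg U X) (Idn (ubase U) (onO (uR U) X))"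
  using algebra_mor_comparison[of "Idn (utop U) X"] by simp

lemma is_functor_comparison:
  "is_functor (utop U) (small_EM code (Phi0 U)) (utop1 (comparison code U))"
proof (rule is_functorI[OF X.category_axioms Phi.category_small_EM], goal_cases)
  case (6 f g)
  then show ?case
    using algebra_mor_comparison[of g] algebra_mor_comparison[of f] by (simp add: R.preserves_Comp)
qed (auto simp: comparison_def)

lemma strict_1cell_comparison: "strict_1cell small U (Psi0 code (Phi0 U)) (comparison code U)"
proof -
  have "strict_uarr_1cell U (Psi0 code (Phi0 U)) (comparison code U)"
    by (rule strict_uarr_1cellI[OF universal_arrow_axioms Phi.universal_arrow_Psi0])
      (auto simp: is_functor_id_func C.category_axioms is_functor_comparison,
       auto simp: comparison_def id_nat_def)
  then show ?thesis
    by (simp add: strict_1cell_def strict_1cell_axioms_def universal_arrow_axioms Phi.universal_arrow_Psi0)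
qed

end

context coded_monad
begin

text \<open>The universal arrow of \<open>M\<close> has \<open>\<zeta>(v) = n v\<close>, from which the forgetful functor recovers the given
  extension operation itself; this is why the counit can be an identity.\<close>

lemma Phi0_Psi0: "Phi0 (Psi0 code M) = M"
proof -
  have "compose (Obj (mcat M)) (onO (forget code M))
      (\<lambda>A\<in>Obj (mcat M). code_alg code M (free_alg M A)) = mS M"
    using S by (intro extensionalityI[of _ "Obj (mcat M)"])
      (auto simp: PiE_iff compose_def forget_simps(1)[OF algebra_free], simp add: free_alg_def)
  moreover have "(\<lambda>B\<in>Obj (mcat M). \<lambda>h\<in>arrows_into (mcat M) (onO (forget code M) (uL (Psi0 code M) B)).
      onA (forget code M) (uzeta (Psi0 code M) (uL (Psi0 code M) B) h)) = mext M"
  proof (rule extensionalityI[of _ "Obj (mcat M)"])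
    fix B
    assume B: "B \<in> Obj (mcat M)"
    have free: "algebra M (mS M B, mext M B)"
      using algebra_free[OF B] by (simp add: free_alg_def)
    have "(\<lambda>h\<in>arrows_into (mcat M) (mS M B).
        onA (forget code M) (uzeta (Psi0 code M) (code_alg code M (mS M B, mext M B)) h)) = mext M B"
      using B mext_extensional(2)[OF B] free algebra_mor_struct[OF free] algebra_free
      by (intro extensionalityI[of _ "arrows_into (mcat M) (mS M B)"]) auto
    then show "(\<lambda>B\<in>Obj (mcat M). \<lambda>h\<in>arrows_into (mcat M) (onO (forget code M) (uL (Psi0 code M) B)).
      onA (forget code M) (uzeta (Psi0 code M) (uL (Psi0 code M) B) h)) B = mext M B"
      using B algebra_free[OF B] by (simp add: free_alg_def)
  qed simp_all
  ultimately show ?thesis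
    unfolding Phi0_def Psi0_simps by (simp add: Psi0_def)
qed

text \<open>For \<open>\<Psi> M\<close>, the comparison functor is an identity because \<open>\<zeta>(v) = n v\<close>.\<close>

lemma comparison_alg_Psi0:
  assumes "algebra M X"
  shows "comparison_alg (Psi0 code M) (code_alg code M X) = X"
proof (cases X)
  case (Pair N n)
  interpret N: monad_algebra small M N n
    using assms Pair by (intro monad_algebraI[OF extensive_monad_axioms]) simp
  show ?thesis
    using assms Pair N.ext_struct algebra_free algebra_mor_struct[of N n]
    by (auto simp: comparison_alg_def intro!: extensionalityI[of _ "arrows_into (mcat M) N"])
qed

end

text \<open>Applying \<open>\<Psi>\<close> and then \<open>\<Phi>\<close> first lifts \<open>P\<close> to all algebras and then restricts the lifting to
  free ones, which recovers the given structures by \<open>hat_free\<close>.\<close>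

lemma (in coded_cell1) Phi1_Psi1: "Phi1 (Psi0 code M) (Psi0 code T) (Psi1 code M T P) = P"
proof -
  interpret Psi: strict_1cell small "Psi0 code M" "Psi0 code T" "Psi1 code M T P"
    by (rule strict_1cell_Psi1)
  have "pext_alg (Phi0 (Psi0 code M)) (Phi1 (Psi0 code M) (Psi0 code T) (Psi1 code M T P)) A
      = pext_alg M P A" if "A \<in> Obj (mcat M)" for A
    using that Psi.pext_alg_Phi1[of A] M.algebra_free[OF that] algebra_hat[OF M.algebra_free[OF that]]
    by (simp add: ET.comparison_alg_Psi0 hat_free)
  then show ?thesis
    using Psi.emnd_cell1_Phi1 emnd_cell1_axioms
    by (intro emnd_cell1.emnd1_eqI) (auto simp: EM.Phi0_Psi0 ET.Phi0_Psi0)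
qed

text \<open>This is the triangle law at \<open>\<Phi> U\<close>: \<open>\<Phi>\<close> only sees the comparison algebras of the objects \<open>L A\<close>, and these are the
  free algebras.\<close>

lemma (in coded_arrow) Phi1_comparison:
  "Phi1 U (Psi0 code (Phi0 U)) (comparison code U) = emnd_Id1 (Phi0 U)"
proof -
  interpret K: strict_1cell small U "Psi0 code (Phi0 U)" "comparison code U"
    by (rule strict_1cell_comparison)
  have "pext_alg (Phi0 U) (Phi1 U (Psi0 code (Phi0 U)) (comparison code U)) A
      = pext_alg (Phi0 U) (emnd_Id1 (Phi0 U)) A" if "A \<in> Obj (ubase U)" for A
    using that K.pext_alg_Phi1[of A] Phi.algebra_free[of A]
    by (simp add: Phi.comparison_alg_Psi0 pext_alg_Id1[OF extensive_monad_Phi0] comparison_L)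
  then show ?thesis
    using K.emnd_cell1_Phi1 emnd_cell1_Id1[OF extensive_monad_Phi0]
    by (intro emnd_cell1.emnd1_eqI) (auto simp: Phi.Phi0_Psi0)
qed

text \<open>This is the triangle law at \<open>\<Psi> M\<close>: every algebra is its own comparison algebra.\<close>

lemma (in coded_monad) comparison_Psi0: "comparison code (Psi0 code M) = uarr_Id1 (Psi0 code M)"
proof -
  interpret Psi: coded_arrow small code "Psi0 code M"
    by (intro coded_arrow.intro universe_axioms universal_arrow_Psi0)
  have "utop1 (comparison code (Psi0 code M)) = id_func (small_EM code M)"
    using Psi.is_functor_comparison is_functor_id_func[OF category_small_EM]
    by (intro functor_eqI[of "small_EM code M" "small_EM code M"])
      (auto simp: Phi0_Psi0 comparison_alg_Psi0 elim!: Obj_small_EM_E Arr_small_EM_E)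
  then show ?thesis
    using Psi.strict_1cell_comparison strict_1cell_Id1[OF universal_arrow_Psi0]
    by (intro strict_1cell.uarr1_eqI) (auto simp: Phi0_Psi0)
qed

locale coded_strict_1cell = univ: universe small code + strict_1cell small A B f
  for small :: "'u set \<Rightarrow> bool" and code :: "'u set \<Rightarrow> 'u" and A B :: "'u uarr" and f :: "'u uarr1"

sublocale coded_strict_1cell \<subseteq> cA: coded_arrow small code A ..
sublocale coded_strict_1cell \<subseteq> cB: coded_arrow small code B ..
sublocale coded_strict_1cell \<subseteq> Phi: coded_cell1 small code "Phi0 A" "Phi0 B" "Phi1 A B f"
  by (intro coded_cell1I univ.universe_axioms emnd_cell1_Phi1)

context coded_strict_1cell
begin

lemma comparison_natural:
  "uarr_Comp1 A (Psi0 code (Phi0 A)) (Psi0 code (Phi0 B))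
      (Psi1 code (Phi0 A) (Phi0 B) (Phi1 A B f)) (comparison code A)
    = uarr_Comp1 A B (Psi0 code (Phi0 B)) (comparison code B) f"
proof (rule strict_1cell.uarr1_eqI[OF strict_1cell_Comp1 strict_1cell_Comp1],
    rule cA.strict_1cell_comparison, rule Phi.strict_1cell_Psi1, rule strict_1cell_axioms,
    rule cB.strict_1cell_comparison)
  let ?l = "comp_func (utop A) (hat_func code (Phi0 A) (Phi0 B) (Phi1 A B f)) (utop1 (comparison code A))"
  let ?r = "comp_func (utop A) (utop1 (comparison code B)) (utop1 f)"
  have "?l = ?r"
  proof (rule functor_eqI)
    show "is_functor (utop A) (small_EM code (Phi0 B)) ?l"
      by (rule is_functor_comp_func[OF cA.is_functor_comparison Phi.is_functor_hat_func])
    show "is_functor (utop A) (small_EM code (Phi0 B)) ?r"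
      by (rule is_functor_comp_func[OF V.is_functor_axioms cB.is_functor_comparison])
  qed (auto simp: hat_comparison)
  then show "utop1 (uarr_Comp1 A (Psi0 code (Phi0 A)) (Psi0 code (Phi0 B))
      (Psi1 code (Phi0 A) (Phi0 B) (Phi1 A B f)) (comparison code A))
    = utop1 (uarr_Comp1 A B (Psi0 code (Phi0 B)) (comparison code B) f)" by simp
qed (simp add: comp_func_id_right[OF J.is_functor_axioms] comp_func_id_left[OF J.is_functor_axioms])

end

text \<open>Naturality of the comparison with respect to 2-cells, by components. In the second component both
  sides are coded arrows \<open>R\<^sup>\<dagger> (\<beta> X) = \<alpha> (R X)\<close> between comparison algebras, up to identities.\<close>

lemma comparison_natural2:
  assumes "universe small code" "strict_2cell small A B f g \<alpha> \<beta>"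
  shows "hcomp (ubase A) (ubase B) (ubase1 f) \<alpha> (id_func (ubase A))
        (id_nat (ubase A) (ubase A) (id_func (ubase A)))
      = hcomp (ubase A) (ubase B) (id_func (ubase B))
        (id_nat (ubase B) (ubase B) (id_func (ubase B))) (ubase1 g) \<alpha>"
    and "hcomp (utop A) (small_EM code (Phi0 B)) (hat_func code (Phi0 A) (Phi0 B) (Phi1 A B f))
        (hat_nat code (Phi0 A) (Phi0 B) (Phi1 A B f) (Phi1 A B g) \<alpha>) (utop1 (comparison code A))
        (id_nat (utop A) (small_EM code (Phi0 A)) (utop1 (comparison code A)))
      = hcomp (utop A) (small_EM code (Phi0 B)) (utop1 (comparison code B))
        (id_nat (utop B) (small_EM code (Phi0 B)) (utop1 (comparison code B))) (utop1 g) \<beta>"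
proof -
  interpret strict_2cell small A B f g \<alpha> \<beta> by fact
  interpret f: coded_strict_1cell small code A B f
    using assms(1) f.strict_1cell_axioms by (simp add: coded_strict_1cell_def)
  interpret g: coded_strict_1cell small code A B g
    using assms(1) g.strict_1cell_axioms by (simp add: coded_strict_1cell_def)
  interpret Phi: coded_cell2 small code "Phi0 A" "Phi0 B" "Phi1 A B f" "Phi1 A B g" \<alpha>
    by (intro coded_cell2I assms emnd_cell2_Phi2)
  show "hcomp (ubase A) (ubase B) (ubase1 f) \<alpha> (id_func (ubase A))
        (id_nat (ubase A) (ubase A) (id_func (ubase A)))
      = hcomp (ubase A) (ubase B) (id_func (ubase B))
        (id_nat (ubase B) (ubase B) (id_func (ubase B))) (ubase1 g) \<alpha>"
    by (simp only: hcomp_id_right[OF \<alpha>.is_nat_trans_axioms] hcomp_id_left[OF \<alpha>.is_nat_trans_axioms])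
  have "code_alg_arr code (Phi0 B) (comparison_alg B (onO (utop1 f) X), comparison_alg B (onO (utop1 g) X),
          \<alpha> (onO (uR A) X))
      \<cdot>\<^bsub>small_EM code (Phi0 B)\<^esub> code_alg_arr code (Phi0 B) (comparison_alg B (onO (utop1 f) X),
          comparison_alg B (onO (utop1 f) X), Idn (ubase B) (onO (ubase1 f) (onO (uR A) X)))
      = code_alg_arr code (Phi0 B) (comparison_alg B (onO (utop1 g) X), comparison_alg B (onO (utop1 g) X),
          Idn (ubase B) (onO (ubase1 g) (onO (uR A) X)))
      \<cdot>\<^bsub>small_EM code (Phi0 B)\<^esub> code_alg_arr code (Phi0 B) (comparison_alg B (onO (utop1 f) X),
          comparison_alg B (onO (utop1 g) X), \<alpha> (onO (uR A) X))" if X: "X \<in> Obj (utop A)" for X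
    using X f.B.algebra_mor_comparison[of "\<beta> X"] f.cB.algebra_mor_comparison_Idn[of "onO (utop1 f) X"]
      f.cB.algebra_mor_comparison_Idn[of "onO (utop1 g) X"]
    by simp
  then show "hcomp (utop A) (small_EM code (Phi0 B)) (hat_func code (Phi0 A) (Phi0 B) (Phi1 A B f))
        (hat_nat code (Phi0 A) (Phi0 B) (Phi1 A B f) (Phi1 A B g) \<alpha>) (utop1 (comparison code A))
        (id_nat (utop A) (small_EM code (Phi0 A)) (utop1 (comparison code A)))
      = hcomp (utop A) (small_EM code (Phi0 B)) (utop1 (comparison code B))
        (id_nat (utop B) (small_EM code (Phi0 B)) (utop1 (comparison code B))) (utop1 g) \<beta>"
    by (intro extensionalityI[of _ "Obj (utop A)"])
      (simp_all add: f.hat_comparison g.hat_comparison, auto simp: hcomp_def)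
qed

lemma id_two_func_simps [simp]:
  "on0 id_two_func A = A" "on1 id_two_func A B f = f" "on2 id_two_func A B \<alpha> = \<alpha>"
  by (simp_all add: id_two_func_def)

lemma comp_two_func_simps [simp]:
  "on0 (G \<circ>\<^sub>2 F) A = on0 G (on0 F A)"
  "on1 (G \<circ>\<^sub>2 F) A B f = on1 G (on0 F A) (on0 F B) (on1 F A B f)"
  "on2 (G \<circ>\<^sub>2 F) A B \<alpha> = on2 G (on0 F A) (on0 F B) (on2 F A B \<alpha>)"
  by (simp_all add: comp_two_func_def)

lemma two_functor_id:
  assumes "two_category K"
  shows "two_functor K K id_two_func"
  by (rule two_functor.intro[OF assms assms two_functor_axioms.intro]) simp_all

lemma two_functor_comp:
  assumes F: "two_functor K L F" and G: "two_functor L N G"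
  shows "two_functor K N (G \<circ>\<^sub>2 F)"
proof -
  interpret F: two_functor K L F by fact
  interpret G: two_functor L N G by fact
  have arr: "on2 F A B \<alpha> \<in> Arr (Hom L (on0 F A) (on0 F B))"
    if "A \<in> Ob K" "B \<in> Ob K" "\<alpha> \<in> Arr (Hom K A B)" for A B \<alpha>
    using F.on2_type[OF that(1,2), of \<alpha>] that(3) by (auto simp: hom_iff)
  show ?thesis
  proof (rule two_functor.intro[OF F.source.two_category_axioms G.target.two_category_axioms
        two_functor_axioms.intro], unfold comp_two_func_simps, goal_cases)
    case (3 A B \<alpha> f f')
    then show ?case by (intro G.on2_type F.on2_type F.on0_type)
  next
    case (5 A B \<alpha> f f' \<beta> f'')
    then show ?case
      by (simp add: F.on2_vertical[of A B \<alpha> f f' \<beta> f'']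
          G.on2_vertical[OF F.on0_type F.on0_type F.on2_type F.on2_type])
  qed (simp_all add: F.on0_type G.on0_type F.on1_type G.on1_type F.on2_Id2 G.on2_Id2 F.on1_Id1 G.on1_Id1
      F.on1_Comp1 G.on1_Comp1 F.on2_Comp2 G.on2_Comp2 arr)
qed

theorem theorem6p2:
  fixes small :: "'u set \<Rightarrow> bool" and code :: "'u set \<Rightarrow> 'u"
  assumes "universe small code"
  shows "\<exists>\<eta> \<epsilon>. two_adjunction (UArr small) (EMnd small) Phi (Psi code) \<eta> \<epsilon>"
proof (intro exI)
  note Phi = two_functor_Phi[of small] and Psi = universe.two_functor_Psi[OF assms]
  have arrow: "coded_arrow small code A" if "universal_arrow small A" for A
    using that assms by (simp add: coded_arrow_def)
  have monad: "coded_monad small code M" if "extensive_monad small M" for M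
    using that assms by (simp add: coded_monad_def)
  have cell1: "coded_strict_1cell small code A B f" if "strict_1cell small A B f" for A B f
    using that assms by (simp add: coded_strict_1cell_def)
  note emnd1 = coded_cell1I[OF assms]
  note Phi0 = universal_arrow.extensive_monad_Phi0
  note Phi0_Psi0 = coded_monad.Phi0_Psi0[OF monad]
  have unit: "two_nat_trans (UArr small) (UArr small) id_two_func (Psi code \<circ>\<^sub>2 Phi) (comparison code)"
  proof (rule two_nat_trans.intro[OF two_functor_id[OF two_category_UArr] two_functor_comp[OF Phi Psi]
        two_nat_trans_axioms.intro], unfold UArr_simps comp_two_func_simps id_two_func_simps
        Phi_simps Psi_simps, goal_cases)
    case (1 A)
    then show ?case
      by (simp add: Obj_uarr_Hom[of small] coded_monad.universal_arrow_Psi0[OF monad[OF Phi0]]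
          coded_arrow.strict_1cell_comparison[OF arrow])
  next
    case (2 A B f)
    then show ?case
      by (simp add: Obj_uarr_Hom[of small] coded_strict_1cell.comparison_natural[OF cell1])
  next
    case (3 A B x)
    then obtain f g \<alpha> \<beta> where x: "x = (f, g, \<alpha>, \<beta>)" and two: "strict_2cell small A B f g \<alpha> \<beta>"
      by (auto simp: Arr_uarr_Hom[of small])
    have "strict_1cell small A (Psi0 code (Phi0 A)) (comparison code A)"
      "strict_1cell small B (Psi0 code (Phi0 B)) (comparison code B)"
      using 3 by (auto intro: coded_arrow.strict_1cell_comparison arrow)
    then show ?case
      using comparison_natural2[OF assms two] coded_strict_1cell.comparison_natural[OF cell1]
        strict_2cellE(1,2)[OF two]
      by (simp add: x)
  qed
  have counit: "two_nat_trans (EMnd small) (EMnd small) (Phi \<circ>\<^sub>2 Psi code) id_two_func emnd_Id1"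
  proof (rule two_nat_trans.intro[OF two_functor_comp[OF Psi Phi] two_functor_id[OF two_category_EMnd]
        two_nat_trans_axioms.intro], unfold EMnd_simps comp_two_func_simps id_two_func_simps
        Phi_simps Psi_simps, goal_cases)
    case (1 M)
    then show ?case
      by (simp add: Phi0_Psi0 Obj_emnd_Hom emnd_cell1_Id1)
  next
    case (2 M T P)
    then have P: "emnd_cell1 small M T P" by (simp add: Obj_emnd_Hom)
    show ?case
      using 2 by (simp add: Phi0_Psi0 coded_cell1.Phi1_Psi1[OF emnd1[OF P]]
          emnd_Comp1_Id1_right[OF P] emnd_Comp1_Id1_left[OF P])
  next
    case (3 M T x)
    then obtain P Q \<theta> where x: "x = (P, Q, \<theta>)" and two: "emnd_cell2 small M T P Q \<theta>"
      by (auto simp: Arr_emnd_Hom[of small])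
    note PQ = emnd_cell2E[OF two]
    have "Id2 (EMnd small) M M (emnd_Id1 M)
        = (emnd_Id1 M, emnd_Id1 M, id_nat (mcat M) (mcat M) (id_func (mcat M)))"
      "Id2 (EMnd small) T T (emnd_Id1 T)
        = (emnd_Id1 T, emnd_Id1 T, id_nat (mcat T) (mcat T) (id_func (mcat T)))"
      using 3 by (simp_all add: Id2_EMnd[OF emnd_cell1_Id1])
    then show ?case
      using 3 by (simp add: x Phi0_Psi0 coded_cell1.Phi1_Psi1[OF emnd1[OF PQ(1)]]
          coded_cell1.Phi1_Psi1[OF emnd1[OF PQ(2)]]
          emnd_Comp1_Id1_right[OF PQ(1)] emnd_Comp1_Id1_left[OF PQ(1)]
          emnd_Comp1_Id1_right[OF PQ(2)] emnd_Comp1_Id1_left[OF PQ(2)]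
          hcomp_id_right[OF PQ(3)] hcomp_id_left[OF PQ(3)])
  qed
  show "two_adjunction (UArr small) (EMnd small) Phi (Psi code) (comparison code) emnd_Id1"
  proof (rule two_adjunction.intro[OF Phi Psi unit counit two_adjunction_axioms.intro],
      unfold UArr_simps EMnd_simps Phi_simps Psi_simps, goal_cases)
    case (1 A)
    then show ?case
      by (simp add: Phi0_Psi0[OF Phi0] coded_arrow.Phi1_comparison[OF arrow]
          emnd_Comp1_Id1_left[OF emnd_cell1_Id1[OF Phi0]])
  next
    case (2 M)
    then show ?case
      by (simp add: Phi0_Psi0 Psi1_Id1[OF monad] coded_monad.comparison_Psi0[OF monad]
          uarr_Comp1_Id1_left[OF strict_1cell_Id1[OF coded_monad.universal_arrow_Psi0[OF monad]]])
  qed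
qed

end
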